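(* The following are true. (1) For every integer $n>0$ and every $r\in(0,1)$, $$\bar\chi\left(n,\frac{1-r}{2}\right)=\sum_{k=1}^{\lfloor 1/r\rfloor}\binom nk(1-kr)^{k-1}(kr)^{n-k},$$ and $\bar\chi(n,\cdot)$ is a continuous piecewise-polynomial function of the filtration radius on $(0,1/2)$. (2) For every integer $k\ge 0$, with $I_k=\left(\frac{k}{2k+2},\frac{k+1}{2k+4}\right)$, $$\lim_{n\to\infty}\ \sup_{r\in I_k}\frac{\bar\chi(n,r)}{n}=\frac{(k/e)^k}{(k+1)!}.$$ (3) Let $k\ge 1$ be an integer and let $\epsilon>0$. For all sufficiently large $n$, the following bounds hold simultaneously for all $r\in\left[\frac{k}{2k+2},\frac{k+1}{2k+4}\right)$: $$\frac{\bar\chi(n,r)}{n}-\epsilon\ \le\ \frac{\bar b_{2k}(n,r)}{n}\ \le\ \frac{\bar\chi(n,r)}{n}.$$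
   Context: The circle is $\mathbb S^1=[0,1]/(0\sim 1)$, of circumference $1$, with its intrinsic (arc-length) metric $d$. For a positive integer $n$, $\mathbf X_n$ is an i.i.d. sample of $n$ points drawn uniformly from $\mathbb S^1$. For a finite set $X\subset\mathbb S^1$ and $r>0$, the Cech complex $\check{C}(X,r)$ is the nerve of the closed arcs $\{y\in\mathbb S^1: d(x,y)\le r\}$, $x\in X$: its vertex set is $X$, and a nonempty subset $\sigma\subseteq X$ is a simplex iff the arcs of radius $r$ centered at the points of $\sigma$ have a common point. Define $$\bar\chi(n,r)=\mathbb E_{\mathbf X_n}\big[\chi(\check{C}(\mathbf X_n,r))\big],\qquad \bar b_k(n,r)=\mathbb E_{\mathbf X_n}\big[\dim H_k(\check{C}(\mathbf X_n,r))\big],$$ where $\chi$ is the Euler characteristic and $H_k$ is homology with coefficients in a field. Conventions: $0^0=1$, and $\binom nk=0$ for $k>n$ (such summands are $0$). *)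

theory Defs
  imports
    "HOL-Probability.Probability"
    "HOL-Library.Function_Algebras"
    "HOL-Computational_Algebra.Polynomial"
begin

section \<open>Dimension of a quotient vector space\<close>

text \<open>
  The classes of the elements of \<open>S\<close> form a finite basis of \<open>V / W\<close>: they are distinct and
  linearly independent modulo \<open>W\<close>, and they generate.
\<close>

definition quotient_basis ::
  "('f :: field \<Rightarrow> 'b :: ab_group_add \<Rightarrow> 'b) \<Rightarrow> 'b set \<Rightarrow> 'b set \<Rightarrow> 'b set \<Rightarrow> bool" where
  "quotient_basis sc V W S \<longleftrightarrow> finite S \<and> S \<subseteq> V \<and>
     (\<forall>a. (\<Sum>s\<in>S. sc (a s) s) \<in> W \<longrightarrow> (\<forall>s\<in>S. a s = 0)) \<and>
     (\<forall>v\<in>V. \<exists>a. v - (\<Sum>s\<in>S. sc (a s) s) \<in> W)"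

definition quotient_dim ::
  "('f :: field \<Rightarrow> 'b :: ab_group_add \<Rightarrow> 'b) \<Rightarrow> 'b set \<Rightarrow> 'b set \<Rightarrow> nat" where
  "quotient_dim sc V W = (THE m. \<exists>S. quotient_basis sc V W S \<and> card S = m)"

context vector_space
begin

lemma quotient_basis_card:
  assumes V: "subspace V" and W: "subspace W" and WV: "W \<subseteq> V"
    and F: "finite F" "V \<subseteq> span F" and S: "quotient_basis scale V W S"
  shows "card S + dim W = dim V"
proof -
  obtain B where B: "B \<subseteq> W" "independent B" "W \<subseteq> span B" "card B = dim W"
    using basis_exists by blast
  have finB: "finite B"
    using independent_span_bound[OF F(1) B(2)] B(1) WV F(2) by blast
  have finS: "finite S" and SV: "S \<subseteq> V" using S by (auto simp: quotient_basis_def)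
  have ind: "\<And>a. (\<Sum>s\<in>S. scale (a s) s) \<in> W \<Longrightarrow> \<forall>s\<in>S. a s = 0"
    using S by (auto simp: quotient_basis_def)
  have gen: "\<And>v. v \<in> V \<Longrightarrow> \<exists>a. v - (\<Sum>s\<in>S. scale (a s) s) \<in> W"
    using S by (auto simp: quotient_basis_def)
  have disj: "S \<inter> B = {}"
  proof (rule ccontr)
    assume "S \<inter> B \<noteq> {}"
    then obtain x where x: "x \<in> S" "x \<in> B" by blast
    have "(\<Sum>s\<in>S. scale (if s = x then 1 else 0) s) = (\<Sum>s\<in>S. if s = x then x else 0)"
      by (rule sum.cong) auto
    also have "\<dots> = x" using x finS by simp
    finally have "(\<Sum>s\<in>S. scale (if s = x then 1 else 0) s) \<in> W" using x B(1) by auto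
    from ind[OF this] x(1) show False by auto
  qed
  have indU: "independent (S \<union> B)"
  proof (rule independent_if_scalars_zero)
    show "finite (S \<union> B)" using finS finB by simp
  next
    fix f x assume sum0: "(\<Sum>x\<in>S \<union> B. scale (f x) x) = 0" and x: "x \<in> S \<union> B"
    have split: "(\<Sum>x\<in>S. scale (f x) x) + (\<Sum>x\<in>B. scale (f x) x) = 0"
      using sum0 by (simp add: sum.union_disjoint[OF finS finB disj])
    have BW: "(\<Sum>x\<in>B. scale (f x) x) \<in> W"
      by (intro subspace_sum[OF W] subspace_scale[OF W]) (use B(1) in auto)
    have "(\<Sum>x\<in>S. scale (f x) x) = - (\<Sum>x\<in>B. scale (f x) x)"
      using split by (simp add: add_eq_0_iff2)
    then have "(\<Sum>x\<in>S. scale (f x) x) \<in> W" using subspace_neg[OF W BW] by simp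
    then have S0: "\<forall>s\<in>S. f s = 0" by (rule ind)
    then have "(\<Sum>x\<in>B. scale (f x) x) = 0" using split by simp
    then have "\<forall>b\<in>B. f b = 0" using independentD[OF B(2) finB subset_refl] by blast
    with S0 x show "f x = 0" by blast
  qed
  have spanU: "V \<subseteq> span (S \<union> B)"
  proof
    fix v assume "v \<in> V"
    then obtain a where a: "v - (\<Sum>s\<in>S. scale (a s) s) \<in> W" using gen by blast
    have "v - (\<Sum>s\<in>S. scale (a s) s) \<in> span (S \<union> B)"
      using a B(3) span_mono[of B "S \<union> B"] by blast
    moreover have "(\<Sum>s\<in>S. scale (a s) s) \<in> span (S \<union> B)"
      by (intro span_sum span_scale span_base) auto
    ultimately show "v \<in> span (S \<union> B)" using span_add by fastforce
  qed
  have "card (S \<union> B) = dim V"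
    by (rule basis_card_eq_dim[OF _ spanU indU]) (use SV B(1) WV in auto)
  then show ?thesis using card_Un_disjoint[OF finS finB disj] B(4) by simp
qed

lemma quotient_basis_exists:
  assumes V: "subspace V" and W: "subspace W" and WV: "W \<subseteq> V"
    and F: "finite F" "V \<subseteq> span F"
  shows "\<exists>S. quotient_basis scale V W S"
proof -
  obtain B where B: "B \<subseteq> W" "independent B" "W \<subseteq> span B"
    by (rule basis_exists[of W])
  obtain C where C: "B \<subseteq> C" "C \<subseteq> V" "independent C" "V \<subseteq> span C"
    using maximal_independent_subset_extend[of B V] B WV by blast
  have finC: "finite C" using independent_span_bound[OF F(1) C(3)] C(2) F(2) by blast
  have WB: "W = span B" using B span_minimal[OF B(1) W] by blast
  let ?S = "C - B"
  have "\<forall>s\<in>?S. a s = 0" if a: "(\<Sum>s\<in>?S. scale (a s) s) \<in> W" for a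
  proof -
    have "finite B" using finC C(1) finite_subset by blast
    then obtain b where b: "(\<Sum>s\<in>?S. scale (a s) s) = (\<Sum>s\<in>B. scale (b s) s)"
      using a WB span_finite by auto
    let ?f = "\<lambda>s. if s \<in> B then - b s else a s"
    have "(\<Sum>s\<in>C. scale (?f s) s) = (\<Sum>s\<in>?S. scale (?f s) s) + (\<Sum>s\<in>B. scale (?f s) s)"
      by (rule sum.subset_diff[OF C(1) finC])
    also have "(\<Sum>s\<in>?S. scale (?f s) s) = (\<Sum>s\<in>?S. scale (a s) s)"
      by (rule sum.cong) auto
    also have "(\<Sum>s\<in>B. scale (?f s) s) = - (\<Sum>s\<in>B. scale (b s) s)"
      by (simp add: sum_negf)
    finally have "(\<Sum>s\<in>C. scale (?f s) s) = 0" using b by simp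
    from independentD[OF C(3) finC subset_refl this]
    have f0: "?f s = 0" if "s \<in> C" for s using that .
    show ?thesis using f0 by (metis DiffE)
  qed
  moreover have "\<exists>a. v - (\<Sum>s\<in>?S. scale (a s) s) \<in> W" if v: "v \<in> V" for v
  proof -
    obtain a where a: "v = (\<Sum>s\<in>C. scale (a s) s)"
      using v C(4) span_finite[OF finC] by auto
    have "v - (\<Sum>s\<in>?S. scale (a s) s) = (\<Sum>s\<in>B. scale (a s) s)"
      unfolding a using sum.subset_diff[OF C(1) finC, of "\<lambda>s. scale (a s) s"] by simp
    also have "\<dots> \<in> W" unfolding WB by (intro span_sum span_scale span_base) auto
    finally show ?thesis by (rule exI[of _ a])
  qed
  ultimately have "quotient_basis scale V W ?S"
    unfolding quotient_basis_def using finC C(2) by (intro conjI allI impI ballI) auto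
  then show ?thesis by blast
qed

lemma quotient_dim_eq:
  assumes "subspace V" "subspace W" "W \<subseteq> V" "finite F" "V \<subseteq> span F"
  shows "quotient_dim scale V W = dim V - dim W"
  unfolding quotient_dim_def
  using quotient_basis_exists[OF assms] quotient_basis_card[OF assms]
  by (intro the_equality) (metis add_diff_cancel_right')+

end

definition fun_scale :: "'f :: field \<Rightarrow> ('i \<Rightarrow> 'f) \<Rightarrow> 'i \<Rightarrow> 'f" where
  "fun_scale c f = (\<lambda>i. c * f i)"

global_interpretation fun_space: vector_space fun_scale
  by unfold_locales (auto simp: fun_scale_def fun_eq_iff algebra_simps)

section \<open>Finite abstract simplicial complexes\<close>

text \<open>
  A complex is the set of its simplices, which are nonempty finite sets of vertices; a
  simplex with \<open>k + 1\<close> vertices has dimension \<open>k\<close>.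
\<close>

definition euler_char :: "'a set set \<Rightarrow> int" where
  "euler_char K = (\<Sum>\<sigma>\<in>K. (-1) ^ (card \<sigma> - 1))"

definition chain_space :: "'a set set \<Rightarrow> nat \<Rightarrow> ('a set \<Rightarrow> 'f :: field) set" where
  "chain_space K k = {c. \<forall>\<sigma>. c \<sigma> \<noteq> 0 \<longrightarrow> \<sigma> \<in> K \<and> card \<sigma> = Suc k}"

text \<open>
  Simplices are oriented by the order on the vertices, so the face \<open>\<sigma> - {v}\<close> enters with the
  sign given by the position of \<open>v\<close> in \<open>\<sigma>\<close>. Homology is not reduced: the empty face of a
  vertex is dropped.
\<close>

definition boundary :: "'a :: linorder set set \<Rightarrow> ('a set \<Rightarrow> 'f :: field) \<Rightarrow> 'a set \<Rightarrow> 'f" where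
  "boundary K c \<tau> = (if \<tau> = {} then 0
     else \<Sum>\<sigma>\<in>K. \<Sum>v | v \<in> \<sigma> \<and> \<sigma> - {v} = \<tau>. (-1) ^ card {u\<in>\<sigma>. u < v} * c \<sigma>)"

definition cycles :: "'a :: linorder set set \<Rightarrow> nat \<Rightarrow> ('a set \<Rightarrow> 'f :: field) set" where
  "cycles K k = {c \<in> chain_space K k. boundary K c = 0}"

definition boundaries :: "'a :: linorder set set \<Rightarrow> nat \<Rightarrow> ('a set \<Rightarrow> 'f :: field) set" where
  "boundaries K k = boundary K ` chain_space K (Suc k)"

definition betti :: "'f :: field itself \<Rightarrow> 'a :: linorder set set \<Rightarrow> nat \<Rightarrow> nat" where
  "betti F K k = quotient_dim fun_scale (cycles K k :: ('a set \<Rightarrow> 'f) set) (boundaries K k)"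

section \<open>The Cech complex of a random sample of the circle\<close>

text \<open>The circle of circumference 1 is represented by the fundamental domain \<open>[0, 1)\<close>.\<close>

definition circle :: "real set" where
  "circle = {0..<1}"

definition circle_dist :: "real \<Rightarrow> real \<Rightarrow> real" where
  "circle_dist x y = min \<bar>x - y\<bar> (1 - \<bar>x - y\<bar>)"

definition closed_arc :: "real \<Rightarrow> real \<Rightarrow> real set" where
  "closed_arc x r = {y \<in> circle. circle_dist x y \<le> r}"

definition cech :: "real set \<Rightarrow> real \<Rightarrow> real set set" where
  "cech X r = {\<sigma>. \<sigma> \<subseteq> X \<and> \<sigma> \<noteq> {} \<and> (\<Inter>x\<in>\<sigma>. closed_arc x r) \<noteq> {}}"

definition circle_sample :: "nat \<Rightarrow> (nat \<Rightarrow> real) measure" where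
  "circle_sample n = PiM {..<n} (\<lambda>_. uniform_measure lborel circle)"

definition mean_euler_char :: "nat \<Rightarrow> real \<Rightarrow> real" where
  "mean_euler_char n r =
     (\<integral>\<omega>. real_of_int (euler_char (cech (\<omega> ` {..<n}) r)) \<partial>circle_sample n)"

definition mean_betti :: "'f :: field itself \<Rightarrow> nat \<Rightarrow> nat \<Rightarrow> real \<Rightarrow> real" where
  "mean_betti F k n r = (\<integral>\<omega>. real (betti F (cech (\<omega> ` {..<n}) r) k) \<partial>circle_sample n)"

definition piecewise_polynomial_on :: "real \<Rightarrow> real \<Rightarrow> (real \<Rightarrow> real) \<Rightarrow> bool" where
  "piecewise_polynomial_on a b f \<longleftrightarrow>
     (\<exists>(m :: nat) t. t 0 = a \<and> t m = b \<and> (\<forall>i<m. t i < t (Suc i)) \<and>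
        (\<forall>i<m. \<exists>p :: real poly. \<forall>x \<in> {t i..t (Suc i)} \<inter> {a<..<b}. f x = poly p x))"

end

theory Submission
  imports Defs "HOL-Real_Asymp.Real_Asymp"
begin

text \<open>
  Put \<open>s = 1 - 2 r\<close>. A set of points spans a simplex iff it leaves free a half-open arc of length
  \<open>s\<close>. Call a set \<open>I\<close> of sample points spread if its points have pairwise distance at least \<open>s\<close>
  and every other sample point lies less than \<open>s\<close> clockwise behind a point of \<open>I\<close>; let \<open>N\<^sub>m\<close> be
  the number of spread sets with \<open>m\<close> points. Removing the vertices one at a time and generating the
  cycles in the links, which are complexes of the same kind on a line, one finds that
  the reduced homology in degree \<open>2 k\<close> has dimension at most \<open>N\<^sub>k\<^sub>+\<^sub>1 - 1\<close>. Inclusion-exclusion over the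
  free arcs gives \<open>\<chi> = \<Sum>m. N\<^sub>m\<close>, so by Euler-Poincare these bounds are attained.

  The probability that \<open>m\<close> given points form a spread set is \<open>(1 - m s)\<^sup>m\<^sup>-\<^sup>1 (m s)\<^sup>n\<^sup>-\<^sup>m\<close>: the first
  factor is the volume of the configurations of pairwise distance at least \<open>s\<close>, and the remaining
  points have to fall into \<open>m\<close> disjoint arcs of length \<open>s\<close>. This yields the formula for the mean
  Euler characteristic. For \<open>1 / (k + 2) < s \<le> 1 / (k + 1)\<close> only \<open>N\<^sub>k\<^sub>+\<^sub>1\<close> has a mean of linear order,
  and its maximum over \<open>s\<close> is asymptotically \<open>n (k / e)\<^sup>k / (k + 1)!\<close>.
\<close>

text \<open>Spread sets are the periodic orbits of the clockwise map \<open>nxt s X\<close> that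
  wind once around the circle, and this dynamics controls how their number changes when a point is
  removed. For homology only upper bounds are proved, through one half-exact Mayer-Vietoris step
  comparing a complex with the deletion and the link of a vertex; no homotopy type is determined.
  This suffices because of a count without slack: the bounds allow the Euler characteristic to be at
  most 1 plus the sum of \<open>N\<^sub>m - 1\<close> over the nonzero \<open>N\<^sub>m\<close>, yet
  it equals the sum of all \<open>N\<^sub>m\<close>. The means are Bochner integrals, so
  measurability must be shown for every sample, including those with coinciding points or points
  outside \<open>[0, 1)\<close>; only the evaluation may ignore such null sets. The constant in the
  limit arises from \<open>y = 1 - (k + 1) * s\<close>: the mean number of spread sets with k + 1
  points is a binomial coefficient times \<open>y ^ k * (1 - y) ^ (n - k - 1)\<close>, which is
  largest near y = k / n, with value about \<open>(k / (e * n)) ^ k\<close>.\<close>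

section \<open>Generating cycles modulo boundaries\<close>

text \<open>
  The sign vanishes on infinite sets, which makes the relations between the operators below hold
  without finiteness assumptions.
\<close>

definition ins_sign :: "'a :: linorder \<Rightarrow> 'a set \<Rightarrow> 'f :: field" where
  "ins_sign v \<tau> = (if finite \<tau> then (-1) ^ card {u\<in>\<tau>. u < v} else 0)"

text \<open>Interior and exterior multiplication by \<open>v\<close> in the exterior algebra on the
  vertices: \<open>del_vertex v\<close> is the summand of the boundary that deletes
  \<open>v\<close>, and it yields a chain on the link of \<open>v\<close>;
  \<open>ins_vertex v\<close> is coning with apex \<open>v\<close>. Their anticommutation rules
  carry the sign computations of this section.\<close>

definition del_vertex :: "'a :: linorder \<Rightarrow> ('a set \<Rightarrow> 'f :: field) \<Rightarrow> 'a set \<Rightarrow> 'f" where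
  "del_vertex v c \<tau> = (if v \<in> \<tau> then 0 else ins_sign v \<tau> * c (insert v \<tau>))"

definition ins_vertex :: "'a :: linorder \<Rightarrow> ('a set \<Rightarrow> 'f :: field) \<Rightarrow> 'a set \<Rightarrow> 'f" where
  "ins_vertex v c \<tau> = (if v \<in> \<tau> then ins_sign v \<tau> * c (\<tau> - {v}) else 0)"

text \<open>The sum runs over an ambient vertex set \<open>A\<close> and not over the simplices of a
  complex, so that one operator serves a complex, its subcomplexes and the links of its
  vertices.\<close>

definition bd :: "'a :: linorder set \<Rightarrow> ('a set \<Rightarrow> 'f :: field) \<Rightarrow> 'a set \<Rightarrow> 'f" where
  "bd A c \<tau> = (\<Sum>v\<in>A. del_vertex v c \<tau>)"

lemma ins_sign_insert:
  assumes "u \<noteq> v" "u \<notin> \<tau>"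
  shows "(ins_sign v (insert u \<tau>) :: 'f :: field) = (if u < v then - ins_sign v \<tau> else ins_sign v \<tau>)"
proof -
  have "{w \<in> insert u \<tau>. w < v} = (if u < v then insert u {w\<in>\<tau>. w < v} else {w\<in>\<tau>. w < v})"
    by auto
  then show ?thesis using assms by (auto simp: ins_sign_def)
qed

lemma ins_sign_remove:
  assumes "u \<noteq> v" "u \<in> \<tau>"
  shows "(ins_sign v (\<tau> - {u}) :: 'f :: field) = (if u < v then - ins_sign v \<tau> else ins_sign v \<tau>)"
proof -
  have "insert u (\<tau> - {u}) = \<tau>" using assms(2) by blast
  then show ?thesis using ins_sign_insert[OF assms(1), of "\<tau> - {u}", where 'f='f] by simp
qed

lemma ins_sign_self: "(ins_sign v (insert v \<tau>) :: 'f :: field) = ins_sign v \<tau>"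
proof -
  have "{w \<in> insert v \<tau>. w < v} = {w\<in>\<tau>. w < v}" by auto
  then show ?thesis by (simp add: ins_sign_def)
qed

lemma ins_sign_square: "finite \<tau> \<Longrightarrow> ins_sign v \<tau> * ins_sign v \<tau> = (1 :: 'f :: field)"
  by (simp add: ins_sign_def flip: power_add)

lemma del_del: "del_vertex u (del_vertex v c) \<tau> = - del_vertex v (del_vertex u c) \<tau>"
proof (cases "u = v \<or> u \<in> \<tau> \<or> v \<in> \<tau>")
  case True then show ?thesis by (auto simp: del_vertex_def)
next
  case False
  then show ?thesis
    by (auto simp: del_vertex_def ins_sign_insert insert_commute not_less_iff_gr_or_eq)
qed

lemma del_ins: "u \<noteq> v \<Longrightarrow> del_vertex u (ins_vertex v c) \<tau> = - ins_vertex v (del_vertex u c) \<tau>"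
  by (cases "u \<in> \<tau>"; cases "v \<in> \<tau>")
    (auto simp: del_vertex_def ins_vertex_def ins_sign_insert ins_sign_remove insert_Diff_if
      not_less_iff_gr_or_eq)

lemma del_ins_same:
  "finite \<tau> \<Longrightarrow> del_vertex v (ins_vertex v c) \<tau> = (if v \<in> \<tau> then 0 else c \<tau>)"
  by (simp add: del_vertex_def ins_vertex_def ins_sign_self ins_sign_square mult.assoc[symmetric])

lemma ins_del_same:
  "finite \<tau> \<Longrightarrow> ins_vertex v (del_vertex v c) \<tau> = (if v \<in> \<tau> then c \<tau> else 0 :: 'f :: field)"
proof (cases "v \<in> \<tau>")
  case True
  assume fin: "finite \<tau>"
  have *: "insert v (\<tau> - {v}) = \<tau>" using True by blast
  have "ins_sign v (\<tau> - {v}) = (ins_sign v \<tau> :: 'f)"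
    using ins_sign_self[of v "\<tau> - {v}", where 'f='f] unfolding * by simp
  then show ?thesis using True ins_sign_square[OF fin, of v, where 'f='f]
    by (simp add: del_vertex_def ins_vertex_def insert_absorb mult.assoc[symmetric])
qed (simp add: ins_vertex_def)

lemma bd_insert: "finite A \<Longrightarrow> x \<notin> A \<Longrightarrow> bd (insert x A) c = del_vertex x c + bd A c"
  by (auto simp: bd_def fun_eq_iff)

lemma del_add: "del_vertex v (c + d) = del_vertex v c + del_vertex v d"
  by (auto simp: del_vertex_def fun_eq_iff algebra_simps)

lemma del_scale: "del_vertex v (fun_scale a c) = fun_scale a (del_vertex v c)"
  by (auto simp: del_vertex_def fun_eq_iff fun_scale_def)

lemma bd_add: "bd A (c + d) = bd A c + bd A d"
  by (auto simp: bd_def fun_eq_iff del_add sum.distrib)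

lemma bd_scale: "bd A (fun_scale a c) = fun_scale a (bd A c)"
  by (simp add: bd_def fun_eq_iff del_scale) (simp add: bd_def fun_scale_def sum_distrib_left)

lemma bd_zero [simp]: "bd A 0 = 0"
  by (simp add: bd_def fun_eq_iff del_vertex_def cong: if_cong)

lemma bd_uminus: "bd A (- c) = - bd A c"
  by (auto simp: bd_def del_vertex_def fun_eq_iff sum_negf[symmetric] intro!: sum.cong)

lemma del_bd: "finite A \<Longrightarrow> del_vertex v (bd A c) = - bd A (del_vertex v c)"
proof (rule ext)
  fix \<tau> assume "finite A"
  have "del_vertex v (bd A c) \<tau> = (\<Sum>u\<in>A. del_vertex v (del_vertex u c) \<tau>)"
    by (auto simp: bd_def del_vertex_def sum_distrib_left)
  also have "\<dots> = (\<Sum>u\<in>A. - del_vertex u (del_vertex v c) \<tau>)"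
    by (intro sum.cong refl del_del)
  finally show "del_vertex v (bd A c) \<tau> = (- bd A (del_vertex v c)) \<tau>"
    by (simp add: bd_def sum_negf)
qed

lemma bd_bd: "finite A \<Longrightarrow> bd A (bd A c) = 0"
proof (induction A arbitrary: c rule: finite_induct)
  case empty
  then show ?case by (auto simp: bd_def)
next
  case (insert x A)
  have "del_vertex x (del_vertex x c) = 0" by (auto simp: del_vertex_def fun_eq_iff)
  then show ?case
    by (simp only: bd_insert[OF insert.hyps] bd_add del_add del_bd[OF insert.hyps(1)] insert.IH) simp
qed

text \<open>Cartan's formula: coning with \<open>w\<close> is a contracting homotopy of the full
  simplex on \<open>A\<close>. Complexes closed under adding \<open>w\<close> inherit it, see
  \<open>gens_cone\<close>.\<close>

lemma bd_ins:
  assumes A: "finite A" "w \<in> A" and c: "\<And>\<sigma>. c \<sigma> \<noteq> 0 \<Longrightarrow> finite \<sigma>"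
  shows "bd A (ins_vertex w c) = c - ins_vertex w (bd A c)"
proof (rule ext)
  fix \<tau>
  show "bd A (ins_vertex w c) \<tau> = (c - ins_vertex w (bd A c)) \<tau>"
  proof (cases "finite \<tau>")
    case False
    then have "c \<tau> = 0" using c by blast
    with False show ?thesis
      by (simp add: bd_def del_vertex_def ins_vertex_def ins_sign_def cong: if_cong)
  next
    case True
    have "bd A (ins_vertex w c) \<tau>
      = del_vertex w (ins_vertex w c) \<tau> + (\<Sum>v\<in>A-{w}. del_vertex v (ins_vertex w c) \<tau>)"
      unfolding bd_def by (rule sum.remove[OF A])
    also have "(\<Sum>v\<in>A-{w}. del_vertex v (ins_vertex w c) \<tau>)
      = (\<Sum>v\<in>A-{w}. - ins_vertex w (del_vertex v c) \<tau>)"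
      by (intro sum.cong refl del_ins) auto
    also have "\<dots> = - ins_vertex w (bd (A-{w}) c) \<tau>"
      by (auto simp: ins_vertex_def bd_def sum_negf sum_distrib_left)
    also have "ins_vertex w (bd (A-{w}) c) \<tau> = ins_vertex w (bd A c) \<tau> - ins_vertex w (del_vertex w c) \<tau>"
      unfolding ins_vertex_def bd_def by (simp add: sum.remove[OF A] algebra_simps)
    finally show ?thesis using del_ins_same[OF True, of w c] ins_del_same[OF True, of w c] by simp
  qed
qed

section \<open>Generators of reduced homology under deletion of a vertex\<close>

definition chains :: "'a set set \<Rightarrow> nat \<Rightarrow> ('a set \<Rightarrow> 'f :: field) set" where
  "chains K p = {c. \<forall>\<sigma>. c \<sigma> \<noteq> 0 \<longrightarrow> \<sigma> \<in> K \<and> finite \<sigma> \<and> card \<sigma> = p}"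

text \<open>\<open>K\<close> may be void, and this differs from \<open>K = {{}}\<close>: a link can
  be either, and only the latter has homology, namely in degree -1.\<close>

definition simplicial :: "'a set \<Rightarrow> 'a set set \<Rightarrow> bool" where
  "simplicial A K \<longleftrightarrow> finite A \<and> K \<subseteq> Pow A \<and> (\<forall>\<sigma>\<in>K. \<forall>\<tau>\<subseteq>\<sigma>. \<tau> \<in> K)"

lemma chains_subspace: "fun_space.subspace (chains K p :: ('a set \<Rightarrow> 'f :: field) set)"
proof (rule fun_space.subspaceI)
  show "(0 :: 'a set \<Rightarrow> 'f) \<in> chains K p" by (simp add: chains_def)
next
  fix c d :: "'a set \<Rightarrow> 'f" assume "c \<in> chains K p" "d \<in> chains K p"
  moreover have "c \<sigma> \<noteq> 0 \<or> d \<sigma> \<noteq> 0" if "(c + d) \<sigma> \<noteq> 0" for \<sigma>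
    using that by (metis plus_fun_apply add.right_neutral)
  ultimately show "c + d \<in> chains K p" unfolding chains_def mem_Collect_eq by blast
next
  fix a and c :: "'a set \<Rightarrow> 'f" assume "c \<in> chains K p"
  then show "fun_scale a c \<in> chains K p" by (simp add: chains_def fun_scale_def)
qed

lemma chains_mono: "K \<subseteq> L \<Longrightarrow> chains K p \<subseteq> chains L p"
  by (auto simp: chains_def)

text \<open>
  The empty simplex is kept, so this is reduced homology; \<open>p\<close> counts the vertices of the
  simplices, one more than their dimension.
\<close>

definition gens :: "'f :: field itself \<Rightarrow> 'a :: linorder set \<Rightarrow> 'a set set \<Rightarrow> nat \<Rightarrow> nat \<Rightarrow> bool" where
  "gens _ A K p m \<longleftrightarrow> (\<exists>S :: ('a set \<Rightarrow> 'f) set. finite S \<and> card S \<le> m \<and>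
     (\<forall>c\<in>chains K p. bd A c = 0 \<longrightarrow>
        (\<exists>a. \<exists>b\<in>chains K (Suc p). c = (\<Sum>s\<in>S. fun_scale (a s) s) + bd A b)))"

lemma gens_mono: "gens F A K p m \<Longrightarrow> m \<le> m' \<Longrightarrow> gens F A K p m'"
  unfolding gens_def by (elim exE conjE, rule exI) (intro conjI, assumption, simp, assumption)

lemma gens_zero_iff:
  "gens TYPE('f :: field) A K p 0 \<longleftrightarrow>
    (\<forall>c\<in>chains K p. bd A (c :: 'a :: linorder set \<Rightarrow> 'f) = 0 \<longrightarrow> (\<exists>b\<in>chains K (Suc p). c = bd A b))"
proof -
  have *: "(\<exists>S :: ('a set \<Rightarrow> 'f) set. finite S \<and> card S \<le> 0 \<and> P S) = P {}" for P
    by auto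
  show ?thesis unfolding gens_def * by simp
qed

lemma gens_cone:
  assumes A: "finite A" "w \<in> A" and K: "\<And>\<sigma>. \<sigma> \<in> K \<Longrightarrow> insert w \<sigma> \<in> K"
  shows "gens TYPE('f :: field) A K p 0"
  unfolding gens_zero_iff
proof (intro ballI impI)
  fix c :: "'a set \<Rightarrow> 'f" assume c: "c \<in> chains K p" "bd A c = 0"
  have "ins_vertex w c \<in> chains K (Suc p)"
    unfolding chains_def
  proof safe
    fix \<sigma> assume "ins_vertex w c \<sigma> \<noteq> 0"
    then have "w \<in> \<sigma>" "finite \<sigma>" "c (\<sigma> - {w}) \<noteq> 0"
      by (auto simp: ins_vertex_def ins_sign_def split: if_splits)
    moreover from this have *: "\<sigma> - {w} \<in> K" "card (\<sigma> - {w}) = p" using c(1) by (simp_all add: chains_def)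
    moreover have "insert w (\<sigma> - {w}) = \<sigma>" using \<open>w \<in> \<sigma>\<close> by blast
    moreover note card_Suc_Diff1[of \<sigma> w]
    ultimately show "\<sigma> \<in> K" "finite \<sigma>" "card \<sigma> = Suc p"
      using K[OF *(1)] by metis+
  qed
  moreover have "bd A (ins_vertex w c) = c"
  proof -
    have "ins_vertex w (bd A c) = 0" by (simp add: c(2) ins_vertex_def fun_eq_iff)
    moreover have "finite \<sigma>" if "c \<sigma> \<noteq> 0" for \<sigma> using c(1) that by (simp add: chains_def)
    ultimately show ?thesis using bd_ins[OF A, of c] by simp
  qed
  ultimately show "\<exists>b\<in>chains K (Suc p). c = bd A b" by metis
qed

text \<open>The complexes without vertices. The class of the empty simplex in \<open>{{}}\<close> is
  the one from which all classes in higher degrees are built by passing from links to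
  complexes.\<close>

lemma gens_subset_empty:
  assumes "K \<subseteq> {{}}"
  shows "gens TYPE('f :: field) A (K :: 'a :: linorder set set) p (if p = 0 \<and> K \<noteq> {} then 1 else 0)"
proof (cases "p = 0 \<and> K \<noteq> {}")
  case False
  have "c = 0" if "c \<in> chains K p" for c :: "'a set \<Rightarrow> 'f"
  proof (rule ext)
    fix \<sigma>
    have "c \<sigma> \<noteq> 0 \<Longrightarrow> \<sigma> = {} \<and> \<sigma> \<in> K \<and> card \<sigma> = p"
      using that assms unfolding chains_def by blast
    then have "c \<sigma> = 0" using False by fastforce
    then show "c \<sigma> = 0 \<sigma>" by simp
  qed
  moreover have "0 \<in> chains K (Suc p)" by (auto simp: chains_def)
  ultimately have "gens TYPE('f) A K p 0" unfolding gens_zero_iff by (metis bd_zero)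
  with False show ?thesis by (simp only: if_False)
next
  case True
  let ?e = "\<lambda>\<sigma>. if \<sigma> = {} then 1 else 0 :: 'f"
  have "\<exists>a. \<exists>b\<in>chains K (Suc p). c = (\<Sum>s\<in>{?e}. fun_scale (a s) s) + bd A b"
    if c: "c \<in> chains K p" for c :: "'a set \<Rightarrow> 'f"
  proof (intro exI bexI)
    show "0 \<in> chains K (Suc p)" by (auto simp: chains_def)
    show "c = (\<Sum>s\<in>{?e}. fun_scale (c {}) s) + bd A 0"
      using c assms by (auto simp: chains_def fun_scale_def fun_eq_iff)
  qed
  then have "gens TYPE('f) A K p 1"
    unfolding gens_def by (intro exI[of _ "{?e}"] conjI ballI impI) (simp, simp, blast)
  then show ?thesis by (simp only: if_P[OF True])
qed

text \<open>In degree -1 the only simplex is the empty one, which survives every deletion; adding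
  \<open>v\<close> back can only create further boundaries.\<close>

lemma gens_remove_zero:
  assumes K: "simplicial A K" and "gens F A {\<sigma>\<in>K. v \<notin> \<sigma>} 0 m"
  shows "gens F A K 0 m"
proof -
  have *: "chains K 0 = (chains {\<sigma>\<in>K. v \<notin> \<sigma>} 0 :: ('a set \<Rightarrow> 'b) set)"
    by (auto simp: chains_def)
  have sub: "chains {\<sigma>\<in>K. v \<notin> \<sigma>} (Suc 0) \<subseteq> (chains K (Suc 0) :: ('a set \<Rightarrow> 'b) set)"
    by (rule chains_mono) blast
  obtain S :: "('a set \<Rightarrow> 'b) set" where S: "finite S" "card S \<le> m"
    "\<forall>c\<in>chains K 0. bd A c = 0 \<longrightarrow> (\<exists>a. \<exists>b\<in>chains {\<sigma>\<in>K. v \<notin> \<sigma>} (Suc 0).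
      c = (\<Sum>s\<in>S. fun_scale (a s) s) + bd A b)"
    using assms(2) unfolding gens_def * by blast
  show ?thesis unfolding gens_def
  proof (intro exI[of _ S] conjI ballI impI S(1,2))
    fix c :: "'a set \<Rightarrow> 'b" assume "c \<in> chains K 0" "bd A c = 0"
    then show "\<exists>a. \<exists>b\<in>chains K (Suc 0). c = (\<Sum>s\<in>S. fun_scale (a s) s) + bd A b"
      using S(3) sub by (meson in_mono)
  qed
qed

text \<open>Exactness of the Mayer-Vietoris sequence at the homology of \<open>K\<close>, where
  \<open>K\<close> is the union of the deletion of \<open>v\<close> and the cone over the link of
  \<open>v\<close>: a cycle whose link part bounds in the link can be pushed off
  \<open>v\<close>.\<close>

lemma link_cycle_boundary:
  assumes K: "simplicial A K" and v: "v \<in> A"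
    and c: "c \<in> chains K (Suc p)" "bd A c = 0"
    and b: "b \<in> chains {\<sigma>. v \<notin> \<sigma> \<and> insert v \<sigma> \<in> K} (Suc p)" "del_vertex v c = bd A b"
  shows "\<exists>d\<in>chains {\<sigma>\<in>K. v \<notin> \<sigma>} (Suc p). \<exists>b'\<in>chains K (Suc (Suc p)). bd A d = 0 \<and> c = d + bd A b'"
proof -
  have A: "finite A" using K by (simp add: simplicial_def)
  let ?c0 = "\<lambda>\<sigma>. if v \<in> \<sigma> then 0 else c \<sigma>"
  have fb: "finite \<sigma>" if "b \<sigma> \<noteq> 0" for \<sigma> using b that by (auto simp: chains_def)
  have "c = ?c0 + ins_vertex v (del_vertex v c)"
  proof (rule ext)
    fix \<sigma> show "c \<sigma> = (?c0 + ins_vertex v (del_vertex v c)) \<sigma>"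
    proof (cases "finite \<sigma>")
      case True then show ?thesis by (simp add: ins_del_same)
    next
      case False then show ?thesis using c(1) by (auto simp: chains_def ins_vertex_def ins_sign_def)
    qed
  qed
  then have c0: "c = ?c0 + ins_vertex v (bd A b)" by (simp only: b(2))
  have eb: "bd A (ins_vertex v b) = b - ins_vertex v (bd A b)" by (rule bd_ins[OF A v fb])
  \<comment> \<open>Subtracting the boundary of the cone over \<open>b\<close> trades the part of
    \<open>c\<close> through \<open>v\<close> for \<open>b\<close> itself, and \<open>b\<close>
    avoids \<open>v\<close>.\<close>
  have eq: "c = (?c0 + b) + bd A (- ins_vertex v b)"
    unfolding bd_uminus eb by (subst c0) simp
  have "?c0 \<in> chains {\<sigma>\<in>K. v \<notin> \<sigma>} (Suc p)" using c(1) by (auto simp: chains_def)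
  moreover have "b \<in> chains {\<sigma>\<in>K. v \<notin> \<sigma>} (Suc p)"
  proof -
    have "{\<sigma>. v \<notin> \<sigma> \<and> insert v \<sigma> \<in> K} \<subseteq> {\<sigma>\<in>K. v \<notin> \<sigma>}"
      using K unfolding simplicial_def by blast
    from chains_mono[OF this] b(1) show ?thesis by blast
  qed
  ultimately have d: "?c0 + b \<in> chains {\<sigma>\<in>K. v \<notin> \<sigma>} (Suc p)"
    by (rule fun_space.subspace_add[OF chains_subspace])
  have "bd A (?c0 + b) = bd A (?c0 + b) + bd A (bd A (- ins_vertex v b))"
    by (simp only: bd_bd[OF A]) simp
  also have "\<dots> = bd A c" by (simp only: bd_add[symmetric] eq[symmetric])
  finally have "bd A (?c0 + b) = 0" using c(2) by (rule trans)
  moreover have "- ins_vertex v b \<in> chains K (Suc (Suc p))"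
    unfolding chains_def
  proof safe
    fix \<sigma> assume "(- ins_vertex v b) \<sigma> \<noteq> 0"
    then have *: "v \<in> \<sigma>" "finite \<sigma>" "b (\<sigma> - {v}) \<noteq> 0"
      by (auto simp: ins_vertex_def ins_sign_def split: if_splits)
    then have "insert v (\<sigma> - {v}) \<in> K" "card (\<sigma> - {v}) = Suc p"
      using b(1) unfolding chains_def by blast+
    moreover have "insert v (\<sigma> - {v}) = \<sigma>" using * by blast
    moreover note card_Suc_Diff1[of \<sigma> v]
    ultimately show "\<sigma> \<in> K" "finite \<sigma>" "card \<sigma> = Suc (Suc p)"
      using * by metis+
  qed
  ultimately show ?thesis using d eq by blast
qed

lemma del_vertex_link:
  assumes K: "simplicial A K" and c: "c \<in> chains K (Suc p)" "bd A c = 0"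
  shows "del_vertex v c \<in> chains {\<sigma>. v \<notin> \<sigma> \<and> insert v \<sigma> \<in> K} p" "bd A (del_vertex v c) = 0"
proof -
  show "del_vertex v c \<in> chains {\<sigma>. v \<notin> \<sigma> \<and> insert v \<sigma> \<in> K} p"
    unfolding chains_def
  proof safe
    fix \<sigma> assume "del_vertex v c \<sigma> \<noteq> 0"
    then have *: "v \<notin> \<sigma>" "finite \<sigma>" "c (insert v \<sigma>) \<noteq> 0"
      by (auto simp: del_vertex_def ins_sign_def split: if_splits)
    then show "finite \<sigma>" "v \<in> \<sigma> \<Longrightarrow> False" "insert v \<sigma> \<in> K" "card \<sigma> = p"
      using c(1) by (auto simp: chains_def) 
  qed
  show "bd A (del_vertex v c) = 0"
  proof -
    have "finite A" using K by (simp add: simplicial_def)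
    from del_bd[OF this, of v c] have "bd A (del_vertex v c) = - del_vertex v 0" by (simp add: c(2))
    then show ?thesis by (simp add: del_vertex_def fun_eq_iff cong: if_cong)
  qed
qed

text \<open>The dimension count of the same exact sequence. Since the link has at most one
  generator, a single cycle \<open>g\<close> with nontrivial link class is enough: every other cycle
  has its link class killed by a multiple of \<open>g\<close> and then falls under
  \<open>link_cycle_boundary\<close>.\<close>

lemma gens_remove:
  assumes K: "simplicial A K" and v: "v \<in> A"
    and dl: "gens TYPE('f :: field) A {\<sigma>\<in>K. v \<notin> \<sigma>} (Suc p) m"
    and lk: "gens TYPE('f) A {\<sigma>. v \<notin> \<sigma> \<and> insert v \<sigma> \<in> K} p m'" and m': "m' \<le> 1"
  shows "gens TYPE('f) A K (Suc p) (m + m')"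
proof -
  let ?D = "{\<sigma>\<in>K. v \<notin> \<sigma>}" and ?L = "{\<sigma>. v \<notin> \<sigma> \<and> insert v \<sigma> \<in> K}"
  let ?cyc = "\<lambda>c :: 'a set \<Rightarrow> 'f. c \<in> chains K (Suc p) \<and> bd A c = 0"
  let ?null = "\<lambda>c. \<exists>b\<in>chains ?L (Suc p). del_vertex v c = bd A b"
  obtain S :: "('a set \<Rightarrow> 'f) set" where S: "finite S" "card S \<le> m"
    "\<And>c. c \<in> chains ?D (Suc p) \<Longrightarrow> bd A c = 0 \<Longrightarrow>
      \<exists>a. \<exists>b\<in>chains ?D (Suc (Suc p)). c = (\<Sum>s\<in>S. fun_scale (a s) s) + bd A b"
    using dl unfolding gens_def by blast
  obtain T :: "('a set \<Rightarrow> 'f) set" where T: "finite T" "card T \<le> m'"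
    "\<And>c. c \<in> chains ?L p \<Longrightarrow> bd A c = 0 \<Longrightarrow>
      \<exists>a. \<exists>b\<in>chains ?L (Suc p). c = (\<Sum>s\<in>T. fun_scale (a s) s) + bd A b"
    using lk unfolding gens_def by blast
  have null: "\<exists>a. \<exists>b\<in>chains K (Suc (Suc p)). c = (\<Sum>s\<in>S. fun_scale (a s) s) + bd A b"
    if c: "?cyc c" "?null c" for c
  proof -
    obtain d b where d: "d \<in> chains ?D (Suc p)" "b \<in> chains K (Suc (Suc p))" "bd A d = 0" "c = d + bd A b"
      using link_cycle_boundary[OF K v] c by blast
    obtain a b' where b': "b' \<in> chains ?D (Suc (Suc p))" "d = (\<Sum>s\<in>S. fun_scale (a s) s) + bd A b'"
      using S(3)[OF d(1,3)] by blast
    have "b' \<in> chains K (Suc (Suc p))" using b'(1) chains_mono[of ?D K] by blast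
    then have "b' + b \<in> chains K (Suc (Suc p))"
      using d(2) by (rule fun_space.subspace_add[OF chains_subspace])
    moreover have "c = (\<Sum>s\<in>S. fun_scale (a s) s) + bd A (b' + b)"
      using d(4) b'(2) by (simp add: bd_add algebra_simps)
    ultimately show ?thesis by blast
  qed
  show ?thesis
  proof (cases "\<forall>c. ?cyc c \<longrightarrow> ?null c")
    case True
    then have "gens TYPE('f) A K (Suc p) m"
      unfolding gens_def using S(1,2) by (intro exI[of _ S] conjI ballI impI null) blast+
    then show ?thesis by (rule gens_mono) simp
  next
    case False
    then obtain g where g: "?cyc g" "\<not> ?null g" by blast
    have "T \<noteq> {}" using g T(3)[OF del_vertex_link[OF K]] by fastforce
    then obtain t where t: "T = {t}" "m' = 1"
      using T(1,2) m' by (metis One_nat_def card_0_eq card_1_singletonE le_antisym le_zero_eq not_less_eq_eq)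
    have ex: "\<exists>l. \<exists>b\<in>chains ?L (Suc p). del_vertex v c = fun_scale l t + bd A b" if "?cyc c" for c
      using T(3)[OF del_vertex_link[OF K]] that t(1) by fastforce
    obtain l b where lb: "b \<in> chains ?L (Suc p)" "del_vertex v g = fun_scale l t + bd A b"
      using ex[OF g(1)] by blast
    have l: "l \<noteq> 0" using g(2) lb by (auto simp: fun_scale_def zero_fun_def[symmetric])
    have main: "\<exists>a. \<exists>b\<in>chains K (Suc (Suc p)). c = (\<Sum>s\<in>S \<union> {g}. fun_scale (a s) s) + bd A b"
      if c: "?cyc c" for c
    proof -
      obtain l' b' where lb': "b' \<in> chains ?L (Suc p)" "del_vertex v c = fun_scale l' t + bd A b'"
        using ex[OF c] by blast
      \<comment> \<open>Chosen so that the multiples of \<open>t\<close> in the link parts of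
        \<open>c\<close> and of the multiple of \<open>g\<close> cancel.\<close>
      let ?q = "- (l' / l)"
      let ?c = "c + fun_scale ?q g"
      have "?cyc ?c"
      proof
        show "?c \<in> chains K (Suc p)"
          using c g(1) by (intro fun_space.subspace_add[OF chains_subspace]
              fun_space.subspace_scale[OF chains_subspace]) auto
        show "bd A ?c = 0" using c g(1) by (simp only: bd_add bd_scale) simp
      qed
      moreover have "?null ?c"
      proof
        show "b' + fun_scale ?q b \<in> chains ?L (Suc p)"
          using lb(1) lb'(1) by (intro fun_space.subspace_add[OF chains_subspace]
              fun_space.subspace_scale[OF chains_subspace])
        show "del_vertex v ?c = bd A (b' + fun_scale ?q b)"
          unfolding del_add del_scale lb(2) lb'(2) bd_add bd_scale
          using l by (simp add: fun_eq_iff fun_scale_def field_simps)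
      qed
      ultimately obtain a b'' where b'': "b'' \<in> chains K (Suc (Suc p))"
        "?c = (\<Sum>s\<in>S. fun_scale (a s) s) + bd A b''" using null by blast
      have cc: "c = (\<Sum>s\<in>S. fun_scale (a s) s) + fun_scale (l'/l) g + bd A b''"
        using b''(2) by (auto simp: fun_eq_iff fun_scale_def algebra_simps)
      \<comment> \<open>Generators form a set, so \<open>g\<close> may already occur in
        \<open>S\<close>; its coefficients then have to be added up.\<close>
      have "\<exists>a'. (\<Sum>s\<in>S. fun_scale (a s) s) + fun_scale (l'/l) g = (\<Sum>s\<in>S \<union> {g}. fun_scale (a' s) s)"
      proof (cases "g \<in> S")
        case True
        let ?a = "a(g := a g + l'/l)"
        have 1: "(\<Sum>s\<in>S \<union> {g}. fun_scale (?a s) s)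
          = fun_scale (?a g) g + (\<Sum>s\<in>S-{g}. fun_scale (?a s) s)"
          using sum.remove[OF S(1) True, of "\<lambda>s. fun_scale (?a s) s"] True by (simp only: insert_absorb Un_insert_right Un_empty_right)
        have 2: "(\<Sum>s\<in>S-{g}. fun_scale (?a s) s) = (\<Sum>s\<in>S-{g}. fun_scale (a s) s)"
          by (rule sum.cong) auto
        have 3: "fun_scale (?a g) g = fun_scale (a g) g + fun_scale (l'/l) g"
          by (simp add: fun_space.scale_left_distrib)
        show ?thesis
          by (rule exI[of _ ?a], unfold 1 2 3 sum.remove[OF S(1) True, of "\<lambda>s. fun_scale (a s) s"])
            (simp only: add_ac)
      next
        case False
        have "(\<Sum>s\<in>S. fun_scale ((a(g := l'/l)) s) s) = (\<Sum>s\<in>S. fun_scale (a s) s)"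
          using False by (intro sum.cong) auto
        then show ?thesis using False S(1)
          by (intro exI[of _ "a(g := l'/l)"]) (simp add: add.commute)
      qed
      then obtain a' where "(\<Sum>s\<in>S. fun_scale (a s) s) + fun_scale (l'/l) g
        = (\<Sum>s\<in>S \<union> {g}. fun_scale (a' s) s)" ..
      with cc have "c = (\<Sum>s\<in>S \<union> {g}. fun_scale (a' s) s) + bd A b''" by (simp only:)
      then show ?thesis using b''(1) by blast
    qed
    have "card (S \<union> {g}) \<le> m + m'" using S(1,2) t(2) by (simp add: card_insert_if)
    moreover have "finite (S \<union> {g})" using S(1) by simp
    ultimately show ?thesis
      unfolding gens_def by (intro exI[of _ "S \<union> {g}"] conjI ballI impI main) blast+
  qed
qed

section \<open>Dimensions of cycles and boundaries\<close>

context vector_space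
begin

text \<open>Rank and nullity: a basis of \<open>V\<close> modulo the kernel, as supplied by
  \<open>quotient_basis\<close>, is mapped bijectively onto a basis of the image.\<close>

lemma dim_kernel_image:
  assumes V: "subspace V" "finite F" "V \<subseteq> span F"
    and add: "\<And>x y. f (x + y) = f x + f y" and sc: "\<And>c x. f (scale c x) = scale c (f x)"
  shows "dim V = dim {x\<in>V. f x = 0} + dim (f ` V)"
proof -
  let ?W = "{x\<in>V. f x = 0}"
  have f0: "f 0 = 0" using add[of 0 0] by simp
  have fsum: "f (\<Sum>s\<in>S. scale (a s) s) = (\<Sum>s\<in>S. scale (a s) (f s))" if "finite S" for S a
    using that by induction (simp_all add: f0 add sc)
  have W: "subspace ?W"
    using V(1) by (auto simp: subspace_def f0 add sc)
  obtain S where S: "quotient_basis scale V ?W S"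
    using quotient_basis_exists[OF V(1) W _ V(2,3)] by blast
  have card: "card S + dim ?W = dim V"
    by (rule quotient_basis_card[OF V(1) W _ V(2,3) S]) blast
  have finS: "finite S" and SV: "S \<subseteq> V"
    and ind: "\<And>a. (\<Sum>s\<in>S. scale (a s) s) \<in> ?W \<Longrightarrow> \<forall>s\<in>S. a s = 0"
    and gen: "\<And>v. v \<in> V \<Longrightarrow> \<exists>a. v - (\<Sum>s\<in>S. scale (a s) s) \<in> ?W"
    using S by (auto simp: quotient_basis_def)
  have SinV: "(\<Sum>s\<in>S. scale (a s) s) \<in> V" for a
    using SV by (intro subspace_sum[OF V(1)] subspace_scale[OF V(1)]) blast
  have inj: "inj_on f S"
  proof (rule inj_onI)
    fix s t assume st: "s \<in> S" "t \<in> S" "f s = f t"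
    show "s = t"
    proof (rule ccontr)
      assume ne: "s \<noteq> t"
      let ?a = "\<lambda>x. if x = s then 1 else if x = t then - 1 else 0"
      have "f (\<Sum>x\<in>S. scale (?a x) x) = (\<Sum>x\<in>S. scale (?a x) (f x))" by (rule fsum[OF finS])
      also have "\<dots> = (\<Sum>x\<in>S. (if x = s then f s else 0) + (if x = t then - f t else 0))"
        using ne by (intro sum.cong refl) auto
      also have "\<dots> = f s - f t" using st(1,2) finS by (simp add: sum.distrib)
      finally have "(\<Sum>x\<in>S. scale (?a x) x) \<in> ?W" using st(3) SinV by simp
      from ind[OF this] st(1) show False by auto
    qed
  qed
  have indep: "independent (f ` S)"
  proof (rule independent_if_scalars_zero)
    fix u y assume u: "(\<Sum>y\<in>f ` S. scale (u y) y) = 0" and y: "y \<in> f ` S"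
    have "f (\<Sum>s\<in>S. scale (u (f s)) s) = (\<Sum>s\<in>S. scale (u (f s)) (f s))"
      using fsum[OF finS] .
    also have "\<dots> = 0" using u by (simp add: sum.reindex[OF inj])
    finally have "(\<Sum>s\<in>S. scale (u (f s)) s) \<in> ?W" using SinV by simp
    from ind[OF this] y show "u y = 0" by auto
  qed (use finS in simp)
  have "f ` V \<subseteq> span (f ` S)"
  proof (rule image_subsetI)
    fix v assume "v \<in> V"
    then obtain a where a: "v - (\<Sum>s\<in>S. scale (a s) s) \<in> ?W" using gen by blast
    have "f v = f ((v - (\<Sum>s\<in>S. scale (a s) s)) + (\<Sum>s\<in>S. scale (a s) s))" by simp
    also have "\<dots> = (\<Sum>s\<in>S. scale (a s) (f s))" using a by (simp only: add fsum[OF finS]) simp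
    finally show "f v \<in> span (f ` S)" by (simp add: span_sum span_scale span_base)
  qed
  then have "card (f ` S) = dim (f ` V)"
    using SV by (intro basis_card_eq_dim[OF _ _ indep]) auto
  then show ?thesis using card card_image[OF inj] by simp
qed

end

section \<open>Cycle and boundary spaces, and the Euler-Poincare formula\<close>

definition cyc :: "'a :: linorder set \<Rightarrow> 'a set set \<Rightarrow> nat \<Rightarrow> ('a set \<Rightarrow> 'f :: field) set" where
  "cyc A K p = {c \<in> chains K p. bd A c = 0}"

definition bdy :: "'a :: linorder set \<Rightarrow> 'a set set \<Rightarrow> nat \<Rightarrow> ('a set \<Rightarrow> 'f :: field) set" where
  "bdy A K p = bd A ` chains K (Suc p)"

definition unit_chain :: "'a set \<Rightarrow> 'a set \<Rightarrow> 'f :: field" where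
  "unit_chain \<sigma> = (\<lambda>\<tau>. if \<tau> = \<sigma> then 1 else 0)"

lemma simplicial_finite: "simplicial A K \<Longrightarrow> finite K" "simplicial A K \<Longrightarrow> \<sigma> \<in> K \<Longrightarrow> finite \<sigma>"
  unfolding simplicial_def by (metis finite_Pow_iff finite_subset, metis PowD finite_subset subsetD)

lemma unit_chain_expand:
  assumes "finite P" "\<And>\<tau>. c \<tau> \<noteq> 0 \<Longrightarrow> \<tau> \<in> P"
  shows "c = (\<Sum>\<sigma>\<in>P. fun_scale (c \<sigma>) (unit_chain \<sigma>))"
proof (rule ext)
  fix \<tau>
  have "(\<Sum>\<sigma>\<in>P. fun_scale (c \<sigma>) (unit_chain \<sigma>)) \<tau> = (\<Sum>\<sigma>\<in>P. c \<sigma> * (if \<tau> = \<sigma> then 1 else 0))"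
    using assms(1) by (induction P rule: finite_induct) (simp_all add: fun_scale_def unit_chain_def)
  also have "\<dots> = (\<Sum>\<sigma>\<in>P. if \<tau> = \<sigma> then c \<sigma> else 0)" by (rule sum.cong) auto
  also have "\<dots> = c \<tau>" using assms by auto
  finally show "c \<tau> = (\<Sum>\<sigma>\<in>P. fun_scale (c \<sigma>) (unit_chain \<sigma>)) \<tau>" by simp
qed

lemma inj_unit_chain: "inj (unit_chain :: 'a set \<Rightarrow> 'a set \<Rightarrow> 'f :: field)"
proof (rule injI)
  fix \<sigma> \<tau> :: "'a set" assume "(unit_chain \<sigma> :: 'a set \<Rightarrow> 'f) = unit_chain \<tau>"
  then have "unit_chain \<sigma> \<sigma> = (unit_chain \<tau> \<sigma> :: 'f)" by simp
  then show "\<sigma> = \<tau>" by (simp add: unit_chain_def split: if_splits)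
qed

lemma chains_span:
  assumes "simplicial A K"
  shows "(chains K p :: ('a set \<Rightarrow> 'f :: field) set) \<subseteq> fun_space.span (unit_chain ` {\<sigma>\<in>K. card \<sigma> = p})"
proof
  fix c :: "'a set \<Rightarrow> 'f" assume c: "c \<in> chains K p"
  let ?P = "{\<sigma>\<in>K. card \<sigma> = p}"
  have eq: "c = (\<Sum>\<sigma>\<in>?P. fun_scale (c \<sigma>) (unit_chain \<sigma>))"
    using simplicial_finite(1)[OF assms] c by (intro unit_chain_expand) (simp_all add: chains_def)
  show "c \<in> fun_space.span (unit_chain ` ?P)"
    by (subst eq) (intro fun_space.span_sum fun_space.span_scale fun_space.span_base imageI)
qed

lemma dim_chains:
  assumes K: "simplicial A K"
  shows "fun_space.dim (chains K p :: ('a set \<Rightarrow> 'f :: field) set) = card {\<sigma>\<in>K. card \<sigma> = p}"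
proof -
  let ?P = "{\<sigma>\<in>K. card \<sigma> = p}"
  let ?U = "unit_chain ` ?P :: ('a set \<Rightarrow> 'f) set"
  have fin: "finite ?P" using simplicial_finite(1)[OF K] by simp
  have inj: "inj_on (unit_chain :: 'a set \<Rightarrow> 'a set \<Rightarrow> 'f) ?P"
    by (rule inj_on_subset[OF inj_unit_chain subset_UNIV])
  have "fun_space.independent ?U"
  proof (rule fun_space.independent_if_scalars_zero)
    fix u :: "('a set \<Rightarrow> 'f) \<Rightarrow> 'f" and y
    assume u: "(\<Sum>y\<in>?U. fun_scale (u y) y) = 0" and y: "y \<in> ?U"
    let ?c = "\<lambda>\<sigma>. if \<sigma> \<in> ?P then u (unit_chain \<sigma>) else 0"
    obtain \<sigma> where \<sigma>: "\<sigma> \<in> ?P" "y = unit_chain \<sigma>" using y by blast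
    have "?c = (\<Sum>\<sigma>\<in>?P. fun_scale (?c \<sigma>) (unit_chain \<sigma>))"
      using fin by (intro unit_chain_expand) (simp_all split: if_splits)
    also have "\<dots> = (\<Sum>\<sigma>\<in>?P. fun_scale (u (unit_chain \<sigma>)) (unit_chain \<sigma>))"
      by (rule sum.cong) auto
    also have "\<dots> = 0" using u by (simp add: sum.reindex[OF inj])
    finally have "?c \<sigma> = 0" by (simp add: fun_eq_iff)
    then show "u y = 0" using \<sigma> by simp
  qed (use fin in simp)
  moreover have "?U \<subseteq> chains K p"
    using simplicial_finite(2)[OF K] by (auto simp: chains_def unit_chain_def split: if_splits)
  ultimately have "card ?U = fun_space.dim (chains K p :: ('a set \<Rightarrow> 'f) set)"
    by (intro fun_space.basis_card_eq_dim chains_span[OF K])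
  then show ?thesis using card_image[OF inj] by simp
qed

lemma bd_chains:
  assumes K: "simplicial A K" and c: "c \<in> chains K (Suc p)"
  shows "bd A c \<in> chains K p"
  unfolding chains_def mem_Collect_eq
proof (intro allI impI)
  fix \<tau> assume "bd A c \<tau> \<noteq> 0"
  then have "\<exists>v\<in>A. del_vertex v c \<tau> \<noteq> 0"
    unfolding bd_def using sum.neutral[of A "\<lambda>v. del_vertex v c \<tau>"] by blast
  then obtain v where "v \<in> A" "del_vertex v c \<tau> \<noteq> 0" ..
  then have v: "v \<notin> \<tau>" "finite \<tau>" "c (insert v \<tau>) \<noteq> 0"
    by (auto simp: del_vertex_def ins_sign_def split: if_splits)
  then have "insert v \<tau> \<in> K" "card (insert v \<tau>) = Suc p"
    using c unfolding chains_def by blast+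
  moreover from this have "\<tau> \<in> K" using K unfolding simplicial_def by blast
  ultimately show "\<tau> \<in> K \<and> finite \<tau> \<and> card \<tau> = p" using v by simp
qed

lemma module_hom_bd: "module_hom fun_scale fun_scale (bd A :: ('a :: linorder set \<Rightarrow> 'f :: field) \<Rightarrow> _)"
  unfolding module_hom_iff by (intro conjI allI fun_space.module_axioms bd_add bd_scale)

lemma cyc_subspace: "fun_space.subspace (cyc A K p :: ('a :: linorder set \<Rightarrow> 'f :: field) set)"
proof -
  have "cyc A K p = chains K p \<inter> {c :: 'a set \<Rightarrow> 'f. bd A c = 0}" unfolding cyc_def by blast
  then show ?thesis
    using fun_space.subspace_inter[OF chains_subspace module_hom.subspace_kernel[OF module_hom_bd]]
    by (simp only:)
qed

lemma bdy_subspace: "fun_space.subspace (bdy A K p :: ('a :: linorder set \<Rightarrow> 'f :: field) set)"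
  unfolding bdy_def by (rule module_hom.subspace_image[OF module_hom_bd chains_subspace])

lemma bdy_subset_cyc: "simplicial A K \<Longrightarrow> bdy A K p \<subseteq> cyc A K p"
  unfolding bdy_def cyc_def
  by (intro image_subsetI CollectI conjI bd_chains bd_bd) (auto simp: simplicial_def)

lemma cyc_span:
  assumes "simplicial A K"
  shows "(cyc A K p :: ('a :: linorder set \<Rightarrow> 'f :: field) set) \<subseteq> fun_space.span (unit_chain ` {\<sigma>\<in>K. card \<sigma> = p})"
  unfolding cyc_def by (rule subset_trans[OF _ chains_span[OF assms]]) blast

lemma finite_units: "simplicial A K \<Longrightarrow> finite (unit_chain ` {\<sigma>\<in>K. card \<sigma> = p})"
  using simplicial_finite(1) by fastforce

lemma dim_cyc_bdy:
  fixes A :: "'a :: linorder set"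
  assumes K: "simplicial A K"
  shows "card {\<sigma>\<in>K. card \<sigma> = Suc p} =
    fun_space.dim (cyc A K (Suc p) :: ('a set \<Rightarrow> 'f :: field) set) + fun_space.dim (bdy A K p :: ('a set \<Rightarrow> 'f) set)"
  using fun_space.dim_kernel_image[OF chains_subspace finite_units[OF K] chains_span[OF K],
      where f = "bd A :: ('a set \<Rightarrow> 'f) \<Rightarrow> _", OF bd_add bd_scale]
  by (simp only: dim_chains[OF K] cyc_def bdy_def)

lemma dim_cyc_zero:
  fixes A :: "'a :: linorder set"
  assumes K: "simplicial A K"
  shows "fun_space.dim (cyc A K 0 :: ('a set \<Rightarrow> 'f :: field) set) = card {\<sigma>\<in>K. card \<sigma> = 0}"
proof -
  have "bd A c = 0" if c: "c \<in> chains K 0" for c :: "'a set \<Rightarrow> 'f"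
  proof (rule ext)
    fix \<tau>
    have "\<sigma> = {}" if "c \<sigma> \<noteq> 0" for \<sigma>
    proof -
      have "finite \<sigma> \<and> card \<sigma> = 0" using c that by (simp add: chains_def)
      then show ?thesis by (metis card_0_eq)
    qed
    then have "c (insert v \<tau>) = 0" for v by (metis insert_not_empty)
    then show "bd A c \<tau> = 0 \<tau>" by (simp add: bd_def del_vertex_def cong: if_cong)
  qed
  then have "cyc A K 0 = (chains K 0 :: ('a set \<Rightarrow> 'f) set)" unfolding cyc_def by blast
  then show ?thesis by (simp add: dim_chains[OF K])
qed

lemma dim_bdy_le_cyc:
  fixes A :: "'a :: linorder set"
  assumes K: "simplicial A K"
  shows "fun_space.dim (bdy A K p :: ('a set \<Rightarrow> 'f :: field) set) \<le> fun_space.dim (cyc A K p :: ('a set \<Rightarrow> 'f) set)"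
proof -
  obtain S where "quotient_basis fun_scale (cyc A K p :: ('a set \<Rightarrow> 'f) set) (bdy A K p) S"
    using fun_space.quotient_basis_exists[OF cyc_subspace bdy_subspace bdy_subset_cyc[OF K]
        finite_units[OF K] cyc_span[OF K]] by blast
  from fun_space.quotient_basis_card[OF cyc_subspace bdy_subspace bdy_subset_cyc[OF K]
        finite_units[OF K] cyc_span[OF K] this] show ?thesis by simp
qed

lemma dim_cyc_le_gens:
  fixes A :: "'a :: linorder set"
  assumes K: "simplicial A K" and g: "gens TYPE('f :: field) A K p m"
  shows "fun_space.dim (cyc A K p :: ('a set \<Rightarrow> 'f) set) \<le> m + fun_space.dim (bdy A K p :: ('a set \<Rightarrow> 'f) set)"
proof -
  obtain S :: "('a set \<Rightarrow> 'f) set" where S: "finite S" "card S \<le> m"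
    "\<And>c. c \<in> chains K p \<Longrightarrow> bd A c = 0 \<Longrightarrow>
      \<exists>a. \<exists>b\<in>chains K (Suc p). c = (\<Sum>s\<in>S. fun_scale (a s) s) + bd A b"
    using g unfolding gens_def by blast
  obtain B :: "('a set \<Rightarrow> 'f) set" where B: "B \<subseteq> bdy A K p" "fun_space.independent B"
    "bdy A K p \<subseteq> fun_space.span B" "card B = fun_space.dim (bdy A K p :: ('a set \<Rightarrow> 'f) set)"
    using fun_space.basis_exists by blast
  have "B \<subseteq> fun_space.span (unit_chain ` {\<sigma>\<in>K. card \<sigma> = p})"
    using B(1) bdy_subset_cyc[OF K] cyc_span[OF K] by blast
  then have finB: "finite B"
    using fun_space.independent_span_bound[OF finite_units[OF K] B(2)] by blast
  have "(cyc A K p :: ('a set \<Rightarrow> 'f) set) \<subseteq> fun_space.span (S \<union> B)"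
  proof
    fix c :: "'a set \<Rightarrow> 'f" assume "c \<in> cyc A K p"
    then obtain a b where b: "b \<in> chains K (Suc p)" "c = (\<Sum>s\<in>S. fun_scale (a s) s) + bd A b"
      using S(3) unfolding cyc_def by blast
    have "bd A b \<in> fun_space.span B" using b(1) B(3) unfolding bdy_def by blast
    then have "bd A b \<in> fun_space.span (S \<union> B)" using fun_space.span_mono[of B "S \<union> B"] by blast
    moreover have "(\<Sum>s\<in>S. fun_scale (a s) s) \<in> fun_space.span (S \<union> B)"
      by (intro fun_space.span_sum fun_space.span_scale fun_space.span_base) simp
    ultimately show "c \<in> fun_space.span (S \<union> B)" unfolding b(2) by (intro fun_space.span_add)
  qed
  then have "fun_space.dim (cyc A K p :: ('a set \<Rightarrow> 'f) set) \<le> card (S \<union> B)"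
    using S(1) finB by (intro fun_space.dim_le_card) simp_all
  also have "\<dots> \<le> card S + card B" by (rule card_Un_le)
  finally show ?thesis using S(2) B(4) by simp
qed

definition reduced_betti :: "'f :: field itself \<Rightarrow> 'a :: linorder set \<Rightarrow> 'a set set \<Rightarrow> nat \<Rightarrow> nat" where
  "reduced_betti _ A K p = fun_space.dim (cyc A K p :: ('a set \<Rightarrow> 'f) set)
     - fun_space.dim (bdy A K p :: ('a set \<Rightarrow> 'f) set)"

lemma reduced_betti_le:
  "simplicial A K \<Longrightarrow> gens TYPE('f :: field) A K p m \<Longrightarrow> reduced_betti TYPE('f) A K p \<le> m"
  using dim_cyc_le_gens[of A K p m, where 'f='f] by (simp add: reduced_betti_def)

text \<open>Euler-Poincare: rank and nullity make the alternating sum of the numbers of simplices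
  telescope, and the last boundary space vanishes because no simplex has more than
  \<open>card A\<close> vertices. The summand 1 compensates for the empty simplex, and the sign is
  that of the number \<open>p\<close> of vertices, opposite to that of the degree.\<close>

lemma euler_char_reduced_betti:
  fixes A :: "'a :: linorder set"
  assumes K: "simplicial A K" and ne: "{} \<in> K"
  shows "euler_char (K - {{}}) = 1 - (\<Sum>p\<le>card A. (-1) ^ p * int (reduced_betti TYPE('f :: field) A K p))"
proof -
  define n where "n = card A"
  define z where "z = (\<lambda>p. int (fun_space.dim (cyc A K p :: ('a set \<Rightarrow> 'f) set)))"
  define b where "b = (\<lambda>p. int (fun_space.dim (bdy A K p :: ('a set \<Rightarrow> 'f) set)))"
  define N where "N = (\<lambda>p. int (card {\<sigma>\<in>K. card \<sigma> = p}))"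
  have fA: "finite A" and KA: "K \<subseteq> Pow A" using K by (auto simp: simplicial_def)
  have finK: "finite K" by (rule simplicial_finite(1)[OF K])
  have le: "card \<sigma> \<le> n" if "\<sigma> \<in> K" for \<sigma> using that KA fA unfolding n_def by (auto intro: card_mono)
  have N0: "N 0 = z 0" unfolding N_def z_def using dim_cyc_zero[OF K, where 'f='f] by (simp only:)
  have NS: "N (Suc p) = z (Suc p) + b p" for p
    unfolding N_def z_def b_def dim_cyc_bdy[OF K, where 'f='f] by (rule of_nat_add)
  have "{\<sigma>\<in>K. card \<sigma> = Suc n} = {}" using le by fastforce
  then have "N (Suc n) = 0" unfolding N_def by (simp only: card.empty of_nat_0)
  then have top: "b n = 0" using NS[of n] by (simp add: z_def b_def)
  have tele: "(\<Sum>p\<le>m. (-1) ^ p * N p) = (\<Sum>p\<le>m. (-1) ^ p * (z p - b p)) + (-1) ^ m * b m" for m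
    by (induction m) (simp_all add: N0 NS algebra_simps)
  have zb: "z p - b p = int (reduced_betti TYPE('f) A K p)" for p
    unfolding z_def b_def reduced_betti_def using dim_bdy_le_cyc[OF K, of p, where 'f='f]
    by (simp only: of_nat_diff)
  have "(\<Sum>\<sigma>\<in>K. (-1) ^ card \<sigma> :: int) = (\<Sum>p\<le>n. \<Sum>\<sigma>\<in>{\<sigma>\<in>K. card \<sigma> = p}. (-1) ^ card \<sigma>)"
    using finK le by (intro sum.group[symmetric]) auto
  also have "\<dots> = (\<Sum>p\<le>n. (-1) ^ p * N p)" unfolding N_def by (intro sum.cong refl) simp
  also have "\<dots> = (\<Sum>p\<le>n. (-1) ^ p * int (reduced_betti TYPE('f) A K p))"
    by (simp add: tele top zb)
  finally have tot: "(\<Sum>\<sigma>\<in>K. (-1) ^ card \<sigma> :: int) = (\<Sum>p\<le>n. (-1) ^ p * int (reduced_betti TYPE('f) A K p))" .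
  have "euler_char (K - {{}}) = (\<Sum>\<sigma>\<in>K - {{}}. - ((-1) ^ card \<sigma>))"
    unfolding euler_char_def
  proof (rule sum.cong)
    fix \<sigma> assume "\<sigma> \<in> K - {{}}"
    then have "card \<sigma> \<noteq> 0" using simplicial_finite(2)[OF K] by auto
    then obtain m where "card \<sigma> = Suc m" using not0_implies_Suc by blast
    then show "(-1) ^ (card \<sigma> - 1) = - ((-1) ^ card \<sigma> :: int)" by simp
  qed simp
  also have "\<dots> = 1 - (\<Sum>\<sigma>\<in>K. (-1) ^ card \<sigma>)"
    using sum.remove[OF finK ne, of "\<lambda>\<sigma>. (-1) ^ card \<sigma> :: int"] by (simp add: sum_negf)
  finally show ?thesis unfolding tot n_def .
qed

text \<open>The two operators differ only in the empty face of a vertex, which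
  \<open>boundary\<close> drops and \<open>bd\<close> keeps. For k >= 1 it does not occur, so
  reduced and ordinary homology agree.\<close>

lemma boundary_eq_bd:
  assumes K: "simplicial A K" and k: "k \<ge> 1" and c: "c \<in> chains K (Suc k)"
  shows "boundary (K - {{}}) c = bd A c"
proof (rule ext)
  fix \<tau> :: "'a set"
  have fA: "finite A" and KA: "K \<subseteq> Pow A" using K by (auto simp: simplicial_def)
  have cK: "\<sigma> \<in> K \<and> finite \<sigma> \<and> card \<sigma> = Suc k" if "c \<sigma> \<noteq> 0" for \<sigma> using c that by (simp add: chains_def)
  show "boundary (K - {{}}) c \<tau> = bd A c \<tau>"
  proof (cases "\<tau> = {}")
    case True
    have "c {v} = 0" for v using cK[of "{v}"] k by auto
    then show ?thesis using True by (simp add: boundary_def bd_def del_vertex_def)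
  next
    case False
    let ?S = "SIGMA \<sigma>:K - {{}}. {v. v \<in> \<sigma> \<and> \<sigma> - {v} = \<tau>}"
    let ?V = "{v\<in>A - \<tau>. insert v \<tau> \<in> K}"
    let ?g = "\<lambda>\<sigma> v. (-1) ^ card {u\<in>\<sigma>. u < v} * c \<sigma>"
    have "boundary (K - {{}}) c \<tau> = (\<Sum>(\<sigma>,v)\<in>?S. ?g \<sigma> v)"
      unfolding boundary_def using False simplicial_finite[OF K]
      by (simp only: if_False) (intro sum.Sigma; auto)
    also have "\<dots> = (\<Sum>v\<in>?V. ?g (insert v \<tau>) v)"
    proof (rule sum.reindex_bij_witness[of _ "\<lambda>v. (insert v \<tau>, v)" snd])
      fix x assume "x \<in> ?S"
      then obtain \<sigma> v where x: "x = (\<sigma>, v)" "\<sigma> \<in> K" "v \<in> \<sigma>" "\<sigma> - {v} = \<tau>" by auto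
      then have "insert v \<tau> = \<sigma>" by blast
      then show "(insert (snd x) \<tau>, snd x) = x" "snd x \<in> ?V"
        "?g (insert (snd x) \<tau>) (snd x) = (case x of (\<sigma>, v) \<Rightarrow> ?g \<sigma> v)"
        using x KA by auto
    qed auto
    also have "\<dots> = (\<Sum>v\<in>?V. del_vertex v c \<tau>)"
    proof (rule sum.cong)
      fix v assume v: "v \<in> ?V"
      then have "finite \<tau>" using simplicial_finite(2)[OF K] by fastforce
      then have "ins_sign v (insert v \<tau>) = ((-1) ^ card {u\<in>insert v \<tau>. u < v} :: 'b)"
        by (simp add: ins_sign_def)
      then show "?g (insert v \<tau>) v = del_vertex v c \<tau>"
        using v by (simp add: del_vertex_def ins_sign_self)
    qed simp
    also have "\<dots> = bd A c \<tau>"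
      unfolding bd_def
    proof (rule sum.mono_neutral_left[OF fA])
      show "\<forall>v\<in>A - ?V. del_vertex v c \<tau> = 0"
      proof
        fix v assume v: "v \<in> A - ?V"
        then have "v \<in> \<tau> \<or> c (insert v \<tau>) = 0" using cK[of "insert v \<tau>"] by blast
        then show "del_vertex v c \<tau> = 0" by (auto simp: del_vertex_def)
      qed
    qed blast
    finally show ?thesis .
  qed
qed

lemma betti_eq_reduced:
  fixes A :: "'a :: linorder set"
  assumes K: "simplicial A K" and k: "k \<ge> 1"
  shows "betti TYPE('f :: field) (K - {{}}) k = reduced_betti TYPE('f) A K (Suc k)"
proof -
  have ch: "chain_space (K - {{}}) j = (chains K (Suc j) :: ('a set \<Rightarrow> 'f) set)" for j
  proof -
    have "\<sigma> \<in> K - {{}} \<and> card \<sigma> = Suc j \<longleftrightarrow> \<sigma> \<in> K \<and> finite \<sigma> \<and> card \<sigma> = Suc j" for \<sigma>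
      using simplicial_finite(2)[OF K, of \<sigma>] by (cases "\<sigma> = {}") (simp, blast)
    then show ?thesis unfolding chain_space_def chains_def by (simp only:)
  qed
  have "cycles (K - {{}}) k = (cyc A K (Suc k) :: ('a set \<Rightarrow> 'f) set)"
    unfolding cycles_def cyc_def ch
    by (intro Collect_cong conj_cong refl) (simp only: boundary_eq_bd[OF K k])
  moreover have "boundaries (K - {{}}) k = (bdy A K (Suc k) :: ('a set \<Rightarrow> 'f) set)"
    unfolding boundaries_def bdy_def ch
    by (intro image_cong refl boundary_eq_bd[OF K]) simp_all
  ultimately show ?thesis
    unfolding betti_def reduced_betti_def
    using fun_space.quotient_dim_eq[OF cyc_subspace bdy_subspace bdy_subset_cyc[OF K]
        finite_units[OF K] cyc_span[OF K]] by (simp only:)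
qed

section \<open>Clockwise distances\<close>

text \<open>Takes values in (0, 1], with distance 1 rather than 0 from a point to itself. Thus
  \<open>s \<le> cw a b\<close> says that \<open>b\<close> avoids the open arc of length
  \<open>s\<close> after \<open>a\<close>, and for s <= 1 a point never blocks the arc that it
  starts.\<close>

definition cw :: "real \<Rightarrow> real \<Rightarrow> real" where
  "cw a b = (if a < b then b - a else b - a + 1)"

lemma cw_pos: "a \<in> circle \<Longrightarrow> b \<in> circle \<Longrightarrow> 0 < cw a b"
  and cw_le_1: "a \<in> circle \<Longrightarrow> b \<in> circle \<Longrightarrow> cw a b \<le> 1"
  and cw_less_1: "a \<in> circle \<Longrightarrow> b \<in> circle \<Longrightarrow> a \<noteq> b \<Longrightarrow> cw a b < 1"
  and cw_self: "cw a a = 1"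
  and cw_inj: "a \<in> circle \<Longrightarrow> b \<in> circle \<Longrightarrow> c \<in> circle \<Longrightarrow> cw a b = cw a c \<Longrightarrow> b = c"
  by (auto simp: cw_def circle_def split: if_splits)

text \<open>Positions relative to \<open>a\<close>, where \<open>a\<close> itself has position 1, determine all distances.\<close>

lemma cw_shift:
  assumes "a \<in> circle" "b \<in> circle" "c \<in> circle"
  shows "cw c b = (if cw a c < cw a b then cw a b - cw a c else cw a b - cw a c + 1)"
  using assms by (auto simp: cw_def circle_def)

text \<open>For s <= 1 the point \<open>a\<close> itself is a candidate, at distance 1, so the
  minimum exists. \<open>nxt 0 X\<close> is the cyclic successor, which will serve to rotate spread
  sets.\<close>

definition nxt :: "real \<Rightarrow> real set \<Rightarrow> real \<Rightarrow> real" where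
  "nxt s X a = arg_min_on (cw a) {b\<in>X. s \<le> cw a b}"

lemma nxt:
  assumes "finite X" "a \<in> X" "s \<le> 1"
  shows "nxt s X a \<in> X" "s \<le> cw a (nxt s X a)"
    "\<And>b. b \<in> X \<Longrightarrow> s \<le> cw a b \<Longrightarrow> cw a (nxt s X a) \<le> cw a b"
proof -
  have *: "finite {b\<in>X. s \<le> cw a b}" "{b\<in>X. s \<le> cw a b} \<noteq> {}"
    using assms cw_self[of a] by auto
  show "nxt s X a \<in> X" "s \<le> cw a (nxt s X a)"
    using arg_min_if_finite(1)[OF *, of "cw a"] by (simp_all add: nxt_def)
  show "cw a (nxt s X a) \<le> cw a b" if "b \<in> X" "s \<le> cw a b" for b
    unfolding nxt_def by (rule arg_min_least[OF *]) (use that in simp)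
qed

lemma nxt_eqI:
  assumes "finite X" "X \<subseteq> circle" "a \<in> X" "s \<le> 1"
    and "y \<in> X" "s \<le> cw a y" "\<And>b. b \<in> X \<Longrightarrow> s \<le> cw a b \<Longrightarrow> cw a y \<le> cw a b"
  shows "nxt s X a = y"
proof (rule cw_inj[of a])
  note n = nxt[OF assms(1,3,4)]
  show "a \<in> circle" "nxt s X a \<in> circle" "y \<in> circle" using assms(2,3,5) n(1) by auto
  show "cw a (nxt s X a) = cw a y" by (rule antisym[OF n(3)[OF assms(5,6)] assms(7)[OF n(1,2)]])
qed

lemma nxt_remove:
  assumes "finite X" "X \<subseteq> circle" "a \<in> X" "a \<noteq> v" "s \<le> 1" "nxt s X a \<noteq> v"
  shows "nxt s (X - {v}) a = nxt s X a"
proof (rule nxt_eqI)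
  note n = nxt[OF assms(1,3,5)]
  show "nxt s X a \<in> X - {v}" "s \<le> cw a (nxt s X a)" using n(1,2) assms(6) by auto
  show "cw a (nxt s X a) \<le> cw a b" if "b \<in> X - {v}" "s \<le> cw a b" for b
    using n(3) that by blast
qed (use assms in auto)

text \<open>The image of \<open>a\<close> lies in the arc (a, b], that of \<open>b\<close> in (b,
  a], and these arcs are disjoint for distinct points.\<close>

lemma nxt_inj:
  assumes X: "finite X" "X \<subseteq> circle" and ab: "a \<in> X" "b \<in> X" and s: "s \<le> 1"
    and sep: "s \<le> cw a b" "s \<le> cw b a" and eq: "nxt s X a = nxt s X b"
  shows "a = b"
proof (rule ccontr)
  assume ne: "a \<noteq> b"
  define y where "y = nxt s X a"
  have y: "y \<in> X" "cw a y \<le> cw a b" "cw b y \<le> cw b a"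
    using nxt(1)[OF X(1) ab(1) s] nxt(3)[OF X(1) ab(1) s ab(2) sep(1)]
      nxt(3)[OF X(1) ab(2) s ab(1) sep(2)] eq by (simp_all add: y_def)
  have c: "a \<in> circle" "b \<in> circle" "y \<in> circle" using X ab y by auto
  show False
    using y(2,3) ne cw_pos[OF c(1,3)] cw_shift[OF c(1,3,2)] cw_shift[OF c(1,1,2)] cw_self[of a]
      cw_less_1[OF c(1,2)] by (auto split: if_splits)
qed

text \<open>
  The point of an invariant set closest behind \<open>x\<close> would otherwise be mapped to a closer one.
\<close>

lemma invariant_covers:
  assumes X: "finite X" "X \<subseteq> circle" and s: "s \<le> 1"
    and J: "J \<subseteq> X" "J \<noteq> {}" "\<And>a. a \<in> J \<Longrightarrow> nxt s X a \<in> J" and x: "x \<in> X - J"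
  shows "\<exists>a\<in>J. cw a x < s"
proof -
  have finJ: "finite J" using X(1) J(1) finite_subset by blast
  define m where "m = arg_min_on (\<lambda>a. cw a x) J"
  have m: "m \<in> J" "\<And>a. a \<in> J \<Longrightarrow> cw m x \<le> cw a x"
    using arg_min_if_finite(1)[OF finJ J(2)] arg_min_least[OF finJ J(2)] by (auto simp: m_def)
  have "cw m x < s"
  proof (rule ccontr)
    assume "\<not> cw m x < s"
    then have le: "cw m (nxt s X m) \<le> cw m x" using nxt(3)[OF X(1) _ s] m(1) J(1) x by auto
    let ?y = "nxt s X m"
    have y: "?y \<in> J" "?y \<noteq> x" using J(3)[OF m(1)] x by auto
    have c: "m \<in> circle" "x \<in> circle" "?y \<in> circle" using X J y m x by auto
    have "cw m ?y < cw m x" using le cw_inj[OF c(1,3,2)] y(2) by fastforce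
    then have "cw ?y x < cw m x" using cw_shift[OF c(1,2,3)] cw_pos[OF c(1,3)] by simp
    then show False using m(2)[OF y(1)] by simp
  qed
  then show ?thesis using m(1) by blast
qed

section \<open>Spread sets\<close>

text \<open>An orbit of \<open>nxt s X\<close> with winding number one: on such a set
  \<open>nxt\<close> is the cyclic shift (\<open>spread_nxt\<close>), there is no smaller invariant
  set (\<open>spread_invariant_subset\<close>), and conversely invariance gives the covering
  condition by \<open>invariant_covers\<close>.\<close>

definition spread :: "real \<Rightarrow> real set \<Rightarrow> real set \<Rightarrow> bool" where
  "spread s X I \<longleftrightarrow> I \<noteq> {} \<and> I \<subseteq> X \<and> (\<forall>a\<in>I. \<forall>b\<in>I. s \<le> cw a b) \<and> (\<forall>x\<in>X - I. \<exists>a\<in>I. cw a x < s)"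

definition spreads :: "real \<Rightarrow> real set \<Rightarrow> nat \<Rightarrow> real set set" where
  "spreads s X m = {I. spread s X I \<and> card I = m}"

lemma spreadD:
  assumes "spread s X I"
  shows "I \<noteq> {}" "I \<subseteq> X" "\<And>a. a \<in> I \<Longrightarrow> a \<in> X" "\<And>a b. a \<in> I \<Longrightarrow> b \<in> I \<Longrightarrow> s \<le> cw a b"
    "\<And>x. x \<in> X \<Longrightarrow> x \<notin> I \<Longrightarrow> \<exists>a\<in>I. cw a x < s"
  using assms unfolding spread_def by blast+

locale circle_points =
  fixes s :: real and X :: "real set"
  assumes finX: "finite X" and Xcirc: "X \<subseteq> circle" and s0: "0 < s" and s1: "s \<le> 1"
begin

lemma remove: "circle_points s (X - {v})"
  using finX Xcirc s0 s1 by unfold_locales auto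

lemma finite_spreads: "finite (spreads s X m)"
  using finX by (intro finite_subset[of "spreads s X m" "Pow X"]) (auto simp: spreads_def spread_def)

lemma nxt_in: "a \<in> X \<Longrightarrow> nxt s X a \<in> X"
  using nxt(1)[OF finX _ s1] .

lemma spread_finite: "spread s X I \<Longrightarrow> finite I"
  using finX finite_subset by (auto simp: spread_def)

text \<open>Otherwise the image \<open>y\<close> of \<open>a\<close> is covered by some
  \<open>c\<close> in \<open>I\<close>. By minimality \<open>c\<close> does not come before
  \<open>y\<close> as seen from \<open>a\<close>, so the arc from \<open>c\<close> to
  \<open>y\<close> runs through \<open>a\<close> and already its part up to \<open>a\<close> has
  length at least \<open>s\<close>.\<close>

lemma spread_nxt:
  assumes I: "spread s X I" and a: "a \<in> I"
  shows "nxt s X a \<in> I"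
proof (rule ccontr)
  let ?y = "nxt s X a"
  assume y: "?y \<notin> I"
  have aX: "a \<in> X" using spreadD(3)[OF I a] .
  note n = nxt[OF finX aX s1]
  obtain c where c: "c \<in> I" "cw c ?y < s" using spreadD(5)[OF I n(1) y] by blast
  have cX: "c \<in> X" "s \<le> cw a c" "s \<le> cw c a" using spreadD(3,4)[OF I] a c by blast+
  have ci: "a \<in> circle" "?y \<in> circle" "c \<in> circle" using Xcirc aX cX n(1) by auto
  have "cw a ?y \<le> cw a c" using n(3) cX by auto
  then show False
    using c(2) n(2) cX(3) cw_shift[OF ci(1,2,3)] cw_shift[OF ci(1,1,3)] cw_self[of a] cw_pos[OF ci(1,2)]
      cw_le_1[OF ci(1,3)] by (auto split: if_splits)
qed

lemma spread_image_nxt: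
  assumes I: "spread s X I"
  shows "nxt s X ` I = I"
proof (rule endo_inj_surj[OF spread_finite[OF I]])
  show "nxt s X ` I \<subseteq> I" using spread_nxt[OF I] by blast
  show "inj_on (nxt s X) I"
  proof (rule inj_onI)
    fix a b assume ab: "a \<in> I" "b \<in> I" "nxt s X a = nxt s X b"
    show "a = b"
      using nxt_inj[OF finX Xcirc spreadD(3)[OF I ab(1)] spreadD(3)[OF I ab(2)] s1
          spreadD(4)[OF I ab(1,2)] spreadD(4)[OF I ab(2,1)] ab(3)] .
  qed
qed

text \<open>An invariant set comes closer than \<open>s\<close> to every point outside of it,
  whereas the points of \<open>I\<close> keep distance \<open>s\<close> from each other.\<close>

lemma spread_invariant_subset:
  assumes I: "spread s X I" and M: "M \<subseteq> I" "M \<noteq> {}" "\<And>a. a \<in> M \<Longrightarrow> nxt s X a \<in> M"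
  shows "M = I"
proof (rule ccontr)
  assume "M \<noteq> I"
  then obtain c where c: "c \<in> I" "c \<notin> M" using M(1) by blast
  have IX: "I \<subseteq> X" using I by (simp add: spread_def)
  then obtain m where "m \<in> M" "cw m c < s"
    using invariant_covers[OF finX Xcirc s1 _ M(2,3), of c] M(1) c by blast
  moreover have "s \<le> cw m c" using spreadD(4)[OF I _ c(1), of m] \<open>m \<in> M\<close> M(1) by blast
  ultimately show False by simp
qed

lemma spread_eq:
  assumes "spread s X I" "spread s X J" "a \<in> I" "a \<in> J"
  shows "I = J"
proof -
  have ne: "I \<inter> J \<noteq> {}" using assms(3,4) by blast
  have inv: "nxt s X a \<in> I \<inter> J" if "a \<in> I \<inter> J" for a
    using spread_nxt[OF assms(1), of a] spread_nxt[OF assms(2), of a] that by blast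
  have "I \<inter> J = I" by (rule spread_invariant_subset[OF assms(1) _ ne inv]) auto
  moreover have "I \<inter> J = J" by (rule spread_invariant_subset[OF assms(2) _ ne inv]) auto
  ultimately show ?thesis by blast
qed

text \<open>If \<open>v\<close> is not the image of a point of \<open>J\<close>, then
  \<open>nxt\<close> acts on \<open>J\<close> as before the removal, so \<open>J\<close> stays
  invariant when \<open>v\<close> returns and covers \<open>v\<close> as well.\<close>

lemma spread_remove:
  assumes J: "spread s (X - {v}) J" and nv: "\<And>a. a \<in> J \<Longrightarrow> nxt s X a \<noteq> v"
  shows "spread s X J"
proof -
  interpret R: circle_points s "X - {v}" by (rule remove)
  note JX = spreadD(2,1)[OF J]
  have "nxt s X a \<in> J" if "a \<in> J" for a
  proof -
    have "a \<in> X" "a \<noteq> v" using that JX(1) by auto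
    from nxt_remove[OF finX Xcirc this s1 nv[OF that]] show ?thesis
      using R.spread_nxt[OF J that] by simp
  qed
  then have "\<exists>a\<in>J. cw a x < s" if "x \<in> X - J" for x
    using invariant_covers[OF finX Xcirc s1 _ JX(2)] JX(1) that by blast
  then show ?thesis using JX spreadD(4)[OF J] unfolding spread_def by blast
qed

lemma spreads_remove_nonimage:
  assumes "v \<notin> nxt s X ` X"
  shows "spreads s (X - {v}) m \<subseteq> spreads s X m" "\<And>I. spread s X I \<Longrightarrow> v \<notin> I"
proof -
  show "spreads s (X - {v}) m \<subseteq> spreads s X m"
  proof
    fix J assume "J \<in> spreads s (X - {v}) m"
    then have J: "spread s (X - {v}) J" "card J = m" by (simp_all add: spreads_def)
    have "nxt s X a \<noteq> v" if "a \<in> J" for a using spreadD(3)[OF J(1) that] assms by blast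
    then show "J \<in> spreads s X m" using spread_remove[OF J(1)] J(2) by (simp add: spreads_def)
  qed
  show "v \<notin> I" if "spread s X I" for I
    using spread_image_nxt[OF that] spreadD(2)[OF that] assms by blast
qed

text \<open>By \<open>spread_remove\<close>, a spread set that exists only after the removal
  contains a preimage of \<open>v\<close>. That preimage is unique, and spread sets with a common
  point are equal.\<close>

lemma card_spreads_remove_inj:
  assumes inj: "inj_on (nxt s X) X" and none: "spreads s X m = {}"
  shows "card (spreads s (X - {v}) m) \<le> 1"
proof -
  interpret R: circle_points s "X - {v}" by (rule remove)
  have ex: "\<exists>a\<in>J. nxt s X a = v" if "J \<in> spreads s (X - {v}) m" for J
  proof (rule ccontr)
    assume "\<not> ?thesis"
    moreover have "spread s (X - {v}) J" "card J = m" using that by (simp_all add: spreads_def)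
    ultimately have "J \<in> spreads s X m" using spread_remove by (simp add: spreads_def)
    then show False using none by blast
  qed
  have "I = J" if IJ: "I \<in> spreads s (X - {v}) m" "J \<in> spreads s (X - {v}) m" for I J
  proof -
    obtain a b where ab: "a \<in> I" "nxt s X a = v" "b \<in> J" "nxt s X b = v"
      using ex[OF IJ(1)] ex[OF IJ(2)] by blast
    have sp: "spread s (X - {v}) I" "spread s (X - {v}) J" using IJ by (simp_all add: spreads_def)
    have "a \<in> X" "b \<in> X" using spreadD(3)[OF sp(1) ab(1)] spreadD(3)[OF sp(2) ab(3)] by simp_all
    then have "a = b" using inj_onD[OF inj, of a b] ab by simp
    then show ?thesis using R.spread_eq[OF sp, of a] ab by simp
  qed
  then show ?thesis using R.finite_spreads by (simp add: card_le_Suc0_iff_eq)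
qed

text \<open>By injectivity no point outside \<open>I\<close> is mapped into \<open>I\<close>. If
  \<open>J\<close> contained a preimage of \<open>v\<close>, it would meet \<open>I\<close>; its
  part outside \<open>I\<close> is invariant and not all of \<open>J\<close>, hence empty. Then
  \<open>J\<close> equals \<open>I\<close> by cardinality, although it lacks \<open>v\<close>. So
  \<open>spread_remove\<close> applies to \<open>J\<close>.\<close>

lemma spreads_remove_spread:
  assumes inj: "inj_on (nxt s X) X" and I: "I \<in> spreads s X m" and v: "v \<in> I"
  shows "spreads s (X - {v}) m \<subseteq> spreads s X m - {I}"
proof
  interpret R: circle_points s "X - {v}" by (rule remove)
  have spI: "spread s X I" using I by (simp add: spreads_def)
  note IX = spreadD(2)[OF spI]
  fix J assume J: "J \<in> spreads s (X - {v}) m"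
  then have spJ: "spread s (X - {v}) J" by (simp add: spreads_def)
  note JX = spreadD(2)[OF spJ]
  have "nxt s X a \<noteq> v" if a: "a \<in> J" for a
  proof
    assume av: "nxt s X a = v"
    have bck: "x \<in> I" if x: "x \<in> X" "nxt s X x \<in> I" for x
    proof -
      have "nxt s X x \<in> nxt s X ` I" unfolding spread_image_nxt[OF spI] by (rule x(2))
      then show ?thesis using inj_on_image_mem_iff[OF inj x(1) IX] by simp
    qed
    have aI: "a \<in> I" using bck[of a] av v a JX by auto
    have "J - I = {}"
    proof (rule ccontr)
      assume ne: "J - I \<noteq> {}"
      have "nxt s (X - {v}) x \<in> J - I" if x: "x \<in> J - I" for x
      proof -
        have "x \<in> X" "x \<noteq> v" using x JX by auto
        moreover have "nxt s X x \<notin> I" using bck[of x] x \<open>x \<in> X\<close> by blast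
        ultimately have "nxt s (X - {v}) x = nxt s X x"
          using v by (intro nxt_remove[OF finX Xcirc _ _ s1]) auto
        then show ?thesis using R.spread_nxt[OF spJ, of x] x \<open>nxt s X x \<notin> I\<close> by auto
      qed
      then have "J - I = J" using R.spread_invariant_subset[OF spJ, of "J - I"] ne by blast
      then show False using a aI by blast
    qed
    then have "J = I"
      using I J spread_finite[OF spI] by (intro card_subset_eq) (auto simp: spreads_def)
    then show False using v JX by blast
  qed
  then have "spread s X J" using spread_remove[OF spJ] by blast
  then show "J \<in> spreads s X m - {I}" using J v JX by (auto simp: spreads_def)
qed

text \<open>\<open>nxt\<close> is monotone around the circle, and a monotone bijection of a
  cyclically ordered set is a rotation, so it maps successors to successors. If the image
  \<open>t\<close> of the successor \<open>y\<close> skipped \<open>z\<close>, the preimage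
  \<open>q\<close> of \<open>z\<close> would come after \<open>y\<close> but be mapped to a point
  strictly between \<open>u\<close> and \<open>t\<close>.\<close>

lemma nxt_commute:
  assumes bij: "nxt s X ` X = X" and x: "x \<in> X"
  shows "nxt s X (nxt 0 X x) = nxt 0 X (nxt s X x)"
proof (rule ccontr)
  define y u where "y = nxt 0 X x" and "u = nxt s X x"
  define t z where "t = nxt s X y" and "z = nxt 0 X u"
  assume "nxt s X (nxt 0 X x) \<noteq> nxt 0 X (nxt s X x)"
  then have tz: "t \<noteq> z" by (simp add: t_def z_def y_def u_def)
  have inj: "inj_on (nxt s X) X" using bij finX by (simp add: eq_card_imp_inj_on)
  note ny = nxt[OF finX x, of 0, folded y_def] and nu = nxt[OF finX x s1, folded u_def]
  have yX: "y \<in> X" and uX: "u \<in> X" using ny(1) nu(1) by simp_all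
  note nt = nxt[OF finX yX s1, folded t_def] and nz = nxt[OF finX uX, of 0, folded z_def]
  have tX: "t \<in> X" and zX: "z \<in> X" using nt(1) nz(1) by simp_all
  have "z \<in> nxt s X ` X" unfolding bij by (rule zX)
  then obtain q where q: "q \<in> X" "nxt s X q = z" by (elim imageE) simp
  note nq = nxt[OF finX q(1) s1, unfolded q(2)]
  have c: "x \<in> circle" "y \<in> circle" "u \<in> circle" "t \<in> circle" "z \<in> circle" "q \<in> circle"
    using Xcirc x yX uX tX zX q(1) by auto
  have near: "cw x y \<le> cw x b" "cw u z \<le> cw u b" if "b \<in> X" for b
    using ny(3)[of b] nz(3)[of b] cw_pos[OF c(1), of b] cw_pos[OF c(3), of b] that Xcirc by auto
  have qy: "q \<noteq> y" using tz q(2) by (auto simp: t_def)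
  have xy: "x \<noteq> y"
  proof
    assume xy: "x = y"
    have "b = x" if "b \<in> X" for b
      using near(1)[OF that] cw_less_1[OF c(1), of b] that Xcirc cw_self[of x] xy by force
    then show False using tz tX zX by metis
  qed
  have ut: "u \<noteq> t" using inj_onD[OF inj, of x y] x yX xy by (auto simp: u_def t_def)
  have uzt: "cw u z < cw u t" using near(2)[OF tX] cw_inj[OF c(3,5,4)] tz by fastforce
  have qx: "q \<noteq> x"
  proof
    assume "q = x"
    then have "u = z" using q(2) u_def by simp
    then show False using near(2)[OF tX] cw_self[of u] cw_less_1[OF c(3,4)] ut by simp
  qed
  have yq: "cw x y < cw x q" using near(1)[OF q(1)] cw_inj[OF c(1,2,6)] qy by fastforce
  \<comment> \<open>Positions measured from \<open>x\<close> turn all the cyclic comparisons into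
    linear arithmetic.\<close>
  define P where "P = cw x"
  have sh: "cw a b = (if P a < P b then P b - P a else P b - P a + 1)" if "a \<in> circle" "b \<in> circle" for a b
    using cw_shift[OF c(1) that(2,1)] by (simp add: P_def)
  have P: "0 < P b \<and> P b \<le> 1" if "b \<in> circle" for b
    using cw_pos[OF c(1) that] cw_le_1[OF c(1) that] by (simp add: P_def)
  have Pq: "P q < 1" using cw_less_1[OF c(1,6)] qx by (simp add: P_def)
  have 1: "s \<le> P u" "s \<le> P t \<Longrightarrow> P u \<le> P t" "s \<le> P z \<Longrightarrow> P u \<le> P z"
    using nu(2) nu(3)[OF tX] nu(3)[OF zX] by (simp_all add: P_def)
  have 2: "s \<le> cw y t" "s \<le> cw y u \<Longrightarrow> cw y t \<le> cw y u" "s \<le> cw y z \<Longrightarrow> cw y t \<le> cw y z"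
    using nt(2) nt(3)[OF uX] nt(3)[OF zX] by simp_all
  have 3: "s \<le> cw q z" "s \<le> cw q u \<Longrightarrow> cw q z \<le> cw q u" "s \<le> cw q t \<Longrightarrow> cw q z \<le> cw q t"
    using nq(2) nq(3)[OF uX] nq(3)[OF tX] by simp_all
 have Put: "P u \<noteq> P t" using ut cw_inj[OF c(1,3,4)] by (auto simp: P_def)
  have PP: "P y < P q" using yq by (simp add: P_def)
  show False
    using 1 2 3 PP Pq uzt s1 Put P[OF c(2)] P[OF c(3)] P[OF c(4)] P[OF c(5)] s0
    unfolding sh[OF c(2,4)] sh[OF c(2,3)] sh[OF c(2,5)] sh[OF c(6,5)] sh[OF c(6,3)] sh[OF c(6,4)]
      sh[OF c(3,5)] sh[OF c(3,4)]
    by (smt (verit))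
qed

text \<open>The second spread set consists of the cyclic successors of the points of
  \<open>I\<close>. It is invariant because \<open>nxt\<close> commutes with the successor map, and
  different from \<open>I\<close> because a set closed under successors is everything.\<close>

lemma spreads_second:
  assumes bij: "nxt s X ` X = X" and I: "I \<in> spreads s X m" "I \<noteq> X"
  shows "card (spreads s X m) \<ge> 2"
proof -
  let ?J = "nxt 0 X ` I"
  have spI: "spread s X I" using I by (simp add: spreads_def)
  note IX = spreadD(2)[OF spI] and ne = spreadD(1)[OF spI]
  have n0: "nxt 0 X a \<in> X" "\<And>b. b \<in> X \<Longrightarrow> cw a (nxt 0 X a) \<le> cw a b" if "a \<in> X" for a
  proof -
    show "nxt 0 X a \<in> X" using nxt(1)[OF finX that] by simp
    show "cw a (nxt 0 X a) \<le> cw a b" if "b \<in> X" for b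
    proof -
      have "0 < cw a b" using \<open>a \<in> X\<close> that Xcirc by (intro cw_pos) auto
      then show ?thesis using nxt(3)[OF finX \<open>a \<in> X\<close>, of 0 b] that by simp
    qed
  qed
  have JX: "?J \<subseteq> X" using n0(1) IX by auto
  have inv: "nxt s X a \<in> ?J" if "a \<in> ?J" for a
  proof -
    obtain b where b: "b \<in> I" "a = nxt 0 X b" using \<open>a \<in> ?J\<close> by blast
    have "nxt s X a = nxt 0 X (nxt s X b)" using nxt_commute[OF bij, of b] b IX by auto
    then show ?thesis using spread_nxt[OF spI b(1)] by blast
  qed
  have sep: "s \<le> cw (nxt 0 X a) (nxt 0 X b)" if ab: "a \<in> I" "b \<in> I" for a b
  proof (cases "a = b")
    case True then show ?thesis using s1 by (simp add: cw_self)
  next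
    case False
    define c d y sy where "c = nxt 0 X a" and "d = nxt 0 X b" and "y = nxt s X a" and "sy = nxt 0 X y"
    have X: "a \<in> X" "b \<in> X" "y \<in> I" "y \<in> X" using ab IX spread_nxt[OF spI ab(1)] by (auto simp: y_def)
    have X': "c \<in> X" "d \<in> X" "sy \<in> X" using n0(1) X by (auto simp: c_def d_def sy_def)
    have ci: "a \<in> circle" "b \<in> circle" "y \<in> circle" "c \<in> circle" "d \<in> circle" "sy \<in> circle"
      using X X' Xcirc by auto
    have sc: "nxt s X c = sy" using nxt_commute[OF bij X(1)] by (simp add: c_def sy_def y_def)
    then have csy: "s \<le> cw c sy" using nxt(2)[OF finX X'(1) s1] by simp
    have yb: "cw a y \<le> cw a b"
      using nxt(3)[OF finX X(1) s1 X(2) spreadD(4)[OF spI ab]] by (simp add: y_def)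
    have cy: "cw a c \<le> cw a y" using n0(2)[OF X(1) X(4)] by (simp add: c_def)
    have db: "cw b d \<le> cw b a" using n0(2)[OF X(2) X(1)] by (simp add: d_def)
    have syb: "cw y sy \<le> cw y b" using n0(2)[OF X(4) X(2)] by (simp add: sy_def)
    show ?thesis
    proof (cases "b = y")
      case True
      then have "d = sy" by (simp add: d_def sy_def)
      then show ?thesis using csy by (simp add: c_def d_def)
    next
      case by_ne: False
      then have yb': "cw a y < cw a b" using yb cw_inj[OF ci(1,3,2)] by fastforce
      note sh = cw_shift[OF ci(1)]
      have b1: "cw a b < 1" using cw_less_1[OF ci(1,2)] False by simp
      \<comment> \<open>The successor of \<open>y\<close> does not pass \<open>b\<close>, and
        \<open>d\<close> lies beyond \<open>b\<close>; so \<open>d\<close> is farther from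
        \<open>c\<close> than \<open>sy\<close>, the image of \<open>c\<close>.\<close>
      have "cw a sy \<le> cw a b" "cw a y < cw a sy"
        using syb yb' cw_pos[OF ci(1,6)] cw_pos[OF ci(1,3)] cw_le_1[OF ci(1,6)] b1
        unfolding sh[OF ci(6,3)] sh[OF ci(2,3)] by (auto split: if_splits)
      moreover have "cw a b < cw a d"
        using db b1 cw_pos[OF ci(1,5)] cw_self[of a] unfolding sh[OF ci(5,2)] sh[OF ci(1,2)]
        by (auto split: if_splits)
      ultimately have "s \<le> cw c d"
        using csy cy unfolding sh[OF ci(6,4)] sh[OF ci(5,4)] by (auto split: if_splits)
      then show ?thesis by (simp add: c_def d_def)
    qed
  qed
  have "\<exists>a\<in>?J. cw a x < s" if "x \<in> X - ?J" for x
    using invariant_covers[OF finX Xcirc s1 JX _ inv that] ne by simp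
  then have spJ: "spread s X ?J" using ne JX sep unfolding spread_def by blast
  have "inj_on (nxt 0 X) I"
  proof (rule inj_onI)
    fix a b assume ab: "a \<in> I" "b \<in> I" "nxt 0 X a = nxt 0 X b"
    have "a \<in> X" "b \<in> X" "0 \<le> cw a b" "0 \<le> cw b a"
      using ab IX spreadD(4)[OF spI ab(1,2)] spreadD(4)[OF spI ab(2,1)] s0 by auto
    then show "a = b" using nxt_inj[OF finX Xcirc, of a b 0] ab(3) by simp
  qed
  then have J: "?J \<in> spreads s X m" using spJ I card_image[of "nxt 0 X" I] by (simp add: spreads_def)
  \<comment> \<open>With parameter 0, \<open>invariant_covers\<close> would place a point outside
    \<open>I\<close> at negative distance.\<close>
  have "?J \<noteq> I"
  proof
    assume eq: "?J = I"
    obtain x where x: "x \<in> X - I" using I(2) IX by blast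
    have "\<exists>a\<in>I. cw a x < 0"
      using invariant_covers[OF finX Xcirc _ IX ne _ x, of 0] eq by auto
    then show False using cw_pos x IX Xcirc by (metis DiffD1 not_less_iff_gr_or_eq subsetD)
  qed
  then have "card {I, ?J} = 2" by simp
  moreover have "{I, ?J} \<subseteq> spreads s X m" using I J by simp
  ultimately show ?thesis using card_mono[OF finite_spreads] by metis
qed

end

section \<open>Links of vertices\<close>

text \<open>Points on a line at positions \<open>p\<close>; a simplex leaves free an open gap of
  length \<open>s\<close> inside [a, 1]. The link of a vertex of the arc complex has this form with
  a = 0, and the links met below have it again with a larger \<open>a\<close>. Positions are kept
  apart from the vertices because the orientation signs refer to the order of the vertices
  themselves.\<close>

definition lin_cx :: "real \<Rightarrow> ('a \<Rightarrow> real) \<Rightarrow> 'a set \<Rightarrow> real \<Rightarrow> 'a set set" where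
  "lin_cx s p Y a = {\<sigma>. \<sigma> \<subseteq> Y \<and> (\<exists>g\<ge>a. g + s \<le> 1 \<and> (\<forall>b\<in>\<sigma>. p b \<le> g \<or> g + s \<le> p b))}"

definition arc_cx :: "real \<Rightarrow> real set \<Rightarrow> real set set" where
  "arc_cx s X = {\<sigma>. \<sigma> \<subseteq> X \<and> (\<exists>a\<in>circle. \<forall>b\<in>\<sigma>. s \<le> cw a b)}"

lemma lin_cxI: "\<sigma> \<subseteq> Y \<Longrightarrow> a \<le> g \<Longrightarrow> g + s \<le> 1 \<Longrightarrow> (\<And>b. b \<in> \<sigma> \<Longrightarrow> p b \<le> g \<or> g + s \<le> p b) \<Longrightarrow> \<sigma> \<in> lin_cx s p Y a"
  unfolding lin_cx_def by blast

lemma lin_cxE: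
  assumes "\<sigma> \<in> lin_cx s p Y a"
  obtains g where "\<sigma> \<subseteq> Y" "a \<le> g" "g + s \<le> 1" "\<And>b. b \<in> \<sigma> \<Longrightarrow> p b \<le> g \<or> g + s \<le> p b"
  using assms unfolding lin_cx_def by blast

lemma simplicial_lin_cx: "finite A \<Longrightarrow> Y \<subseteq> A \<Longrightarrow> simplicial A (lin_cx s p Y a)"
  unfolding simplicial_def lin_cx_def by blast

lemma simplicial_arc_cx: "finite A \<Longrightarrow> X \<subseteq> A \<Longrightarrow> simplicial A (arc_cx s X)"
  unfolding simplicial_def arc_cx_def by blast

lemma lin_cx_remove: "{\<sigma>\<in>lin_cx s p Y a. v \<notin> \<sigma>} = lin_cx s p (Y - {v}) a"
  unfolding lin_cx_def by blast

lemma arc_cx_remove: "{\<sigma>\<in>arc_cx s X. v \<notin> \<sigma>} = arc_cx s (X - {v})"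
  unfolding arc_cx_def by blast

text \<open>The gap that starts at \<open>a\<close> contains no point at all, so the complex is a
  full simplex or void.\<close>

lemma gens_lin_far:
  assumes A: "finite A" "Y \<subseteq> A" "Y \<noteq> {}" and far: "\<And>y. y \<in> Y \<Longrightarrow> a + s \<le> p y"
  shows "gens TYPE('f :: field) A (lin_cx s p Y a) k 0"
proof -
  obtain w where w: "w \<in> Y" using A(3) by blast
  show ?thesis
  proof (rule gens_cone[of A w])
    fix \<sigma> assume "\<sigma> \<in> lin_cx s p Y a"
    then obtain g where g: "\<sigma> \<subseteq> Y" "a \<le> g" "g + s \<le> 1" by (rule lin_cxE)
    show "insert w \<sigma> \<in> lin_cx s p Y a"
    proof (rule lin_cxI)
      show "insert w \<sigma> \<subseteq> Y" using g w by blast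
      then show "p b \<le> a \<or> a + s \<le> p b" if "b \<in> insert w \<sigma>" for b using far that by blast
    qed (use g in simp_all)
  qed (use A w in auto)
qed

text \<open>A gap cannot end before \<open>d\<close>, since that would place \<open>d\<close> at or
  beyond \<open>a + s\<close>. So it starts at or after \<open>d\<close>, hence after
  \<open>y\<close>: the link of \<open>d\<close> is a cone with apex \<open>y\<close>, and
  \<open>d\<close> can be deleted.\<close>

lemma gens_lin_dominated:
  assumes A: "finite A" "y \<in> A" "Z \<subseteq> A"
    and D: "finite D" "D \<subseteq> A" "\<And>d. d \<in> D \<Longrightarrow> p y < p d \<and> p d < a + s"
    and g: "gens TYPE('f :: field) A (lin_cx s p (insert y Z) a) k m"
  shows "gens TYPE('f) A (lin_cx s p (insert y Z \<union> D) a) k m"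
  using D
proof (induction D rule: finite_induct)
  case empty
  then show ?case using g by simp
next
  case (insert d D)
  let ?Y = "insert y Z \<union> insert d D"
  let ?K = "lin_cx s p ?Y a"
  have IH: "gens TYPE('f) A (lin_cx s p (insert y Z \<union> D) a) k m"
    using insert.prems by (intro insert.IH) auto
  have dy: "p y < p d" "p d < a + s" using insert.prems(2)[of d] by simp_all
  show ?case
  proof (cases "d \<in> insert y Z")
    case True
    then have "?Y = insert y Z \<union> D" by blast
    then show ?thesis using IH by (simp only:)
  next
    case False
    then have "?Y - {d} = insert y Z \<union> D" using insert.hyps(2) by blast
    then have dl: "gens TYPE('f) A {\<sigma>\<in>?K. d \<notin> \<sigma>} k m" using IH by (simp only: lin_cx_remove)
    have sK: "simplicial A ?K" using A insert.prems by (intro simplicial_lin_cx) auto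
    have lk: "gens TYPE('f) A {\<sigma>. d \<notin> \<sigma> \<and> insert d \<sigma> \<in> ?K} l 0" for l
    proof (rule gens_cone[OF A(1,2)])
      fix \<sigma> assume \<sigma>: "\<sigma> \<in> {\<sigma>. d \<notin> \<sigma> \<and> insert d \<sigma> \<in> ?K}"
      then have "insert d \<sigma> \<in> ?K" by blast
      then obtain g where g: "insert d \<sigma> \<subseteq> ?Y" "a \<le> g" "g + s \<le> 1"
        "\<And>b. b \<in> insert d \<sigma> \<Longrightarrow> p b \<le> g \<or> g + s \<le> p b" by (rule lin_cxE) blast
      have "p d \<le> g" using g(2) g(4)[of d] dy by auto
      then have "insert d (insert y \<sigma>) \<in> ?K"
        using g dy by (intro lin_cxI[of _ _ _ g]) auto
      moreover have "d \<noteq> y" using dy by blast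
      ultimately show "insert y \<sigma> \<in> {\<sigma>. d \<notin> \<sigma> \<and> insert d \<sigma> \<in> ?K}" using \<sigma> by blast
    qed
    show ?thesis
    proof (cases k)
      case 0
      then show ?thesis using gens_remove_zero[OF sK] dl by (simp only:)
    next
      case (Suc l)
      have "d \<in> A" using insert.prems(1) by blast
      from gens_remove[OF sK this dl[unfolded Suc] lk] show ?thesis unfolding Suc by simp
    qed
  qed
qed

lemma min_position:
  fixes p :: "'a \<Rightarrow> real"
  assumes "finite Y" "Y \<noteq> {}" "inj_on p Y"
  obtains y where "y \<in> Y" "\<forall>z\<in>Y. z \<noteq> y \<longrightarrow> p y < p z"
proof -
  define y where "y = arg_min_on p Y"
  have y: "y \<in> Y" "\<And>z. z \<in> Y \<Longrightarrow> p y \<le> p z"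
    using arg_min_if_finite(1)[OF assms(1,2)] arg_min_least[OF assms(1,2)] by (auto simp: y_def)
  then have "p y < p z" if "z \<in> Y" "z \<noteq> y" for z
    using inj_onD[OF assms(3), of y z] that by (fastforce simp: less_le)
  then show ?thesis using that y(1) by blast
qed

text \<open>All points are dominated by the leftmost one. With a single vertex there is either a
  cone or no vertex that is a simplex, and then only the class of the empty simplex can
  remain.\<close>

lemma gens_lin_near:
  assumes A: "finite A" "Y \<subseteq> A" and inj: "inj_on p Y"
    and near: "\<And>y. y \<in> Y \<Longrightarrow> p y < a + s"
  shows "gens TYPE('f :: field) A (lin_cx s p Y a) k (if k = 0 \<and> a + s \<le> 1 then 1 else 0)"
    (is "gens _ _ _ _ ?m")
proof -
  have small: "gens TYPE('f) A (lin_cx s p Z a) k ?m" if Z: "lin_cx s p Z a \<subseteq> {{}}" for Z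
  proof (rule gens_mono[OF gens_subset_empty[OF Z]])
    have "lin_cx s p Z a \<noteq> {} \<Longrightarrow> a + s \<le> 1" by (auto elim!: lin_cxE)
    then show "(if k = 0 \<and> lin_cx s p Z a \<noteq> {} then 1 else 0) \<le> ?m" by auto
  qed
  show ?thesis
  proof (cases "Y = {}")
    case True
    then show ?thesis by (intro small) (auto elim!: lin_cxE)
  next
    case False
    have fY: "finite Y" using A finite_subset by blast
    obtain y where y: "y \<in> Y" "\<forall>z\<in>Y. z \<noteq> y \<longrightarrow> p y < p z"
      using min_position[OF fY False inj] by blast
    have "gens TYPE('f) A (lin_cx s p (insert y {}) a) k ?m"
    proof (cases "{y} \<in> lin_cx s p {y} a")
      case True
      have "gens TYPE('f) A (lin_cx s p {y} a) k 0"
      proof (rule gens_cone[of A y])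
        fix \<sigma> assume "\<sigma> \<in> lin_cx s p {y} a"
        then have "insert y \<sigma> = {y}" by (auto elim!: lin_cxE)
        then show "insert y \<sigma> \<in> lin_cx s p {y} a" using True by (simp only:)
      qed (use A y in auto)
      then show ?thesis by (rule gens_mono) simp
    next
      case False
      have "\<sigma> = {}" if "\<sigma> \<in> lin_cx s p {y} a" for \<sigma>
      proof -
        have "\<sigma> \<subseteq> {y}" using that by (rule lin_cxE)
        then have "\<sigma> = {} \<or> \<sigma> = {y}" by (rule subset_singletonD)
        then show ?thesis using that False by blast
      qed
      then show ?thesis by (intro small) blast
    qed
    then have "gens TYPE('f) A (lin_cx s p (insert y {} \<union> (Y - {y})) a) k ?m"
      using A y near fY by (intro gens_lin_dominated) auto
    moreover have "insert y {} \<union> (Y - {y}) = Y" using y(1) by blast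
    ultimately show ?thesis by (simp only:)
  qed
qed

text \<open>After deletion of the dominated points, removing \<open>y\<close> leaves the far points,
  which form an acyclic complex. The complex is therefore homologically the suspension of the link
  of \<open>y\<close>, which is the linear complex on \<open>Z\<close> starting at
  \<open>p y\<close>.\<close>

lemma gens_lin_step:
  assumes A: "finite A" "Y \<subseteq> A" and s: "0 < s"
    and y: "y \<in> Y" "\<forall>z\<in>Y. z \<noteq> y \<longrightarrow> p y < p z" "a < p y" "p y < a + s"
    and Z: "Z = {z\<in>Y. a + s \<le> p z}" "Z \<noteq> {}"
  shows "gens TYPE('f :: field) A (lin_cx s p Y a) 0 0"
    and "gens TYPE('f) A (lin_cx s p Z (p y)) k m \<Longrightarrow> m \<le> 1 \<Longrightarrow> gens TYPE('f) A (lin_cx s p Y a) (Suc k) m"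
proof -
  let ?K = "lin_cx s p (insert y Z) a"
  have ZA: "Z \<subseteq> A" "y \<in> A" using A Z(1) y(1) by auto
  have yZ: "y \<notin> Z" using y(4) Z(1) by auto
  have sK: "simplicial A ?K" using A ZA by (intro simplicial_lin_cx) auto
  have "insert y Z - {y} = Z" using yZ by blast
  then have dl: "gens TYPE('f) A {\<sigma>\<in>?K. y \<notin> \<sigma>} l 0" for l
    using gens_lin_far[OF A(1) ZA(1) Z(2), of a s p l] Z(1) by (simp add: lin_cx_remove)
  have Yeq: "insert y Z \<union> (Y - insert y Z) = Y" using y(1) Z(1) by blast
  have dom: "gens TYPE('f) A (lin_cx s p Y a) l m'" if "gens TYPE('f) A ?K l m'" for l m'
  proof -
    have "gens TYPE('f) A (lin_cx s p (insert y Z \<union> (Y - insert y Z)) a) l m'"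
    proof (rule gens_lin_dominated[OF A(1) ZA(2,1) _ _ _ that])
      show "finite (Y - insert y Z)" using A finite_subset by blast
      show "p y < p d \<and> p d < a + s" if "d \<in> Y - insert y Z" for d
        using y(2) that Z(1) by auto
    qed (use A in blast)
    then show ?thesis unfolding Yeq .
  qed
  show "gens TYPE('f) A (lin_cx s p Y a) 0 0"
    by (rule dom[OF gens_remove_zero[OF sK dl]])
  assume g: "gens TYPE('f) A (lin_cx s p Z (p y)) k m" and m: "m \<le> 1"
  have "{\<sigma>. y \<notin> \<sigma> \<and> insert y \<sigma> \<in> ?K} = lin_cx s p Z (p y)"
  proof (intro equalityI subsetI)
    fix \<sigma> assume "\<sigma> \<in> {\<sigma>. y \<notin> \<sigma> \<and> insert y \<sigma> \<in> ?K}"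
    then have \<sigma>: "y \<notin> \<sigma>" "insert y \<sigma> \<in> ?K" by simp_all
    from \<sigma>(2) obtain g where g: "insert y \<sigma> \<subseteq> insert y Z" "a \<le> g" "g + s \<le> 1"
      "\<And>b. b \<in> insert y \<sigma> \<Longrightarrow> p b \<le> g \<or> g + s \<le> p b" by (rule lin_cxE) blast
    have "p y \<le> g" using g(2) g(4)[of y] y(4) by auto
    then show "\<sigma> \<in> lin_cx s p Z (p y)" using g \<sigma>(1) by (intro lin_cxI[of _ _ _ g]) auto
  next
    fix \<sigma> assume "\<sigma> \<in> lin_cx s p Z (p y)"
    then obtain g where g: "\<sigma> \<subseteq> Z" "p y \<le> g" "g + s \<le> 1"
      "\<And>b. b \<in> \<sigma> \<Longrightarrow> p b \<le> g \<or> g + s \<le> p b" by (rule lin_cxE) blast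
    then have "insert y \<sigma> \<in> ?K" using y(3) by (intro lin_cxI[of _ _ _ g]) auto
    then show "\<sigma> \<in> {\<sigma>. y \<notin> \<sigma> \<and> insert y \<sigma> \<in> ?K}" using g(1) yZ by blast
  qed
  then have "gens TYPE('f) A ?K (Suc k) (0 + m)" using g by (intro gens_remove[OF sK ZA(2) dl _ m]) simp
  then show "gens TYPE('f) A (lin_cx s p Y a) (Suc k) m" using dom by simp
qed

text \<open>For positions measured from \<open>v\<close> and a = 0, this makes \<open>v\<close>
  together with \<open>G\<close> a spread set: \<open>a\<close> stands for \<open>v\<close> as
  starting point, and \<open>g + s \<le> 1\<close> is the distance back to \<open>v\<close>, which
  reappears at position 1.\<close>

definition lin_spread :: "real \<Rightarrow> ('a \<Rightarrow> real) \<Rightarrow> 'a set \<Rightarrow> real \<Rightarrow> 'a set \<Rightarrow> bool" where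
  "lin_spread s p Y a G \<longleftrightarrow> G \<subseteq> Y \<and> (\<forall>g\<in>insert a (p ` G). g + s \<le> 1 \<and> (\<forall>h\<in>p ` G. g < h \<longrightarrow> g + s \<le> h)) \<and>
     (\<forall>y\<in>Y - G. \<exists>g\<in>insert a (p ` G). g < p y \<and> p y < g + s)"

lemma lin_spreadD:
  assumes "lin_spread s p Y a G"
  shows "G \<subseteq> Y" "\<And>g. g \<in> insert a (p ` G) \<Longrightarrow> g + s \<le> 1"
    "\<And>g h. g \<in> insert a (p ` G) \<Longrightarrow> h \<in> p ` G \<Longrightarrow> g < h \<Longrightarrow> g + s \<le> h"
    "\<And>y. y \<in> Y \<Longrightarrow> y \<notin> G \<Longrightarrow> \<exists>g\<in>insert a (p ` G). g < p y \<and> p y < g + s"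
  using assms unfolding lin_spread_def by blast+

lemma lin_spreadI:
  assumes "G \<subseteq> Y" "\<And>g. g \<in> insert a (p ` G) \<Longrightarrow> g + s \<le> 1"
    "\<And>g h. g \<in> insert a (p ` G) \<Longrightarrow> h \<in> p ` G \<Longrightarrow> g < h \<Longrightarrow> g + s \<le> h"
    "\<And>y. y \<in> Y \<Longrightarrow> y \<notin> G \<Longrightarrow> \<exists>g\<in>insert a (p ` G). g < p y \<and> p y < g + s"
  shows "lin_spread s p Y a G"
  using assms unfolding lin_spread_def by blast

text \<open>Two suspension steps, at the first point \<open>y\<close> after \<open>a\<close> and at
  the first point \<open>z\<close> at distance at least \<open>s\<close> from \<open>a\<close>,
  lower the index by two and move the start to \<open>z\<close>. Unless something acyclic is met on
  the way, the points \<open>z\<close> so visited form \<open>G\<close>, and the process ends with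
  the empty simplex at index 0.\<close>

lemma gens_lin_even:
  assumes A: "finite A" and s: "0 < s"
    and Y: "Y \<subseteq> A" "inj_on p Y" "\<And>y. y \<in> Y \<Longrightarrow> a < p y"
  shows "gens TYPE('f :: field) A (lin_cx s p Y a) (2 * i) 1 \<and>
    (\<not> gens TYPE('f) A (lin_cx s p Y a) (2 * i) 0 \<longrightarrow> (\<exists>G. card G = i \<and> lin_spread s p Y a G))"
  using Y
proof (induction "card Y" arbitrary: Y a i rule: less_induct)
  case less
  note YA = less.prems(1) and inj = less.prems(2) and pos = less.prems(3)
  have fY: "finite Y" using YA A finite_subset by blast
  let ?g = "\<lambda>m. gens TYPE('f) A (lin_cx s p Y a) (2 * i) m"
  have zero: ?case if "?g 0" using that gens_mono[OF that, of 1] by simp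
  define Z where "Z = {z\<in>Y. a + s \<le> p z}"
  show ?case
  proof (cases "Z = {}")
    case True
    then have near: "p y < a + s" if "y \<in> Y" for y using that by (auto simp: Z_def)
    note g = gens_lin_near[OF A YA inj near, of "2 * i", where 'f='f]
    show ?thesis
    proof (cases "i = 0 \<and> a + s \<le> 1")
      case i: True
      have "lin_spread s p Y a {}" using i near pos by (intro lin_spreadI) auto
      moreover have "card {} = i" using i by simp
      ultimately have "\<exists>G. card G = i \<and> lin_spread s p Y a G" by blast
      then show ?thesis using g i by simp
    next
      case False
      then have "?g 0" using g by (auto split: if_splits)
      then show ?thesis by (rule zero)
    qed
  next
    case Zne: False
    have ZY: "Z \<subseteq> Y" by (auto simp: Z_def)
    show ?thesis
    proof (cases "\<forall>y\<in>Y. a + s \<le> p y")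
      case True
      then have "?g 0" using Zne ZY by (intro gens_lin_far[OF A YA]) auto
      then show ?thesis by (rule zero)
    next
      case False
      have "Y \<noteq> {}" using Zne ZY by blast
      then obtain y where y: "y \<in> Y" "\<forall>z\<in>Y. z \<noteq> y \<longrightarrow> p y < p z"
        using min_position[OF fY _ inj] by blast
      have yas: "p y < a + s"
      proof -
        obtain z where "z \<in> Y" "p z < a + s" using False by force
        then show ?thesis using y(2) by (cases "z = y") auto
      qed
      note step = gens_lin_step[OF A YA s y pos[OF y(1)] yas Z_def Zne, where 'f='f]
      show ?thesis
      proof (cases i)
        case 0
        then show ?thesis using zero step(1) by simp
      next
        case (Suc j)
        have i2: "2 * i = Suc (Suc (2 * j))" using Suc by simp
        have red: "?g m" if "gens TYPE('f) A (lin_cx s p Z (p y)) (Suc (2 * j)) m" "m \<le> 1" for m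
          unfolding i2 by (rule step(2)[OF that])
        have ZA: "Z \<subseteq> A" using ZY YA by blast
        have injZ: "inj_on p Z" using inj ZY by (rule inj_on_subset)
        define W where "W = {z\<in>Z. p y + s \<le> p z}"
        show ?thesis
        proof (cases "W = {}")
          case True
          then have near: "p z < p y + s" if "z \<in> Z" for z using that by (auto simp: W_def)
          \<comment> \<open>The index is odd here, so the class of the empty simplex cannot
            appear.\<close>
          have "?g 0" using gens_lin_near[OF A ZA injZ near, of "Suc (2*j)", where 'f='f] by (intro red) simp_all
          then show ?thesis by (rule zero)
        next
          case Wne: False
          show ?thesis
          proof (cases "\<forall>z\<in>Z. p y + s \<le> p z")
            case True
            then have "?g 0" by (intro red gens_lin_far[OF A ZA Zne]) simp_all
            then show ?thesis by (rule zero)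
          next
            case nfar: False
            obtain z where z: "z \<in> Z" "\<forall>x\<in>Z. x \<noteq> z \<longrightarrow> p z < p x"
              using min_position[OF finite_subset[OF ZA A] Zne injZ] by blast
            have zys: "p z < p y + s"
            proof -
              obtain x where "x \<in> Z" "p x < p y + s" using nfar by force
              then show ?thesis using z(2) by (cases "x = z") auto
            qed
            have yz: "p y < p z" using z(1) yas by (auto simp: Z_def)
            have zas: "a + s \<le> p z" using z(1) by (simp add: Z_def)
            note step' = gens_lin_step(2)[OF A ZA s z yz zys W_def Wne, where 'f='f]
            have red': "?g m" if "gens TYPE('f) A (lin_cx s p W (p z)) (2 * j) m" "m \<le> 1" for m
              by (rule red[OF step'[OF that] that(2)])
            have WY: "W \<subseteq> Y" "y \<notin> W" using ZY y(1) s by (auto simp: W_def)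
            then have "W \<subset> Y" using y(1) by blast
            then have cW: "card W < card Y" by (rule psubset_card_mono[OF fY])
            have IH: "gens TYPE('f) A (lin_cx s p W (p z)) (2 * j) 1 \<and>
              (\<not> gens TYPE('f) A (lin_cx s p W (p z)) (2 * j) 0 \<longrightarrow> (\<exists>G. card G = j \<and> lin_spread s p W (p z) G))"
              using WY YA inj_on_subset[OF inj WY(1)] zys by (intro less.hyps[OF cW]) (auto simp: W_def)
            show ?thesis
            proof (cases "gens TYPE('f) A (lin_cx s p W (p z)) (2 * j) 0")
              case True
              then have "?g 0" by (rule red') simp
              then show ?thesis by (rule zero)
            next
              case False
              then obtain G where G: "card G = j" "lin_spread s p W (p z) G" using IH by blast
              note D = lin_spreadD[OF G(2)]
              have zG: "z \<notin> G" using D(1) zys by (auto simp: W_def)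
              have fG: "finite G" by (rule finite_subset[OF subset_trans[OF D(1) WY(1)] fY])
              have Ggt: "p z < h" if "h \<in> p ` G" for h using that D(1) zys by (force simp: W_def)
              have "lin_spread s p Y a (insert z G)"
              proof (rule lin_spreadI)
                show "insert z G \<subseteq> Y" using D(1) WY(1) z(1) ZY by blast
                fix g assume g: "g \<in> insert a (p ` insert z G)"
                have z1: "p z + s \<le> 1" using D(2)[of "p z"] by simp
                show "g + s \<le> 1" using g D(2)[of g] z1 zas s by (cases "g = a") auto
                fix h assume h: "h \<in> p ` insert z G" "g < h"
                have hz: "p z \<le> h" using h(1) Ggt[of h] by (cases "h = p z") auto
                show "g + s \<le> h"
                proof (cases "g = a")
                  case True then show ?thesis using hz zas by simp
                next
                  case False
                  then have g': "g \<in> insert (p z) (p ` G)" using g by blast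
                  then have "p z \<le> g" using Ggt[of g] by (cases "g = p z") auto
                  then have "h \<noteq> p z" using h(2) by simp
                  then have "h \<in> p ` G" using h(1) by blast
                  then show ?thesis using D(3)[OF g' _ h(2)] by simp
                qed
              next
                fix x assume x: "x \<in> Y" "x \<notin> insert z G"
                show "\<exists>g\<in>insert a (p ` insert z G). g < p x \<and> p x < g + s"
                proof (cases "x \<in> Z")
                  case False
                  then have "p x < a + s" using x(1) by (auto simp: Z_def)
                  then show ?thesis using pos[OF x(1)] by auto
                next
                  case xZ: True
                  then have zx: "p z < p x" using z(2) x(2) by blast
                  show ?thesis
                  proof (cases "x \<in> W")
                    case True
                    then show ?thesis using D(4)[of x] x(2) by auto
                  next
                    case False
                    then have "p x < p z + s" using xZ yz by (auto simp: W_def)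
                    then show ?thesis using zx by auto
                  qed
                qed
              qed
              moreover have "card (insert z G) = i" using zG fG G(1) Suc by simp
              moreover have "?g 1" using IH by (intro red') simp_all
              ultimately show ?thesis by blast
            qed
          qed
        qed
      qed
    qed
  qed
qed

context circle_points
begin

lemma link_eq_lin_cx:
  assumes v: "v \<in> X"
  shows "{\<sigma>. v \<notin> \<sigma> \<and> insert v \<sigma> \<in> arc_cx s X} = lin_cx s (cw v) (X - {v}) 0"
proof (intro equalityI subsetI)
  have vc: "v \<in> circle" using v Xcirc by blast
  fix \<sigma> assume "\<sigma> \<in> {\<sigma>. v \<notin> \<sigma> \<and> insert v \<sigma> \<in> arc_cx s X}"
  then obtain a where \<sigma>: "v \<notin> \<sigma>" "\<sigma> \<subseteq> X" and a: "a \<in> circle" "\<And>b. b \<in> insert v \<sigma> \<Longrightarrow> s \<le> cw a b"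
    unfolding arc_cx_def by blast
  \<comment> \<open>An arc starting at \<open>v\<close> has start position 1 by the convention for
    \<open>cw\<close>, but on the line its gap begins at 0.\<close>
  define g where "g = (if a = v then 0 else cw v a)"
  show "\<sigma> \<in> lin_cx s (cw v) (X - {v}) 0"
  proof (rule lin_cxI)
    show "\<sigma> \<subseteq> X - {v}" using \<sigma> by blast
    show "0 \<le> g" using cw_pos[OF vc a(1)] by (simp add: g_def)
    show "g + s \<le> 1"
      using a(2)[of v] cw_shift[OF vc vc a(1)] cw_self[of v] cw_less_1[OF vc a(1)] s1 by (auto simp: g_def)
    fix b assume b: "b \<in> \<sigma>"
    then have "b \<in> circle" using \<sigma>(2) Xcirc by blast
    then show "cw v b \<le> g \<or> g + s \<le> cw v b"
      using a(2)[of b] b cw_shift[OF vc _ a(1), of b] by (auto simp: g_def split: if_splits)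
  qed
next
  have vc: "v \<in> circle" using v Xcirc by blast
  fix \<sigma> assume "\<sigma> \<in> lin_cx s (cw v) (X - {v}) 0"
  then obtain g where g: "\<sigma> \<subseteq> X - {v}" "0 \<le> g" "g + s \<le> 1"
    "\<And>b. b \<in> \<sigma> \<Longrightarrow> cw v b \<le> g \<or> g + s \<le> cw v b" by (rule lin_cxE) blast
  \<comment> \<open>The point at position \<open>g\<close> from \<open>v\<close>, reduced modulo 1
    to the fundamental domain.\<close>
  define a where "a = (if v + g < 1 then v + g else v + g - 1)"
  have a: "a \<in> circle" using vc g s0 by (auto simp: a_def circle_def)
  have va: "cw v a = (if g = 0 then 1 else g)"
    using vc g(2,3) s0 by (auto simp: a_def cw_def circle_def)
  have "s \<le> cw a b" if "b \<in> insert v \<sigma>" for b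
  proof (cases "b = v")
    case True
    then show ?thesis using cw_shift[OF vc vc a] va cw_self[of v] g(3) s0 s1 by auto
  next
    case False
    then have b: "b \<in> \<sigma>" using that by blast
    then have bc: "b \<in> circle" using g(1) Xcirc by blast
    have "cw v b < 1" using cw_less_1[OF vc bc] False by blast
    then show ?thesis
      using cw_shift[OF vc bc a] va g(4)[OF b] cw_pos[OF vc bc] g(3) s0 by (auto split: if_splits)
  qed
  then have "insert v \<sigma> \<in> arc_cx s X" using a g(1) v unfolding arc_cx_def by blast
  then show "\<sigma> \<in> {\<sigma>. v \<notin> \<sigma> \<and> insert v \<sigma> \<in> arc_cx s X}" using g(1) by blast
qed

lemma lin_spread_spread:
  assumes v: "v \<in> X" and G: "lin_spread s (cw v) (X - {v}) 0 G"
  shows "spread s X (insert v G)"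
proof -
  note D = lin_spreadD[OF G]
  have vc: "v \<in> circle" and GX: "G \<subseteq> X" and vG: "v \<notin> G" using v Xcirc D(1) by auto
  have pG: "0 < cw v c" "cw v c < 1" "c \<in> circle" if "c \<in> G" for c
  proof -
    show c: "c \<in> circle" using that GX Xcirc by blast
    show "0 < cw v c" using cw_pos[OF vc c] .
    show "cw v c < 1" using cw_less_1[OF vc c] that vG by blast
  qed
  have big: "s \<le> cw v d" if "d \<in> G" for d using D(3)[of 0 "cw v d"] pG(1)[OF that] that by simp
  have "s \<le> cw c d" if cd: "c \<in> insert v G" "d \<in> insert v G" for c d
  proof (cases "c = v")
    case True
    then show ?thesis using cd(2) big cw_self[of v] s1 by auto
  next
    case False
    then have c: "c \<in> G" using cd(1) by blast
    note sh = cw_shift[OF vc _ pG(3)[OF c]]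
    have c1: "cw v c + s \<le> 1" using D(2) c by blast
    show ?thesis
    proof (cases "d = v")
      case True
      then show ?thesis using sh[OF vc] cw_self[of v] pG(2)[OF c] c1 by simp
    next
      case False
      then have d: "d \<in> G" using cd(2) by blast
      show ?thesis using sh[OF pG(3)[OF d]] D(3)[of "cw v c" "cw v d"] c d c1 pG(1)[OF d] by auto
    qed
  qed
  moreover have "\<exists>a\<in>insert v G. cw a x < s" if x: "x \<in> X" "x \<notin> insert v G" for x
  proof -
    have xc: "x \<in> circle" using x Xcirc by blast
    obtain g where g: "g \<in> insert 0 (cw v ` G)" "g < cw v x" "cw v x < g + s"
      using D(4)[of x] x by blast
    show ?thesis
    proof (cases "g = 0")
      case True
      then show ?thesis using g by auto
    next
      case False
      then obtain c where c: "c \<in> G" "g = cw v c" using g(1) by blast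
      then have "cw c x < s" using cw_shift[OF vc xc pG(3)[OF c(1)]] g(2,3) by simp
      then show ?thesis using c(1) by blast
    qed
  qed
  ultimately show ?thesis unfolding spread_def using v GX by blast
qed

lemma gens_link:
  assumes A: "finite A" "X \<subseteq> A" and v: "v \<in> X"
  shows "gens TYPE('f :: field) A {\<sigma>. v \<notin> \<sigma> \<and> insert v \<sigma> \<in> arc_cx s X} (2 * i) 1"
    and "(\<And>I. I \<in> spreads s X (Suc i) \<Longrightarrow> v \<notin> I) \<Longrightarrow>
      gens TYPE('f) A {\<sigma>. v \<notin> \<sigma> \<and> insert v \<sigma> \<in> arc_cx s X} (2 * i) 0"
proof -
  have vc: "v \<in> circle" using v Xcirc by blast
  have inj: "inj_on (cw v) (X - {v})" using cw_inj[OF vc] Xcirc by (intro inj_onI) blast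
  have pos: "0 < cw v y" if "y \<in> X - {v}" for y using cw_pos[OF vc] that Xcirc by blast
  have "X - {v} \<subseteq> A" using A by blast
  note even = gens_lin_even[OF A(1) s0 this inj pos, of i, where 'f='f]
  show "gens TYPE('f) A {\<sigma>. v \<notin> \<sigma> \<and> insert v \<sigma> \<in> arc_cx s X} (2 * i) 1"
    unfolding link_eq_lin_cx[OF v] using even by blast
  assume none: "\<And>I. I \<in> spreads s X (Suc i) \<Longrightarrow> v \<notin> I"
  have False if G: "card G = i" "lin_spread s (cw v) (X - {v}) 0 G" for G
  proof -
    have "G \<subseteq> X - {v}" by (rule lin_spreadD(1)[OF G(2)])
    then have "finite G" "v \<notin> G" using finX finite_subset by blast+
    then have "card (insert v G) = Suc i" using G(1) by simp
    then have "insert v G \<in> spreads s X (Suc i)"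
      using lin_spread_spread[OF v G(2)] by (simp add: spreads_def)
    from none[OF this] show False by blast
  qed
  then show "gens TYPE('f) A {\<sigma>. v \<notin> \<sigma> \<and> insert v \<sigma> \<in> arc_cx s X} (2 * i) 0"
    unfolding link_eq_lin_cx[OF v] using even by blast
qed

end

section \<open>Homology of arc complexes\<close>

text \<open>
  Vertices outside the image of \<open>nxt\<close> can be removed without harm. If there are none, \<open>nxt\<close>
  permutes the points: without a spread set of the right size, the removal of any vertex creates at
  most one such set, and otherwise the removal of a vertex of a spread set destroys that set.
\<close>

theorem gens_arc_cx:
  assumes "circle_points s X" and A: "finite A" "X \<subseteq> A"
  shows "gens TYPE('f :: field) A (arc_cx s X) (Suc (2 * i)) (card (spreads s X (Suc i)) - 1)"
  using assms(1,3)
proof (induction "card X" arbitrary: X rule: less_induct)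
  case less
  interpret circle_points s X by (rule less.prems(1))
  note XA = less.prems(2)
  let ?N = "\<lambda>X. card (spreads s X (Suc i))"
  let ?g = "\<lambda>m. gens TYPE('f) A (arc_cx s X) (Suc (2 * i)) m"
  have sX: "simplicial A (arc_cx s X)" by (rule simplicial_arc_cx[OF A(1) XA])
  have dl: "gens TYPE('f) A {\<sigma>\<in>arc_cx s X. v \<notin> \<sigma>} (Suc (2 * i)) (?N (X - {v}) - 1)" if "v \<in> X" for v
    unfolding arc_cx_remove
  proof (rule less.hyps)
    show "card (X - {v}) < card X" by (rule card_Diff1_less[OF finX that])
  qed (use remove XA in auto)
  have rem: "?g (?N (X - {v}) - 1)" if v: "v \<in> X" "\<And>I. I \<in> spreads s X (Suc i) \<Longrightarrow> v \<notin> I" for v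
    using gens_remove[OF sX _ dl[OF v(1)] gens_link(2)[OF A(1) XA v]] v(1) XA by auto
  show ?case
  proof (cases "X = {}")
    case True
    have "arc_cx s X \<subseteq> {{}}" unfolding arc_cx_def True by blast
    from gens_subset_empty[OF this, of A "Suc (2 * i)", where 'f='f] have "?g 0" by simp
    then show ?thesis by (rule gens_mono) simp
  next
    case Xne: False
    show ?thesis
    proof (cases "nxt s X ` X = X")
      case False
      then obtain v where v: "v \<in> X" "v \<notin> nxt s X ` X" using nxt_in by blast
      have "?g (?N (X - {v}) - 1)"
        using spreads_remove_nonimage(2)[OF v(2)] by (intro rem[OF v(1)]) (simp add: spreads_def)
      moreover have "?N (X - {v}) \<le> ?N X"
        by (rule card_mono[OF finite_spreads spreads_remove_nonimage(1)[OF v(2)]])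
      then have "?N (X - {v}) - 1 \<le> ?N X - 1" by (rule diff_le_mono)
      ultimately show ?thesis by (rule gens_mono)
    next
      case bij: True
      have inj: "inj_on (nxt s X) X" using bij finX by (simp add: eq_card_imp_inj_on)
      show ?thesis
      proof (cases "spreads s X (Suc i) = {}")
        case True
        obtain v where v: "v \<in> X" using Xne by blast
        have "?g (?N (X - {v}) - 1)" using True by (intro rem[OF v]) simp
        moreover have "?N (X - {v}) - 1 = 0" using card_spreads_remove_inj[OF inj True, of v] by simp
        ultimately show ?thesis using True by simp
      next
        case False
        then obtain I where I: "I \<in> spreads s X (Suc i)" by blast
        then have spI: "spread s X I" by (simp add: spreads_def)
        show ?thesis
        proof (cases "I = X")
          case True
          obtain a where a: "a \<in> I" using spreadD(1)[OF spI] by blast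
          \<comment> \<open>All points are pairwise at distance at least \<open>s\<close>, so the
            arc after \<open>a\<close> is free for every subset and the complex is a full
            simplex.\<close>
          have "?g 0"
          proof (rule gens_cone[OF A(1)])
            show "a \<in> A" using a True XA by blast
            fix \<sigma> assume "\<sigma> \<in> arc_cx s X"
            then have "insert a \<sigma> \<subseteq> X" using a True unfolding arc_cx_def by blast
            moreover have "s \<le> cw a b" if "b \<in> X" for b using spreadD(4)[OF spI a] that True by blast
            moreover have "a \<in> circle" using a True Xcirc by blast
            ultimately show "insert a \<sigma> \<in> arc_cx s X" unfolding arc_cx_def by blast
          qed
          then show ?thesis by (rule gens_mono) simp
        next
          case False
          obtain v where v: "v \<in> I" using spreadD(1)[OF spI] by blast
          have vX: "v \<in> X" by (rule spreadD(3)[OF spI v])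
          have "?g (?N (X - {v}) - 1 + 1)"
            using vX XA by (intro gens_remove[OF sX _ dl gens_link(1)[OF A(1) XA vX]]) auto
          moreover have "?N (X - {v}) \<le> ?N X - 1"
            using card_mono[OF _ spreads_remove_spread[OF inj I v]] finite_spreads I by simp
          \<comment> \<open>If no spread set survives the removal of \<open>v\<close>, truncated
            subtraction makes the bound for the deletion 0 and the total 1; the second spread set of
            \<open>X\<close> leaves room for it.\<close>
          moreover have "2 \<le> ?N X" by (rule spreads_second[OF bij I False])
          ultimately have "?g (?N (X - {v}) - 1 + 1)" "?N (X - {v}) - 1 + 1 \<le> ?N X - 1" by simp_all
          then show ?thesis by (rule gens_mono)
        qed
      qed
    qed
  qed
qed

section \<open>Euler characteristic and exact Betti numbers in even degrees\<close>

lemma sum_Pow_alternating: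
  "finite S \<Longrightarrow> (\<Sum>T\<in>Pow S. (-1) ^ card T) = (if S = {} then 1 else 0 :: int)"
  using prod_diff_conv_sum[of S "\<lambda>_. 1" "\<lambda>_. 1 :: int"] by (simp add: power_0_left)

context circle_points
begin

text \<open>A free arc can be slid backwards until it starts at a vertex: the vertex that is
  farthest clockwise from the old starting point.\<close>

lemma arc_cx_iff:
  assumes \<sigma>: "\<sigma> \<subseteq> X" "\<sigma> \<noteq> {}"
  shows "\<sigma> \<in> arc_cx s X \<longleftrightarrow> {a\<in>\<sigma>. \<forall>b\<in>\<sigma>. s \<le> cw a b} \<noteq> {}"
proof
  assume "\<sigma> \<in> arc_cx s X"
  then obtain a where a: "a \<in> circle" "\<And>b. b \<in> \<sigma> \<Longrightarrow> s \<le> cw a b" unfolding arc_cx_def by blast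
  have fin: "finite \<sigma>" using \<sigma>(1) finX finite_subset by blast
  obtain c where c: "c \<in> \<sigma>" "\<And>b. b \<in> \<sigma> \<Longrightarrow> - cw a c \<le> - cw a b"
    using arg_min_if_finite(1)[OF fin \<sigma>(2), of "\<lambda>b. - cw a b"] arg_min_least[OF fin \<sigma>(2), of _ "\<lambda>b. - cw a b"]
    by blast
  have "s \<le> cw c b" if b: "b \<in> \<sigma>" for b
  proof -
    have "b \<in> circle" "c \<in> circle" using b c(1) \<sigma>(1) Xcirc by auto
    then show ?thesis using cw_shift[OF a(1), of b c] c(2)[OF b] a(2)[OF b] cw_le_1[OF a(1), of c] by simp
  qed
  then show "{a\<in>\<sigma>. \<forall>b\<in>\<sigma>. s \<le> cw a b} \<noteq> {}" using c(1) by blast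
next
  assume "{a\<in>\<sigma>. \<forall>b\<in>\<sigma>. s \<le> cw a b} \<noteq> {}"
  then obtain a where "a \<in> \<sigma>" "\<forall>b\<in>\<sigma>. s \<le> cw a b" by blast
  then show "\<sigma> \<in> arc_cx s X" using \<sigma> Xcirc unfolding arc_cx_def by blast
qed

text \<open>
  Inclusion-exclusion over the points \<open>a \<in> \<sigma>\<close> that are followed by a gap of length at least \<open>s\<close>.
  For fixed \<open>I\<close>, the sum over the sets \<open>\<sigma>\<close> in which all points of \<open>I\<close> are followed by such a gap
  alternates over the subsets of the points not covered by \<open>I\<close>.
\<close>

lemma euler_char_arc_cx: "euler_char (arc_cx s X - {{}}) = int (card {I. spread s X I})"
proof -
  define S where "S \<sigma> = {a\<in>\<sigma>. \<forall>b\<in>\<sigma>. s \<le> cw a b}" for \<sigma>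
  define U where "U I = {x\<in>X - I. \<forall>a\<in>I. s \<le> cw a x}" for I
  have fin: "finite \<sigma>" if "\<sigma> \<subseteq> X" for \<sigma> using that finX finite_subset by blast
  have finPX: "finite (Pow X)" using finX by simp
  have K: "arc_cx s X - {{}} = {\<sigma>\<in>Pow X - {{}}. S \<sigma> \<noteq> {}}"
    using arc_cx_iff unfolding S_def by (auto simp: arc_cx_def)
  have ne: "(if S \<sigma> \<noteq> {} then 1 else 0 :: int) = - (\<Sum>I\<in>Pow (S \<sigma>) - {{}}. (-1) ^ card I)"
    if "\<sigma> \<subseteq> X" for \<sigma>
  proof -
    have f: "finite (S \<sigma>)" using fin[OF that] by (simp add: S_def)
    show ?thesis using sum_Pow_alternating[OF f] sum.remove[of "Pow (S \<sigma>)" "{}" "\<lambda>I. (-1) ^ card I :: int"] f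
      by (auto split: if_splits)
  qed
  have "euler_char (arc_cx s X - {{}}) = (\<Sum>\<sigma>\<in>Pow X - {{}}. (-1) ^ (card \<sigma> - 1) * (if S \<sigma> \<noteq> {} then 1 else 0))"
    unfolding euler_char_def K using finPX by (intro sum.mono_neutral_cong_left) auto
  also have "\<dots> = (\<Sum>\<sigma>\<in>Pow X - {{}}. \<Sum>I\<in>Pow (S \<sigma>) - {{}}. (-1) ^ card \<sigma> * (-1) ^ card I)"
  proof (rule sum.cong)
    fix \<sigma> assume \<sigma>: "\<sigma> \<in> Pow X - {{}}"
    then have "card \<sigma> \<noteq> 0" using fin[of \<sigma>] by auto
    then obtain m where m: "card \<sigma> = Suc m" using not0_implies_Suc by blast
    show "(-1) ^ (card \<sigma> - 1) * (if S \<sigma> \<noteq> {} then 1 else 0 :: int) = (\<Sum>I\<in>Pow (S \<sigma>) - {{}}. (-1) ^ card \<sigma> * (-1) ^ card I)"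
      using ne[of \<sigma>] \<sigma> by (simp only: m sum_distrib_left[symmetric]) simp
  qed simp
  also have "\<dots> = (\<Sum>\<sigma>\<in>Pow X. \<Sum>I | I \<in> Pow X - {{}} \<and> I \<subseteq> S \<sigma>. (-1) ^ card \<sigma> * (-1) ^ card I)"
  proof (rule sum.mono_neutral_cong_left[OF finPX])
    show "\<forall>\<sigma>\<in>Pow X - (Pow X - {{}}). (\<Sum>I | I \<in> Pow X - {{}} \<and> I \<subseteq> S \<sigma>. (-1) ^ card \<sigma> * (-1) ^ card I) = (0 :: int)"
    proof
      fix \<sigma> assume "\<sigma> \<in> Pow X - (Pow X - {{}})"
      then have "{I. I \<in> Pow X - {{}} \<and> I \<subseteq> S \<sigma>} = {}" by (auto simp: S_def)
      then show "(\<Sum>I | I \<in> Pow X - {{}} \<and> I \<subseteq> S \<sigma>. (-1) ^ card \<sigma> * (-1) ^ card I) = (0 :: int)"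
        by (simp only: sum.empty)
    qed
    fix \<sigma> assume "\<sigma> \<in> Pow X - {{}}"
    then have "Pow (S \<sigma>) - {{}} = {I. I \<in> Pow X - {{}} \<and> I \<subseteq> S \<sigma>}" by (auto simp: S_def)
    then show "(\<Sum>I\<in>Pow (S \<sigma>) - {{}}. (-1) ^ card \<sigma> * (-1) ^ card I)
      = (\<Sum>I | I \<in> Pow X - {{}} \<and> I \<subseteq> S \<sigma>. (-1) ^ card \<sigma> * (-1) ^ card I :: int)" by (simp only:)
  qed blast
  also have "\<dots> = (\<Sum>I\<in>Pow X - {{}}. \<Sum>\<sigma> | \<sigma> \<in> Pow X \<and> I \<subseteq> S \<sigma>. (-1) ^ card \<sigma> * (-1) ^ card I)"
    by (rule sum.swap_restrict) (use finX in auto)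
  also have "\<dots> = (\<Sum>I\<in>Pow X - {{}}. if spread s X I then 1 else 0)"
  proof (rule sum.cong)
    fix I assume I: "I \<in> Pow X - {{}}"
    have finI: "finite I" and finU: "finite (U I)" using fin[of I] I finX by (auto simp: U_def)
    have disj: "I \<inter> U I = {}" by (auto simp: U_def)
    show "(\<Sum>\<sigma> | \<sigma> \<in> Pow X \<and> I \<subseteq> S \<sigma>. (-1) ^ card \<sigma> * (-1) ^ card I) = (if spread s X I then 1 else 0 :: int)"
    proof (cases "\<forall>a\<in>I. \<forall>b\<in>I. s \<le> cw a b")
      case False
      then have "{\<sigma>. \<sigma> \<in> Pow X \<and> I \<subseteq> S \<sigma>} = {}" "\<not> spread s X I"
        unfolding S_def spread_def by blast+
      then show ?thesis by (simp only: sum.empty if_False)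
    next
      case sep: True
      have img: "{\<sigma>. \<sigma> \<in> Pow X \<and> I \<subseteq> S \<sigma>} = (\<lambda>\<rho>. I \<union> \<rho>) ` Pow (U I)"
      proof (intro equalityI subsetI)
        fix \<sigma> assume \<sigma>: "\<sigma> \<in> {\<sigma>. \<sigma> \<in> Pow X \<and> I \<subseteq> S \<sigma>}"
        then have "\<sigma> = I \<union> (\<sigma> - I)" "\<sigma> - I \<in> Pow (U I)" unfolding S_def U_def by blast+
        then show "\<sigma> \<in> (\<lambda>\<rho>. I \<union> \<rho>) ` Pow (U I)" by (rule image_eqI)
      next
        fix \<sigma> assume "\<sigma> \<in> (\<lambda>\<rho>. I \<union> \<rho>) ` Pow (U I)"
        then show "\<sigma> \<in> {\<sigma>. \<sigma> \<in> Pow X \<and> I \<subseteq> S \<sigma>}" using I sep unfolding S_def U_def by blast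
      qed
      have inj: "inj_on (\<lambda>\<rho>. I \<union> \<rho>) (Pow (U I))" using disj by (intro inj_onI) blast
      have "(\<Sum>\<sigma> | \<sigma> \<in> Pow X \<and> I \<subseteq> S \<sigma>. (-1) ^ card \<sigma> * (-1) ^ card I)
        = (\<Sum>\<rho>\<in>Pow (U I). (-1) ^ card (I \<union> \<rho>) * (-1) ^ card I :: int)"
        unfolding img by (rule sum.reindex[OF inj, unfolded o_def])
      also have "\<dots> = (\<Sum>\<rho>\<in>Pow (U I). (-1) ^ card \<rho>)"
      proof (rule sum.cong)
        fix \<rho> assume "\<rho> \<in> Pow (U I)"
        then have "card (I \<union> \<rho>) = card I + card \<rho>"
          using finI finU disj finite_subset by (intro card_Un_disjoint) blast+
        then show "(-1) ^ card (I \<union> \<rho>) * (-1) ^ card I = ((-1) ^ card \<rho> :: int)"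
          by (simp add: power_add mult.commute mult.left_commute flip: power_mult_distrib)
      qed simp
      also have "\<dots> = (if U I = {} then 1 else 0)" by (rule sum_Pow_alternating[OF finU])
      also have "U I = {} \<longleftrightarrow> spread s X I"
        using sep I unfolding U_def spread_def by (auto simp: not_le)
      finally show ?thesis .
    qed
  qed simp
  also have "\<dots> = int (card {I\<in>Pow X - {{}}. spread s X I})"
    using finPX by (simp add: sum.If_cases Int_def)
  also have "{I\<in>Pow X - {{}}. spread s X I} = {I. spread s X I}" using spreadD(1,2) by blast
  finally show ?thesis .
qed

lemma card_all_spreads: "card {I. spread s X I} = (\<Sum>i<card X. card (spreads s X (Suc i)))"
proof -
  have bound: "card I - 1 < card X \<and> Suc (card I - 1) = card I" if "spread s X I" for I
  proof -
    have "card I \<le> card X" by (rule card_mono[OF finX spreadD(2)[OF that]])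
    moreover have "card I \<noteq> 0" using spread_finite[OF that] spreadD(1)[OF that] by simp
    ultimately show ?thesis by linarith
  qed
  have fin: "finite {I. spread s X I}"
    by (rule finite_subset[of _ "Pow X"]) (use finX spreadD(2) in auto)
  have "(\<Sum>i<card X. \<Sum>I\<in>{I\<in>{I. spread s X I}. card I - 1 = i}. 1) = (\<Sum>I\<in>{I. spread s X I}. 1 :: nat)"
    by (rule sum.group[OF fin]) (use bound in auto)
  moreover have "{I\<in>{I. spread s X I}. card I - 1 = i} = spreads s X (Suc i)" for i
  proof (rule set_eqI)
    fix I show "I \<in> {I\<in>{I. spread s X I}. card I - 1 = i} \<longleftrightarrow> I \<in> spreads s X (Suc i)"
      using bound[of I] unfolding spreads_def by auto
  qed
  ultimately show ?thesis by simp
qed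

text \<open>
  By Euler-Poincare, the upper bounds in even degrees are attained, although nothing is known
  about the odd degrees.
\<close>

theorem betti_arc_cx:
  assumes k: "k \<ge> 1"
  shows "betti TYPE('f :: field) (arc_cx s X - {{}}) (2 * k) = card (spreads s X (Suc k)) - 1"
proof -
  have sX: "simplicial X (arc_cx s X)" by (rule simplicial_arc_cx[OF finX subset_refl])
  have cp: "circle_points s X" by unfold_locales
  define h where "h p = reduced_betti TYPE('f) X (arc_cx s X) p" for p
  define N where "N i = card (spreads s X (Suc i))" for i
  have b: "betti TYPE('f) (arc_cx s X - {{}}) (2 * k) = h (Suc (2 * k))"
    unfolding h_def using k by (intro betti_eq_reduced[OF sX]) simp
  have upper: "h (Suc (2 * i)) \<le> N i - 1" for i
    unfolding h_def N_def by (rule reduced_betti_le[OF sX gens_arc_cx[OF cp finX subset_refl]])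
  have ne: "{} \<in> arc_cx s X" unfolding arc_cx_def circle_def by force
  have "int (\<Sum>i<card X. N i) = 1 - (\<Sum>p\<le>card X. (-1) ^ p * int (h p))"
    using euler_char_reduced_betti[OF sX ne, where 'f='f] euler_char_arc_cx card_all_spreads
    by (simp add: h_def N_def)
  also have "\<dots> = 1 + (\<Sum>p\<le>card X. - ((-1) ^ p * int (h p)))" by (simp add: sum_negf)
  \<comment> \<open>\<open>p\<close> counts vertices, so even \<open>p\<close> belong to odd
    degrees; they enter with a favourable sign and are dropped.\<close>
  also have "(\<Sum>p\<le>card X. - ((-1) ^ p * int (h p))) \<le> (\<Sum>p\<le>card X. if odd p then int (h p) else 0)"
    by (rule sum_mono) simp
  also have "\<dots> = (\<Sum>p | p \<le> card X \<and> odd p. int (h p))"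
    by (simp add: sum.If_cases Int_def)
  also have "\<dots> \<le> (\<Sum>p\<in>(\<lambda>i. Suc (2 * i)) ` {..<card X}. int (h p))"
  proof (rule sum_mono2)
    show "{p. p \<le> card X \<and> odd p} \<subseteq> (\<lambda>i. Suc (2 * i)) ` {..<card X}"
      by (auto elim!: oddE)
  qed auto
  also have "\<dots> = (\<Sum>i<card X. int (h (Suc (2 * i))))"
    by (subst sum.reindex) (auto simp: inj_on_def)
  finally have le: "(\<Sum>i<card X. N i) \<le> 1 + (\<Sum>i<card X. h (Suc (2 * i)))" by (simp flip: of_nat_sum)
  show ?thesis
  proof (cases "k < card X")
    case True
    have "(\<Sum>i<card X. N i) = N k + (\<Sum>i\<in>{..<card X}-{k}. N i)"
      "(\<Sum>i<card X. h (Suc (2 * i))) = h (Suc (2 * k)) + (\<Sum>i\<in>{..<card X}-{k}. h (Suc (2 * i)))"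
      using True by (simp_all add: sum.remove)
    \<comment> \<open>In the other even degrees the weak bound by \<open>N i\<close> is enough, so
      that the surplus 1 of the total is left for degree \<open>2 * k\<close>.\<close>
    moreover have "(\<Sum>i\<in>{..<card X}-{k}. h (Suc (2 * i))) \<le> (\<Sum>i\<in>{..<card X}-{k}. N i)"
      by (rule sum_mono) (meson diff_le_self le_trans upper)
    ultimately have "N k \<le> 1 + h (Suc (2 * k))" using le by linarith
    then have "h (Suc (2 * k)) = N k - 1" using upper[of k] by linarith
    then show ?thesis using b by (simp add: N_def)
  next
    case False
    have "spreads s X (Suc k) = {}"
    proof (rule equals0I)
      fix I assume "I \<in> spreads s X (Suc k)"
      then have "spread s X I" "card I = Suc k" by (simp_all add: spreads_def)
      then show False using card_mono[OF finX spreadD(2)[of s X I]] False by simp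
    qed
    then have "N k = 0" by (simp add: N_def)
    then show ?thesis using b upper[of k] by (simp add: N_def)
  qed
qed

end

section \<open>The Cech complex as an arc complex\<close>

text \<open>The closed arc of radius \<open>r\<close> about \<open>y\<close> is the complement of an
  open arc of length \<open>1 - 2 * r\<close> that starts at its end point \<open>y + r\<close>,
  reduced modulo 1.\<close>

lemma circle_dist_le_iff_cw:
  assumes "b \<in> circle" "y \<in> circle" "0 < r" "r < 1/2"
  shows "circle_dist b y \<le> r \<longleftrightarrow> 1 - 2 * r \<le> cw (if y + r < 1 then y + r else y + r - 1) b"
  using assms unfolding circle_dist_def cw_def circle_def
  by (auto simp: abs_if min_def split: if_splits)

lemma cech_eq_arc_cx:
  assumes X: "X \<subseteq> circle" and r: "0 < r" "r < 1/2"
  shows "cech X r = arc_cx (1 - 2 * r) X - {{}}"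
proof -
  have "(\<Inter>x\<in>\<sigma>. closed_arc x r) \<noteq> {} \<longleftrightarrow> (\<exists>a\<in>circle. \<forall>b\<in>\<sigma>. 1 - 2 * r \<le> cw a b)"
    if \<sigma>: "\<sigma> \<subseteq> X" "\<sigma> \<noteq> {}" for \<sigma>
  proof
    assume "(\<Inter>x\<in>\<sigma>. closed_arc x r) \<noteq> {}"
    then obtain y where y: "\<forall>x\<in>\<sigma>. y \<in> closed_arc x r" by blast
    then have yc: "y \<in> circle" "\<And>b. b \<in> \<sigma> \<Longrightarrow> circle_dist b y \<le> r" using \<sigma>(2) by (auto simp: closed_arc_def)
    let ?a = "if y + r < 1 then y + r else y + r - 1"
    have "?a \<in> circle" using yc(1) r by (auto simp: circle_def)
    moreover have "1 - 2 * r \<le> cw ?a b" if "b \<in> \<sigma>" for b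
    proof -
      have "b \<in> circle" using that \<sigma>(1) X by blast
      from circle_dist_le_iff_cw[OF this yc(1) r] yc(2)[OF that] show ?thesis by blast
    qed
    ultimately show "\<exists>a\<in>circle. \<forall>b\<in>\<sigma>. 1 - 2 * r \<le> cw a b" by blast
  next
    assume "\<exists>a\<in>circle. \<forall>b\<in>\<sigma>. 1 - 2 * r \<le> cw a b"
    then obtain a where a: "a \<in> circle" "\<And>b. b \<in> \<sigma> \<Longrightarrow> 1 - 2 * r \<le> cw a b" by blast
    define y where "y = (if 0 \<le> a - r then a - r else a - r + 1)"
    have y: "y \<in> circle" "(if y + r < 1 then y + r else y + r - 1) = a"
      using a(1) r by (auto simp: y_def circle_def)
    have "y \<in> closed_arc b r" if "b \<in> \<sigma>" for b
    proof -
      have "b \<in> circle" using that \<sigma>(1) X by blast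
      from circle_dist_le_iff_cw[OF this y(1) r, unfolded y(2)] a(2)[OF that] y(1)
      show ?thesis by (simp add: closed_arc_def)
    qed
    then show "(\<Inter>x\<in>\<sigma>. closed_arc x r) \<noteq> {}" by blast
  qed
  then show ?thesis unfolding cech_def arc_cx_def by blast
qed

section \<open>Measurability\<close>

context vector_space
begin

lemma dim_image_inj:
  assumes V: "subspace V" "finite F" "V \<subseteq> span F"
    and f: "\<And>x y. f (x + y) = f x + f y" "\<And>c x. f (scale c x) = scale c (f x)"
    and inj: "\<And>x. x \<in> V \<Longrightarrow> f x = 0 \<Longrightarrow> x = 0"
  shows "dim (f ` V) = dim V"
proof -
  have "f 0 = 0" using f(1)[of 0 0] by simp
  then have "{x\<in>V. f x = 0} = {0}" using inj subspace_0[OF V(1)] by blast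
  moreover have "dim {0} = 0" using dim_span[of "{}"] dim_eq_card_independent[OF independent_empty] by simp
  ultimately show ?thesis using dim_kernel_image[OF V f] by simp
qed

end

text \<open>Transports chains along an order isomorphism \<open>\<phi>\<close> from \<open>A\<close> to \<open>\<phi> ` A\<close>.\<close>

definition transport :: "('a \<Rightarrow> 'a) \<Rightarrow> 'a set \<Rightarrow> ('a set \<Rightarrow> 'f :: field) \<Rightarrow> 'a set \<Rightarrow> 'f" where
  "transport \<phi> A c \<tau> = (if \<tau> \<subseteq> \<phi> ` A then c (A \<inter> \<phi> -` \<tau>) else 0)"

text \<open>Samples of the same combinatorial type give isomorphic complexes on different sets of
  reals. Monotonicity makes the isomorphism respect the orientation signs.\<close>

locale relabelling =
  fixes \<phi> :: "'a :: linorder \<Rightarrow> 'a" and A :: "'a set" and K :: "'a set set"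
  assumes mono: "strict_mono_on A \<phi>" and K: "simplicial A K"
begin

lemma inj: "inj_on \<phi> A"
  using mono by (rule strict_mono_on_imp_inj_on)

lemma preimage_image: "\<sigma> \<subseteq> A \<Longrightarrow> A \<inter> \<phi> -` (\<phi> ` \<sigma>) = \<sigma>"
  using inj by (auto dest: inj_onD)

lemma simplicial_image: "simplicial (\<phi> ` A) ((`) \<phi> ` K)"
proof -
  have A: "finite A" "K \<subseteq> Pow A" "\<And>\<sigma> \<tau>. \<sigma> \<in> K \<Longrightarrow> \<tau> \<subseteq> \<sigma> \<Longrightarrow> \<tau> \<in> K"
    using K unfolding simplicial_def by blast+
  have "\<tau> \<in> (`) \<phi> ` K" if \<sigma>: "\<sigma> \<in> K" "\<tau> \<subseteq> \<phi> ` \<sigma>" for \<sigma> \<tau>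
  proof -
    obtain \<rho> where "\<rho> \<subseteq> \<sigma>" "\<tau> = \<phi> ` \<rho>" using \<sigma>(2) by (auto simp: subset_image_iff)
    then show ?thesis using A(3)[OF \<sigma>(1)] by blast
  qed
  moreover have "(`) \<phi> ` K \<subseteq> Pow (\<phi> ` A)" using A(2) by blast
  ultimately show ?thesis unfolding simplicial_def using A(1) by blast
qed

lemma transport_image: "\<sigma> \<subseteq> A \<Longrightarrow> transport \<phi> A c (\<phi> ` \<sigma>) = c \<sigma>"
  by (simp add: transport_def preimage_image image_mono)

lemma transport_add: "transport \<phi> A (c + d) = transport \<phi> A c + transport \<phi> A d"
  by (auto simp: transport_def fun_eq_iff)

lemma transport_scale: "transport \<phi> A (fun_scale a c) = fun_scale a (transport \<phi> A c)"
  by (auto simp: transport_def fun_eq_iff fun_scale_def)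

lemma chains_support:
  assumes "c \<in> chains K p" "c \<sigma> \<noteq> 0" shows "\<sigma> \<subseteq> A"
  using assms K unfolding chains_def simplicial_def by blast

lemma transport_zero:
  assumes c: "c \<in> chains K p" and z: "transport \<phi> A c = 0"
  shows "c = 0"
proof (rule ext)
  fix \<sigma> show "c \<sigma> = 0 \<sigma>"
  proof (cases "\<sigma> \<subseteq> A")
    case True
    then show ?thesis using fun_cong[OF z, of "\<phi> ` \<sigma>"] by (simp add: transport_image)
  next
    case False
    then show ?thesis using chains_support[OF c, of \<sigma>] by auto
  qed
qed

lemma ins_sign_image:
  assumes "v \<in> A" "\<sigma> \<subseteq> A"
  shows "(ins_sign (\<phi> v) (\<phi> ` \<sigma>) :: 'f :: field) = ins_sign v \<sigma>"
proof -
  have less: "\<phi> u < \<phi> v \<longleftrightarrow> u < v" if "u \<in> \<sigma>" for u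
    using strict_mono_on_less[OF mono, of u v] that assms by blast
  have "{u\<in>\<phi> ` \<sigma>. u < \<phi> v} = \<phi> ` {u\<in>\<sigma>. u < v}" using less by blast
  moreover have "card (\<phi> ` {u\<in>\<sigma>. u < v}) = card {u\<in>\<sigma>. u < v}"
    by (rule card_image[OF inj_on_subset[OF inj]]) (use assms in blast)
  moreover have "finite (\<phi> ` \<sigma>) \<longleftrightarrow> finite \<sigma>"
    by (rule finite_image_iff[OF inj_on_subset[OF inj assms(2)]])
  ultimately show ?thesis by (simp add: ins_sign_def)
qed

lemma bd_transport:
  fixes c :: "'a set \<Rightarrow> 'f :: field"
  shows "bd (\<phi> ` A) (transport \<phi> A c) = transport \<phi> A (bd A c)"
proof (rule ext)
  fix \<tau>
  show "bd (\<phi> ` A) (transport \<phi> A c) \<tau> = transport \<phi> A (bd A c) \<tau>"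
  proof (cases "\<tau> \<subseteq> \<phi> ` A")
    case True
    then obtain \<sigma> where \<sigma>: "\<sigma> \<subseteq> A" "\<tau> = \<phi> ` \<sigma>" by (auto simp: subset_image_iff)
    have "bd (\<phi> ` A) (transport \<phi> A c) \<tau> = (\<Sum>v\<in>A. del_vertex (\<phi> v) (transport \<phi> A c) \<tau>)"
      unfolding bd_def by (rule sum.reindex[OF inj, unfolded o_def])
    also have "\<dots> = (\<Sum>v\<in>A. del_vertex v c \<sigma>)"
    proof (rule sum.cong)
      fix v assume v: "v \<in> A"
      have "\<phi> v \<in> \<tau> \<longleftrightarrow> v \<in> \<sigma>" unfolding \<sigma>(2) by (rule inj_on_image_mem_iff[OF inj v \<sigma>(1)])
      moreover have "transport \<phi> A c (insert (\<phi> v) \<tau>) = c (insert v \<sigma>)"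
        using transport_image[of "insert v \<sigma>" c] v \<sigma> by simp
      ultimately show "del_vertex (\<phi> v) (transport \<phi> A c) \<tau> = del_vertex v c \<sigma>"
        unfolding del_vertex_def using ins_sign_image[OF v \<sigma>(1), where 'f='f] \<sigma>(2) by simp
    qed simp
    also have "\<dots> = transport \<phi> A (bd A c) \<tau>" using transport_image[OF \<sigma>(1), of "bd A c"] \<sigma>(2) by (simp add: bd_def)
    finally show ?thesis .
  next
    case False
    then have "transport \<phi> A c (insert v \<tau>) = 0" for v by (simp add: transport_def)
    then show ?thesis using False by (simp add: bd_def del_vertex_def transport_def cong: if_cong)
  qed
qed

lemma chains_transport:
  "transport \<phi> A ` chains K p = (chains ((`) \<phi> ` K) p :: ('a set \<Rightarrow> 'f :: field) set)"
proof (intro equalityI subsetI)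
  have A: "K \<subseteq> Pow A" "finite A" using K unfolding simplicial_def by blast+
  fix d assume "d \<in> transport \<phi> A ` (chains K p :: ('a set \<Rightarrow> 'f) set)"
  then obtain c :: "'a set \<Rightarrow> 'f" where c: "c \<in> chains K p" "d = transport \<phi> A c" by blast
  show "d \<in> chains ((`) \<phi> ` K) p"
    unfolding chains_def mem_Collect_eq
  proof (intro allI impI)
    fix \<tau> assume "d \<tau> \<noteq> 0"
    then have \<tau>: "\<tau> \<subseteq> \<phi> ` A" "c (A \<inter> \<phi> -` \<tau>) \<noteq> 0" unfolding c(2) transport_def by presburger+
    then have "A \<inter> \<phi> -` \<tau> \<in> K" "card (A \<inter> \<phi> -` \<tau>) = p" using c(1) unfolding chains_def by blast+
    moreover have "\<tau> = \<phi> ` (A \<inter> \<phi> -` \<tau>)" using \<tau>(1) by blast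
    moreover have "card (\<phi> ` (A \<inter> \<phi> -` \<tau>)) = card (A \<inter> \<phi> -` \<tau>)"
      by (rule card_image[OF inj_on_subset[OF inj]]) blast
    moreover have "finite (A \<inter> \<phi> -` \<tau>)" using A(2) by simp
    ultimately show "\<tau> \<in> (`) \<phi> ` K \<and> finite \<tau> \<and> card \<tau> = p" by (metis finite_imageI imageI)
  qed
next
  have A: "K \<subseteq> Pow A" "finite A" using K unfolding simplicial_def by blast+
  fix d :: "'a set \<Rightarrow> 'f" assume d: "d \<in> chains ((`) \<phi> ` K) p"
  define c where "c \<sigma> = (if \<sigma> \<subseteq> A then d (\<phi> ` \<sigma>) else 0)" for \<sigma>
  have "c \<in> chains K p"
    unfolding chains_def mem_Collect_eq
  proof (intro allI impI)
    fix \<sigma> assume "c \<sigma> \<noteq> 0"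
    then have \<sigma>: "\<sigma> \<subseteq> A" "d (\<phi> ` \<sigma>) \<noteq> 0" unfolding c_def by presburger+
    then have "\<phi> ` \<sigma> \<in> (`) \<phi> ` K" "card (\<phi> ` \<sigma>) = p" using d unfolding chains_def by blast+
    then obtain \<rho> where \<rho>: "\<rho> \<in> K" "\<phi> ` \<sigma> = \<phi> ` \<rho>" by blast
    then have "\<sigma> = \<rho>" using preimage_image[OF \<sigma>(1)] preimage_image[of \<rho>] A(1) by auto
    moreover have "card (\<phi> ` \<sigma>) = card \<sigma>" by (rule card_image[OF inj_on_subset[OF inj \<sigma>(1)]])
    ultimately show "\<sigma> \<in> K \<and> finite \<sigma> \<and> card \<sigma> = p"
      using \<rho>(1) \<open>card (\<phi> ` \<sigma>) = p\<close> finite_subset[OF \<sigma>(1) A(2)] by simp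
  qed
  moreover have "d = transport \<phi> A c"
  proof (rule ext)
    fix \<tau> show "d \<tau> = transport \<phi> A c \<tau>"
    proof (cases "\<tau> \<subseteq> \<phi> ` A")
      case True
      then have "\<phi> ` (A \<inter> \<phi> -` \<tau>) = \<tau>" by blast
      then show ?thesis using True by (simp add: transport_def c_def)
    next
      case False
      have "\<tau> \<in> (`) \<phi> ` K" if "d \<tau> \<noteq> 0" using d that unfolding chains_def by blast
      then have "d \<tau> = 0" using False A(1) by blast
      then show ?thesis using False by (simp add: transport_def)
    qed
  qed
  ultimately show "d \<in> transport \<phi> A ` chains K p" by blast
qed

lemma reduced_betti_image:
  "reduced_betti TYPE('f :: field) (\<phi> ` A) ((`) \<phi> ` K) (Suc q) = reduced_betti TYPE('f) A K (Suc q)"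
proof -
  let ?T = "transport \<phi> A :: ('a set \<Rightarrow> 'f) \<Rightarrow> _"
  have T0: "?T 0 = 0" by (simp add: transport_def fun_eq_iff)
  have cyc: "cyc (\<phi> ` A) ((`) \<phi> ` K) (Suc q) = ?T ` cyc A K (Suc q)"
  proof (intro equalityI subsetI)
    fix d :: "'a set \<Rightarrow> 'f" assume "d \<in> cyc (\<phi> ` A) ((`) \<phi> ` K) (Suc q)"
    then obtain c :: "'a set \<Rightarrow> 'f" where c: "c \<in> chains K (Suc q)" "d = ?T c" "bd (\<phi> ` A) (?T c) = 0"
      unfolding cyc_def chains_transport[symmetric] by blast
    have "?T (bd A c) = 0" using c(3) by (simp only: bd_transport)
    then have "bd A c = 0" using transport_zero[OF bd_chains[OF K c(1)]] by blast
    then show "d \<in> ?T ` cyc A K (Suc q)" using c(1,2) unfolding cyc_def by blast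
  next
    fix d :: "'a set \<Rightarrow> 'f" assume "d \<in> ?T ` cyc A K (Suc q)"
    then obtain c :: "'a set \<Rightarrow> 'f" where c: "c \<in> chains K (Suc q)" "bd A c = 0" "d = ?T c" unfolding cyc_def by blast
    have "?T c \<in> chains ((`) \<phi> ` K) (Suc q)" unfolding chains_transport[symmetric] using c(1) by (rule imageI)
    moreover have "bd (\<phi> ` A) (?T c) = 0" unfolding bd_transport c(2) by (rule T0)
    ultimately show "d \<in> cyc (\<phi> ` A) ((`) \<phi> ` K) (Suc q)" unfolding cyc_def c(3) by blast
  qed
  have bdy: "bdy (\<phi> ` A) ((`) \<phi> ` K) (Suc q) = ?T ` bdy A K (Suc q)"
    unfolding bdy_def chains_transport[symmetric] image_image bd_transport ..
  have z: "x = 0" if "x \<in> cyc A K (Suc q)" "?T x = 0" for x :: "'a set \<Rightarrow> 'f"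
    using transport_zero[OF _ that(2)] that(1) unfolding cyc_def by blast
  have "fun_space.dim (?T ` cyc A K (Suc q)) = fun_space.dim (cyc A K (Suc q) :: ('a set \<Rightarrow> 'f) set)"
    by (rule fun_space.dim_image_inj[OF cyc_subspace finite_units[OF K] cyc_span[OF K] transport_add transport_scale z])
  moreover have "fun_space.dim (?T ` bdy A K (Suc q)) = fun_space.dim (bdy A K (Suc q) :: ('a set \<Rightarrow> 'f) set)"
    by (rule fun_space.dim_image_inj[OF bdy_subspace finite_units[OF K]
          subset_trans[OF bdy_subset_cyc[OF K] cyc_span[OF K]] transport_add transport_scale z])
      (use bdy_subset_cyc[OF K] in blast)
  ultimately show ?thesis unfolding reduced_betti_def cyc bdy by simp
qed

end


text \<open>Every preimage is a finite union of atoms of the algebra generated by the events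
  \<open>P i\<close>.\<close>

lemma measurable_finite_pattern:
  assumes T: "finite T" and P: "\<And>i. i \<in> T \<Longrightarrow> Measurable.pred M (P i)"
    and F: "\<And>x y. x \<in> space M \<Longrightarrow> y \<in> space M \<Longrightarrow> (\<And>i. i \<in> T \<Longrightarrow> P i x = P i y) \<Longrightarrow> F x = F y"
  shows "(F :: 'a \<Rightarrow> real) \<in> borel_measurable M"
proof (rule borel_measurableI)
  fix S :: "real set"
  define pat where "pat x = {i\<in>T. P i x}" for x
  define C where "C = {c\<in>Pow T. \<exists>x\<in>space M. F x \<in> S \<and> pat x = c}"
  have "F -` S \<inter> space M = (\<Union>c\<in>C. {x\<in>space M. \<forall>i\<in>T. P i x \<longleftrightarrow> i \<in> c})"
  proof (intro equalityI subsetI)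
    fix x assume "x \<in> F -` S \<inter> space M"
    then show "x \<in> (\<Union>c\<in>C. {x\<in>space M. \<forall>i\<in>T. P i x \<longleftrightarrow> i \<in> c})"
      unfolding C_def pat_def by blast
  next
    fix x assume "x \<in> (\<Union>c\<in>C. {x\<in>space M. \<forall>i\<in>T. P i x \<longleftrightarrow> i \<in> c})"
    then obtain c where c: "c \<in> C" "x \<in> space M" "\<forall>i\<in>T. P i x \<longleftrightarrow> i \<in> c" by blast
    then obtain y where y: "y \<in> space M" "F y \<in> S" "pat y = c" unfolding C_def by blast
    have "F x = F y" using c y by (intro F) (auto simp: pat_def)
    then show "x \<in> F -` S \<inter> space M" using c(2) y(2) by simp
  qed
  also have "\<dots> \<in> sets M"
  proof (rule sets.finite_UN)
    show "finite C" using T by (simp add: C_def)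
    show "{x\<in>space M. \<forall>i\<in>T. P i x \<longleftrightarrow> i \<in> c} \<in> sets M" for c
    proof (rule sets.sets_Collect_finite_All[OF _ T])
      fix i assume "i \<in> T"
      then have "{x\<in>space M. P i x} \<in> sets M" using P by (simp add: pred_def)
      then show "{x\<in>space M. P i x \<longleftrightarrow> i \<in> c} \<in> sets M"
        using sets.sets_Collect_neg by (cases "i \<in> c") auto
    qed
  qed
  finally show "F -` S \<inter> space M \<in> sets M" .
qed

text \<open>
  The intersection of the arcs is closed in \<open>[0, 1)\<close>, so its least point is \<open>0\<close> or a left end point
  of an arc. This also covers centres outside of \<open>[0, 1)\<close>.
\<close>

lemma common_point_iff:
  assumes J: "finite J"
  shows "(\<Inter>j\<in>J. closed_arc (x j) r) \<noteq> {} \<longleftrightarrow>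
    (\<exists>c\<in>insert 0 ((\<lambda>j. x j - r) ` J \<union> (\<lambda>j. x j + 1 - r) ` J). 0 \<le> c \<and> c < 1 \<and> (\<forall>j\<in>J. circle_dist (x j) c \<le> r))"
    (is "_ \<longleftrightarrow> (\<exists>c\<in>?C. ?ok c)")
proof
  assume "(\<Inter>j\<in>J. closed_arc (x j) r) \<noteq> {}"
  then obtain y' where y': "\<forall>j\<in>J. y' \<in> closed_arc (x j) r" by blast
  obtain y where y: "0 \<le> y" "y < 1" "\<And>j. j \<in> J \<Longrightarrow> circle_dist (x j) y \<le> r"
  proof (cases "J = {}")
    case True
    then show ?thesis using that[of 0] by simp
  next
    case False
    then have "y' \<in> circle" "\<And>j. j \<in> J \<Longrightarrow> circle_dist (x j) y' \<le> r" using y' by (auto simp: closed_arc_def)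
    then show ?thesis using that[of y'] by (auto simp: circle_def)
  qed
  let ?D = "{c\<in>?C. c \<le> y}"
  define c where "c = Max ?D"
  have D: "finite ?D" "?D \<noteq> {}" using J y(1) by auto
  have c: "c \<in> ?C" "c \<le> y" using Max_in[OF D] by (auto simp: c_def)
  have cmax: "d \<le> c" if "d \<in> ?C" "d \<le> y" for d using Max_ge[OF D(1)] that by (simp add: c_def)
  have "circle_dist (x j) c \<le> r" if j: "j \<in> J" for j
  proof -
    have "x j - r \<le> y \<Longrightarrow> x j - r \<le> c" "x j + 1 - r \<le> y \<Longrightarrow> x j + 1 - r \<le> c"
      using cmax j by auto
    then show ?thesis using y(3)[OF j] c(2) by (auto simp: circle_dist_def min_def abs_if split: if_splits)
  qed
  moreover have "0 \<le> c" using cmax[of 0] y(1) by simp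
  ultimately show "\<exists>c\<in>?C. ?ok c" using c y(2) by (intro bexI[of _ c]) auto
next
  assume "\<exists>c\<in>?C. ?ok c"
  then obtain c where "0 \<le> c" "c < 1" "\<forall>j\<in>J. circle_dist (x j) c \<le> r" by blast
  then have "c \<in> (\<Inter>j\<in>J. closed_arc (x j) r)" by (auto simp: closed_arc_def circle_def)
  then show "(\<Inter>j\<in>J. closed_arc (x j) r) \<noteq> {}" by blast
qed

section \<open>Measurable invariants of the random Cech complex\<close>

lemma sets_uniform_circle: "sets (uniform_measure lborel circle) = sets borel"
  by simp

lemma coordinate_measurable [measurable]: "(\<lambda>\<omega>. \<omega> i) \<in> borel_measurable (circle_sample n)"
proof (cases "i < n")
  case True
  then have "(\<lambda>\<omega>. \<omega> i) \<in> measurable (circle_sample n) (uniform_measure lborel circle)"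
    unfolding circle_sample_def by (intro measurable_component_singleton) simp
  then show ?thesis by (simp add: measurable_cong_sets[OF refl sets_uniform_circle])
next
  case False
  \<comment> \<open>Elements of the product space are \<open>undefined\<close> outside the index
    set.\<close>
  have "(\<lambda>\<omega>. undefined) \<in> borel_measurable (circle_sample n)" by simp
  moreover have "\<omega> i = undefined" if "\<omega> \<in> space (circle_sample n)" for \<omega>
    using that False by (auto simp: circle_sample_def space_PiM PiE_def extensional_def)
  ultimately show ?thesis by (subst measurable_cong[where g = "\<lambda>\<omega>. undefined"]) simp_all
qed

lemma common_point_measurable:
  assumes J: "finite J"
  shows "Measurable.pred (circle_sample n) (\<lambda>\<omega>. (\<Inter>x\<in>\<omega> ` J. closed_arc x r) \<noteq> {})"
proof -
  have *: "(\<Inter>x\<in>\<omega> ` J. closed_arc x r) \<noteq> {} \<longleftrightarrow>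
    (\<forall>j\<in>J. circle_dist (\<omega> j) 0 \<le> r) \<or>
    (\<exists>i\<in>J. 0 \<le> \<omega> i - r \<and> \<omega> i - r < 1 \<and> (\<forall>j\<in>J. circle_dist (\<omega> j) (\<omega> i - r) \<le> r)) \<or>
    (\<exists>i\<in>J. 0 \<le> \<omega> i + 1 - r \<and> \<omega> i + 1 - r < 1 \<and> (\<forall>j\<in>J. circle_dist (\<omega> j) (\<omega> i + 1 - r) \<le> r))"
    for \<omega> :: "nat \<Rightarrow> real"
  proof -
    have "(\<Inter>x\<in>\<omega> ` J. closed_arc x r) = (\<Inter>j\<in>J. closed_arc (\<omega> j) r)" by simp
    then show ?thesis using common_point_iff[OF J, of \<omega> r] by (simp add: bex_Un)
  qed
  show ?thesis
    unfolding * circle_dist_def using J by measurable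
qed

text \<open>\<phi> maps each point of the first sample to the point of the second with the same
  index. This is well defined for samples with repeated points, because ties are determined by the
  strict order.\<close>

lemma cech_image_pattern:
  fixes \<omega> \<omega>' :: "nat \<Rightarrow> real"
  assumes pat: "\<And>J. J \<subseteq> I \<Longrightarrow> (\<Inter>x\<in>\<omega> ` J. closed_arc x r) \<noteq> {} \<longleftrightarrow> (\<Inter>x\<in>\<omega>' ` J. closed_arc x r) \<noteq> {}"
    and ord: "\<And>i j. i \<in> I \<Longrightarrow> j \<in> I \<Longrightarrow> \<omega> i < \<omega> j \<longleftrightarrow> \<omega>' i < \<omega>' j"
  obtains \<phi> where "strict_mono_on (\<omega> ` I) \<phi>" "\<phi> ` \<omega> ` I = \<omega>' ` I" "cech (\<omega>' ` I) r = (`) \<phi> ` cech (\<omega> ` I) r"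
proof -
  have eq: "\<omega> i = \<omega> j \<longleftrightarrow> \<omega>' i = \<omega>' j" if "i \<in> I" "j \<in> I" for i j
  proof -
    have *: "x = y \<longleftrightarrow> \<not> x < y \<and> \<not> y < x" for x y :: real by auto
    show ?thesis
      unfolding *[of "\<omega> i" "\<omega> j"] *[of "\<omega>' i" "\<omega>' j"] ord[OF that] ord[OF that(2,1)] ..
  qed
  define \<phi> where "\<phi> x = \<omega>' (SOME i. i \<in> I \<and> \<omega> i = x)" for x
  have \<phi>: "\<phi> (\<omega> i) = \<omega>' i" if "i \<in> I" for i
  proof -
    have "(SOME j. j \<in> I \<and> \<omega> j = \<omega> i) \<in> I \<and> \<omega> (SOME j. j \<in> I \<and> \<omega> j = \<omega> i) = \<omega> i"
      by (rule someI[of _ i]) (use that in simp)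
    then show ?thesis unfolding \<phi>_def using eq that by blast
  qed
  have img: "\<phi> ` \<omega> ` J = \<omega>' ` J" if "J \<subseteq> I" for J
    using \<phi> that by (force simp: image_image)
  have cech: "cech (\<omega>'' ` I) r = (\<lambda>J. \<omega>'' ` J) ` {J. J \<subseteq> I \<and> J \<noteq> {} \<and> (\<Inter>x\<in>\<omega>'' ` J. closed_arc x r) \<noteq> {}}"
    for \<omega>'' :: "nat \<Rightarrow> real"
  proof (intro equalityI subsetI)
    fix \<sigma> assume "\<sigma> \<in> cech (\<omega>'' ` I) r"
    then have \<sigma>: "\<sigma> \<subseteq> \<omega>'' ` I" "\<sigma> \<noteq> {}" "(\<Inter>x\<in>\<sigma>. closed_arc x r) \<noteq> {}" unfolding cech_def by blast+
    from \<sigma>(1) obtain J where J: "J \<subseteq> I" "\<sigma> = \<omega>'' ` J" by (rule subset_imageE)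
    have "J \<in> {J. J \<subseteq> I \<and> J \<noteq> {} \<and> (\<Inter>x\<in>\<omega>'' ` J. closed_arc x r) \<noteq> {}}"
      using \<sigma>(2,3) J by (intro CollectI conjI) auto
    with J(2) show "\<sigma> \<in> (\<lambda>J. \<omega>'' ` J) ` {J. J \<subseteq> I \<and> J \<noteq> {} \<and> (\<Inter>x\<in>\<omega>'' ` J. closed_arc x r) \<noteq> {}}"
      by (rule image_eqI)
  next
    fix \<sigma> assume "\<sigma> \<in> (\<lambda>J. \<omega>'' ` J) ` {J. J \<subseteq> I \<and> J \<noteq> {} \<and> (\<Inter>x\<in>\<omega>'' ` J. closed_arc x r) \<noteq> {}}"
    then obtain J where J: "J \<subseteq> I" "J \<noteq> {}" "(\<Inter>x\<in>\<omega>'' ` J. closed_arc x r) \<noteq> {}" "\<sigma> = \<omega>'' ` J" by blast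
    show "\<sigma> \<in> cech (\<omega>'' ` I) r"
      unfolding cech_def J(4) using J(2,3) image_mono[OF J(1), of \<omega>''] by (intro CollectI conjI) simp_all
  qed
  show ?thesis
  proof (rule that)
    show "strict_mono_on (\<omega> ` I) \<phi>"
      using ord \<phi> by (auto simp: strict_mono_on_def)
    show "\<phi> ` \<omega> ` I = \<omega>' ` I" by (rule img) simp
    have "{J. J \<subseteq> I \<and> J \<noteq> {} \<and> (\<Inter>x\<in>\<omega>' ` J. closed_arc x r) \<noteq> {}}
      = {J. J \<subseteq> I \<and> J \<noteq> {} \<and> (\<Inter>x\<in>\<omega> ` J. closed_arc x r) \<noteq> {}}" using pat by blast
    then have "cech (\<omega>' ` I) r = (\<lambda>J. \<omega>' ` J) ` {J. J \<subseteq> I \<and> J \<noteq> {} \<and> (\<Inter>x\<in>\<omega> ` J. closed_arc x r) \<noteq> {}}"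
      by (simp only: cech)
    also have "\<dots> = (`) \<phi> ` (\<lambda>J. \<omega> ` J) ` {J. J \<subseteq> I \<and> J \<noteq> {} \<and> (\<Inter>x\<in>\<omega> ` J. closed_arc x r) \<noteq> {}}"
      unfolding image_image[of "(`) \<phi>"] by (rule image_cong) (use img in auto)
    finally show "cech (\<omega>' ` I) r = (`) \<phi> ` cech (\<omega> ` I) r" by (simp only: cech)
  qed
qed

lemma simplicial_cech: "finite X \<Longrightarrow> simplicial X (insert {} (cech X r))"
  unfolding simplicial_def
proof (intro conjI ballI allI impI)
  show "insert {} (cech X r) \<subseteq> Pow X" unfolding cech_def by blast
  fix \<sigma> \<tau> assume \<sigma>: "\<sigma> \<in> insert {} (cech X r)" "\<tau> \<subseteq> \<sigma>"
  show "\<tau> \<in> insert {} (cech X r)"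
  proof (cases "\<tau> = {}")
    case False
    then have "\<sigma> \<in> cech X r" using \<sigma> by blast
    then have "\<sigma> \<subseteq> X" "(\<Inter>x\<in>\<sigma>. closed_arc x r) \<noteq> {}" unfolding cech_def by blast+
    moreover have "(\<Inter>x\<in>\<sigma>. closed_arc x r) \<subseteq> (\<Inter>x\<in>\<tau>. closed_arc x r)" using \<sigma>(2) by blast
    ultimately have "\<tau> \<in> cech X r" unfolding cech_def using \<sigma>(2) False by blast
    then show ?thesis by blast
  qed simp
qed

text \<open>Agreement almost everywhere with a measurable function would not suffice, as
  \<open>circle_sample n\<close> is not a completed measure. The events tested are which index sets
  have intersecting arcs and how the coordinates are ordered.\<close>

lemma measurable_cech_invariant:
  fixes F :: "real set set \<Rightarrow> real"
  assumes F: "\<And>\<phi> X K. relabelling \<phi> X (insert {} K) \<Longrightarrow> {} \<notin> K \<Longrightarrow> F ((`) \<phi> ` K) = F K"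
  shows "(\<lambda>\<omega>. F (cech (\<omega> ` {..<n}) r)) \<in> borel_measurable (circle_sample n)"
proof (rule measurable_finite_pattern[where T = "Inl ` Pow {..<n} \<union> Inr ` ({..<n} \<times> {..<n})"
      and P = "case_sum (\<lambda>J (\<omega> :: nat \<Rightarrow> real). (\<Inter>x\<in>\<omega> ` J. closed_arc x r) \<noteq> {}) (\<lambda>(i, j) \<omega>. \<omega> i < \<omega> j)"])
  let ?P = "case_sum (\<lambda>J (\<omega> :: nat \<Rightarrow> real). (\<Inter>x\<in>\<omega> ` J. closed_arc x r) \<noteq> {}) (\<lambda>(i, j) \<omega>. \<omega> i < \<omega> j)"
  let ?T = "Inl ` Pow {..<n} \<union> Inr ` ({..<n} \<times> {..<n})"
  show "finite ?T" by simp
  show "Measurable.pred (circle_sample n) (?P i)" if "i \<in> ?T" for i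
    using that
  proof (elim UnE imageE)
    fix J assume "i = Inl J" "J \<in> Pow {..<n}"
    then show ?thesis using common_point_measurable[of J] finite_subset[of J "{..<n}"] by simp
  next
    fix q assume "i = Inr q"
    moreover obtain a b where "q = (a, b)" by (cases q)
    moreover have "Measurable.pred (circle_sample n) (\<lambda>\<omega>. \<omega> a < \<omega> b)" by measurable
    ultimately show ?thesis by simp
  qed
  fix \<omega> \<omega>' :: "nat \<Rightarrow> real"
  assume eq: "\<And>i. i \<in> ?T \<Longrightarrow> ?P i \<omega> = ?P i \<omega>'"
  have pat: "(\<Inter>x\<in>\<omega> ` J. closed_arc x r) \<noteq> {} \<longleftrightarrow> (\<Inter>x\<in>\<omega>' ` J. closed_arc x r) \<noteq> {}" if "J \<subseteq> {..<n}" for J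
    using eq[of "Inl J"] that by simp
  have ord: "\<omega> i < \<omega> j \<longleftrightarrow> \<omega>' i < \<omega>' j" if "i \<in> {..<n}" "j \<in> {..<n}" for i j
    using eq[of "Inr (i, j)"] that by simp
  obtain \<phi> where \<phi>: "strict_mono_on (\<omega> ` {..<n}) \<phi>" "cech (\<omega>' ` {..<n}) r = (`) \<phi> ` cech (\<omega> ` {..<n}) r"
    by (rule cech_image_pattern[where I = "{..<n}" and \<omega> = \<omega> and \<omega>' = \<omega>' and r = r]) (simp_all only: pat ord)
  have "relabelling \<phi> (\<omega> ` {..<n}) (insert {} (cech (\<omega> ` {..<n}) r))"
    using \<phi>(1) by (intro relabelling.intro simplicial_cech) auto
  moreover have "{} \<notin> cech (\<omega> ` {..<n}) r" by (simp add: cech_def)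
  ultimately show "F (cech (\<omega> ` {..<n}) r) = F (cech (\<omega>' ` {..<n}) r)"
    unfolding \<phi>(2) by (rule F[symmetric])
qed

lemma measurable_betti_cech:
  assumes "k \<ge> 1"
  shows "(\<lambda>\<omega>. real (betti TYPE('f :: field) (cech (\<omega> ` {..<n}) r) k)) \<in> borel_measurable (circle_sample n)"
proof (rule measurable_cech_invariant[of "\<lambda>K. real (betti TYPE('f) K k)"])
  fix \<phi> :: "real \<Rightarrow> real" and X K assume R: "relabelling \<phi> X (insert {} K)" and K0: "{} \<notin> K"
  interpret relabelling \<phi> X "insert {} K" by (rule R)
  have "betti TYPE('f) K k = reduced_betti TYPE('f) X (insert {} K) (Suc k)"
  proof -
    have "insert {} K - {{}} = K" using K0 by blast
    then show ?thesis using betti_eq_reduced[OF relabelling.K[OF R] assms, where 'f='f] by (simp only:)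
  qed
  moreover have "betti TYPE('f) ((`) \<phi> ` K) k = reduced_betti TYPE('f) (\<phi> ` X) ((`) \<phi> ` insert {} K) (Suc k)"
  proof -
    have "(`) \<phi> ` insert {} K - {{}} = (`) \<phi> ` K" using K0 by auto
    then show ?thesis using betti_eq_reduced[OF simplicial_image assms, where 'f='f] by (simp only:)
  qed
  ultimately show "real (betti TYPE('f) ((`) \<phi> ` K) k) = real (betti TYPE('f) K k)"
    using reduced_betti_image[of k, where 'f='f] by (simp only:)
qed

lemma measurable_euler_cech:
  "(\<lambda>\<omega>. real_of_int (euler_char (cech (\<omega> ` {..<n}) r))) \<in> borel_measurable (circle_sample n)"
proof (rule measurable_cech_invariant[of "\<lambda>K. real_of_int (euler_char K)"])
  fix \<phi> :: "real \<Rightarrow> real" and X K assume R: "relabelling \<phi> X (insert {} K)" and K0: "{} \<notin> K"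
  interpret relabelling \<phi> X "insert {} K" by (rule R)
  have KX: "\<sigma> \<subseteq> X" if "\<sigma> \<in> K" for \<sigma> using relabelling.K[OF R] that unfolding simplicial_def by blast
  have "inj_on ((`) \<phi>) K" using KX inj_on_image_eq_iff[OF inj] by (intro inj_onI) blast
  moreover have "card (\<phi> ` \<sigma>) = card \<sigma>" if "\<sigma> \<in> K" for \<sigma>
    by (rule card_image[OF inj_on_subset[OF inj KX[OF that]]])
  ultimately show "real_of_int (euler_char ((`) \<phi> ` K)) = real_of_int (euler_char K)"
    unfolding euler_char_def by (simp add: sum.reindex)
qed

section \<open>Volumes of separated configurations\<close>

text \<open>Its space is the whole real line; only almost all points lie in \<open>circle\<close>,
  whence the statements almost everywhere below.\<close>

abbreviation unif :: "real measure" where "unif \<equiv> uniform_measure lborel circle"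

lemma circle_borel [measurable]: "circle \<in> sets borel"
  by (simp add: circle_def)

lemma emeasure_circle: "emeasure lborel circle = 1"
  by (simp add: circle_def)

lemma prob_space_unif: "prob_space unif"
  by (rule prob_space_uniform_measure) (simp_all add: emeasure_circle)

lemma nn_integral_unif:
  assumes [measurable]: "f \<in> borel_measurable borel"
  shows "(\<integral>\<^sup>+x. f x \<partial>unif) = (\<integral>\<^sup>+x. f x * indicator {0..1} x \<partial>lborel)"
proof -
  have "(\<integral>\<^sup>+x. f x \<partial>unif) = (\<integral>\<^sup>+x. f x * indicator circle x \<partial>lborel)"
    by (subst nn_integral_uniform_measure) (simp_all add: emeasure_circle divide_ennreal_def)
  also have "\<dots> = (\<integral>\<^sup>+x. f x * indicator {0..1} x \<partial>lborel)"
  proof (rule nn_integral_cong_AE)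
    have "AE x in lborel. x \<noteq> (1::real)" by (rule AE_lborel_singleton)
    then show "AE x in lborel. f x * indicator circle x = f x * indicator {0..1} x"
      by eventually_elim (auto simp: circle_def indicator_def)
  qed
  finally show ?thesis .
qed

lemma AE_unif_circle: "AE x in unif. x \<in> circle"
  by (rule AE_uniform_measureI) simp_all

global_interpretation unif: product_prob_space "\<lambda>_ :: nat. unif" UNIV
  by (intro product_prob_spaceI prob_space_unif)

text \<open>Truncation at 0 keeps the formula valid for an empty range of integration, so later
  integrals need no case distinction on the size of \<open>s\<close>.\<close>

lemma nn_integral_power:
  fixes a c :: real
  shows "(\<integral>\<^sup>+y. ennreal (max 0 (c - y) ^ k) * indicator {a..c} y \<partial>lborel) = ennreal (max 0 (c - a) ^ Suc k / Suc k)"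
proof (cases "a \<le> c")
  case True
  let ?F = "\<lambda>y. - ((c - y) ^ Suc k / Suc k)"
  have "(\<integral>\<^sup>+y. ennreal (max 0 (c - y) ^ k) * indicator {a..c} y \<partial>lborel)
    = (\<integral>\<^sup>+y. ennreal ((c - y) ^ k) * indicator {a..c} y \<partial>lborel)"
    by (intro nn_integral_cong) (auto simp: indicator_def)
  also have "\<dots> = ennreal (?F c - ?F a)"
  proof (rule nn_integral_FTC_Icc)
    show "(\<lambda>y. (c - y) ^ k) \<in> borel_measurable borel" by measurable
    fix y assume "y \<in> {a..c}"
    have "((\<lambda>y. (c - y) ^ Suc k) has_real_derivative - (real (Suc k) * (c - y) ^ k)) (at y)"
      by (rule derivative_eq_intros refl | simp)+
    from DERIV_minus[OF DERIV_cdivide[OF this, of "real (Suc k)"]]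
    show "(?F has_real_derivative (c - y) ^ k) (at y)" by simp
    show "0 \<le> (c - y) ^ k" using \<open>y \<in> {a..c}\<close> by simp
  qed (rule True)
  also have "?F c - ?F a = max 0 (c - a) ^ Suc k / Suc k" using True by simp
  finally show ?thesis .
next
  case False
  then have "(\<integral>\<^sup>+y. ennreal (max 0 (c - y) ^ k) * indicator {a..c} y \<partial>lborel) = 0" by simp
  then show ?thesis using False by (simp add: max_def)
qed

definition line_sep :: "real \<Rightarrow> nat set \<Rightarrow> real \<Rightarrow> real \<Rightarrow> (nat \<Rightarrow> real) \<Rightarrow> bool" where
  "line_sep s J a b x \<longleftrightarrow> (\<forall>j\<in>J. a \<le> x j \<and> x j \<le> b) \<and> (\<forall>i\<in>J. \<forall>j\<in>J. i \<noteq> j \<longrightarrow> s \<le> \<bar>x i - x j\<bar>)"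

lemma line_sepD:
  assumes "line_sep s J a b x"
  shows "\<And>j. j \<in> J \<Longrightarrow> a \<le> x j" "\<And>j. j \<in> J \<Longrightarrow> x j \<le> b" "\<And>i j. i \<in> J \<Longrightarrow> j \<in> J \<Longrightarrow> i \<noteq> j \<Longrightarrow> s \<le> \<bar>x i - x j\<bar>"
  using assms unfolding line_sep_def by blast+

lemma pred_finite_ball:
  "finite I \<Longrightarrow> (\<And>i. i \<in> I \<Longrightarrow> Measurable.pred M (P i)) \<Longrightarrow> Measurable.pred M (\<lambda>x. \<forall>i\<in>I. P i x)"
  unfolding pred_def by (rule sets.sets_Collect_finite_All)

lemma pred_finite_bex:
  "finite I \<Longrightarrow> (\<And>i. i \<in> I \<Longrightarrow> Measurable.pred M (P i)) \<Longrightarrow> Measurable.pred M (\<lambda>x. \<exists>i\<in>I. P i x)"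
  unfolding pred_def by (rule sets.sets_Collect_finite_Ex)

lemma measurable_line_sep:
  assumes J: "finite J" and a: "a \<in> borel_measurable M" "b \<in> borel_measurable M"
    and x: "\<And>j. j \<in> J \<Longrightarrow> (\<lambda>z. x z j) \<in> borel_measurable M"
  shows "Measurable.pred M (\<lambda>z. line_sep s J (a z) (b z) (x z))"
proof -
  have p1: "Measurable.pred M (\<lambda>z. a z \<le> x z j \<and> x z j \<le> b z)" if "j \<in> J" for j
    using a x[OF that] by measurable
  have p2: "Measurable.pred M (\<lambda>z. i \<noteq> j \<longrightarrow> s \<le> \<bar>x z i - x z j\<bar>)" if "i \<in> J" "j \<in> J" for i j
    using x[OF that(1)] x[OF that(2)] by measurable
  show ?thesis
    unfolding line_sep_def
    by (rule pred_intros_logic(3)[OF pred_finite_ball[OF J p1] pred_finite_ball[OF J pred_finite_ball[OF J p2]]])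
qed

lemma component_measurable: "j \<in> J \<Longrightarrow> (\<lambda>x. x j) \<in> borel_measurable (Pi\<^sub>M J (\<lambda>_. unif))"
  using measurable_component_singleton[of j J "\<lambda>_. unif"] by (simp add: measurable_cong_sets[OF refl sets_uniform_circle])

lemma sum_ennreal_average:
  assumes "card J = Suc m" "0 \<le> v"
  shows "(\<Sum>i\<in>J. ennreal (v / Suc m)) = ennreal v"
proof -
  have "(\<Sum>i\<in>J. ennreal (v / Suc m)) = ennreal (\<Sum>i\<in>J. v / Suc m)"
    using assms(2) by (intro sum_ennreal) simp
  then show ?thesis using assms(1) by (simp del: of_nat_Suc)
qed

text \<open>Split by the index of the smallest coordinate.\<close>

lemma line_sep_split:
  assumes J: "finite J" "J \<noteq> {}" and s: "0 < s"
  shows "indicator {x. line_sep s J a b x} x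
    = (\<Sum>i\<in>J. indicator {a..b} (x i) * indicator {x. line_sep s (J - {i}) (x i + s) b x} x :: ennreal)"
proof (cases "line_sep s J a b x")
  case True
  note D = line_sepD[OF True]
  obtain i where i: "i \<in> J" "\<And>j. j \<in> J \<Longrightarrow> x i \<le> x j"
    using arg_min_if_finite(1)[OF J, of x] arg_min_least[OF J, of _ x] by blast
  have ge: "x i + s \<le> x j" if "j \<in> J" "j \<noteq> i" for j
    using D(3)[OF that(1) i(1) that(2)] i(2)[OF that(1)] by simp
  have "line_sep s (J - {i}) (x i + s) b x" unfolding line_sep_def using ge D by auto
  then have one: "indicator {a..b} (x i) * indicator {x. line_sep s (J - {i}) (x i + s) b x} x = (1 :: ennreal)"
    using D(1,2)[OF i(1)] by simp
  have zero: "indicator {a..b} (x j) * indicator {x. line_sep s (J - {j}) (x j + s) b x} x = (0 :: ennreal)"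
    if j: "j \<in> J - {i}" for j
  proof -
    have "\<not> line_sep s (J - {j}) (x j + s) b x"
    proof
      assume "line_sep s (J - {j}) (x j + s) b x"
      from line_sepD(1)[OF this, of i] i(1) j have "x j + s \<le> x i" by auto
      then show False using i(2)[of j] j s by auto
    qed
    then show ?thesis by simp
  qed
  have "(\<Sum>j\<in>J. indicator {a..b} (x j) * indicator {x. line_sep s (J - {j}) (x j + s) b x} x :: ennreal)
    = 1 + (\<Sum>j\<in>J-{i}. 0)"
    unfolding sum.remove[OF J(1) i(1)] one using zero by (intro arg_cong2[where f = "(+)"] sum.cong) auto
  then show ?thesis using True by simp
next
  case False
  have "indicator {a..b} (x i) * indicator {x. line_sep s (J - {i}) (x i + s) b x} x = (0 :: ennreal)"
    if i: "i \<in> J" for i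
  proof (rule ccontr)
    assume "\<not> ?thesis"
    then have *: "a \<le> x i" "x i \<le> b" "line_sep s (J - {i}) (x i + s) b x"
      by (auto simp: indicator_def split: if_splits)
    note D = line_sepD[OF *(3)]
    have ge: "x i + s \<le> x j" "x j \<le> b" if "j \<in> J" "j \<noteq> i" for j using D(1,2)[of j] that by auto
    have "line_sep s J a b x"
      unfolding line_sep_def
    proof (intro conjI ballI impI)
      fix j assume j: "j \<in> J"
      show "a \<le> x j" "x j \<le> b" using ge[OF j] *(1,2) s by (cases "j = i"; force)+
    next
      fix j k assume jk: "j \<in> J" "k \<in> J" "j \<noteq> k"
      show "s \<le> \<bar>x j - x k\<bar>"
      proof (cases "j = i \<or> k = i")
        case True
        then show ?thesis using ge(1)[OF jk(1)] ge(1)[OF jk(2)] jk(3) by auto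
      next
        case False
        then show ?thesis using D(3)[of j k] jk by auto
      qed
    qed
    then show False using False by blast
  qed
  then have "(\<Sum>i\<in>J. indicator {a..b} (x i) * indicator {x. line_sep s (J - {i}) (x i + s) b x} x) = (0 :: ennreal)"
    by (intro sum.neutral ballI)
  then show ?thesis using False by (simp only: indicator_simps mem_Collect_eq) simp
qed

lemma line_sep_update: "line_sep s (J - {i}) a b (x(i := y)) = line_sep s (J - {i}) a b x"
  unfolding line_sep_def by simp

text \<open>Closing up \<open>card J - 1\<close> gaps of length \<open>s\<close> leaves an interval
  of length \<open>b - a + s - card J * s\<close>, of which this is the power. The proof integrates
  over the smallest coordinate; each index is equally likely to carry it and contributes a share
  \<open>1 / card J\<close>.\<close>

lemma volume_line_sep:
  fixes s a b :: real
  assumes J: "finite J" and s: "0 < s" and ab: "0 \<le> a" "b \<le> 1"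
  shows "(\<integral>\<^sup>+x. indicator {x. line_sep s J a b x} x \<partial>Pi\<^sub>M J (\<lambda>_. unif))
    = ennreal (max 0 (b - a + s - card J * s) ^ card J)"
  using J ab(1)
proof (induction "card J" arbitrary: J a)
  case 0
  then have "J = {}" by simp
  then show ?case by (simp add: line_sep_def PiM_empty)
next
  case (Suc m)
  have J: "finite J" "J \<noteq> {}" "card J = Suc m" using Suc by auto
  let ?c = "b - m * s"
  have trm: "(\<integral>\<^sup>+x. indicator {a..b} (x i) * indicator {x. line_sep s (J - {i}) (x i + s) b x} x \<partial>Pi\<^sub>M J (\<lambda>_. unif))
    = ennreal (max 0 (?c - a) ^ Suc m / Suc m)" if i: "i \<in> J" for i
  proof -
    let ?f = "\<lambda>x :: nat \<Rightarrow> real. indicator {a..b} (x i) * indicator {x. line_sep s (J - {i}) (x i + s) b x} x :: ennreal"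
    have Ji: "insert i (J - {i}) = J" "card (J - {i}) = m" using i J by auto
    have meas: "?f \<in> borel_measurable (Pi\<^sub>M J (\<lambda>_. unif))"
    proof (rule borel_measurable_times_ennreal)
      note [measurable] = component_measurable[OF i]
      show "(\<lambda>x. indicator {a..b} (x i) :: ennreal) \<in> borel_measurable (Pi\<^sub>M J (\<lambda>_. unif))" by measurable
      have "Measurable.pred (Pi\<^sub>M J (\<lambda>_. unif)) (\<lambda>x. line_sep s (J - {i}) (x i + s) b x)"
        using J by (intro measurable_line_sep) (auto intro: component_measurable)
      then show "(\<lambda>x. indicator {x. line_sep s (J - {i}) (x i + s) b x} x :: ennreal) \<in> borel_measurable (Pi\<^sub>M J (\<lambda>_. unif))"
        unfolding indicator_def by measurable
    qed
    have "integral\<^sup>N (Pi\<^sub>M J (\<lambda>_. unif)) ?f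
      = (\<integral>\<^sup>+y. (\<integral>\<^sup>+x. ?f (x(i := y)) \<partial>Pi\<^sub>M (J - {i}) (\<lambda>_. unif)) \<partial>unif)"
      using unif.product_nn_integral_insert_rev[of "J - {i}" i ?f] J meas unfolding Ji by simp
    also have "\<dots> = (\<integral>\<^sup>+y. ennreal (max 0 (?c - y) ^ m) * indicator {a..b} y \<partial>unif)"
    proof (rule nn_integral_cong)
      fix y
      show "(\<integral>\<^sup>+x. ?f (x(i := y)) \<partial>Pi\<^sub>M (J - {i}) (\<lambda>_. unif)) = ennreal (max 0 (?c - y) ^ m) * indicator {a..b} y"
      proof (cases "y \<in> {a..b}")
        case False
        then show ?thesis by simp
      next
        case True
        have "(\<integral>\<^sup>+x. ?f (x(i := y)) \<partial>Pi\<^sub>M (J - {i}) (\<lambda>_. unif))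
          = (\<integral>\<^sup>+x. indicator {x. line_sep s (J - {i}) (y + s) b x} x \<partial>Pi\<^sub>M (J - {i}) (\<lambda>_. unif))"
          using True by (intro nn_integral_cong) (simp add: indicator_def line_sep_update)
        also have "\<dots> = ennreal (max 0 (b - (y + s) + s - card (J - {i}) * s) ^ card (J - {i}))"
          using Ji J True s Suc.prems by (intro Suc.hyps(1)) auto
        finally show ?thesis using True unfolding Ji by (simp add: algebra_simps)
      qed
    qed
    also have "\<dots> = (\<integral>\<^sup>+y. ennreal (max 0 (?c - y) ^ m) * indicator {a..b} y * indicator {0..1} y \<partial>lborel)"
      by (rule nn_integral_unif) measurable
    also have "\<dots> = (\<integral>\<^sup>+y. ennreal (max 0 (?c - y) ^ m) * indicator {a..?c} y \<partial>lborel)"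
    proof (rule nn_integral_cong)
      fix y
      have "?c \<le> b" using s by simp
      \<comment> \<open>For m = 0 the range is empty because \<open>?c = b\<close>, so the value 1
        of 0^0 does no harm.\<close>
      moreover have "max 0 (?c - y) ^ m = 0" if "?c < y" "y \<le> b"
        using that s by (cases "m = 0") auto
      ultimately show "ennreal (max 0 (?c - y) ^ m) * indicator {a..b} y * indicator {0..1} y = ennreal (max 0 (?c - y) ^ m) * indicator {a..?c} y"
        using Suc.prems ab(2) by (cases "y \<le> ?c") (auto simp: indicator_def)
    qed
    also have "\<dots> = ennreal (max 0 (?c - a) ^ Suc m / Suc m)" by (rule nn_integral_power)
    finally show ?thesis .
  qed
  have meas: "(\<lambda>x. indicator {a..b} (x i) * indicator {x. line_sep s (J - {i}) (x i + s) b x} x :: ennreal)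
    \<in> borel_measurable (Pi\<^sub>M J (\<lambda>_. unif))" if i: "i \<in> J" for i
  proof (rule borel_measurable_times_ennreal)
    note [measurable] = component_measurable[OF i]
    show "(\<lambda>x. indicator {a..b} (x i) :: ennreal) \<in> borel_measurable (Pi\<^sub>M J (\<lambda>_. unif))" by measurable
    have "Measurable.pred (Pi\<^sub>M J (\<lambda>_. unif)) (\<lambda>x. line_sep s (J - {i}) (x i + s) b x)"
      using J i by (intro measurable_line_sep) (auto intro: component_measurable)
    then show "(\<lambda>x. indicator {x. line_sep s (J - {i}) (x i + s) b x} x :: ennreal) \<in> borel_measurable (Pi\<^sub>M J (\<lambda>_. unif))"
      unfolding indicator_def by measurable
  qed
  have "(\<integral>\<^sup>+x. indicator {x. line_sep s J a b x} x \<partial>Pi\<^sub>M J (\<lambda>_. unif)) = (\<Sum>i\<in>J. ennreal (max 0 (?c - a) ^ Suc m / Suc m))"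
    unfolding line_sep_split[OF J(1,2) s] using meas trm by (subst nn_integral_sum) auto
  also have "\<dots> = ennreal (max 0 (?c - a) ^ Suc m)"
    by (rule sum_ennreal_average[OF J(3)]) simp
  also have "?c - a = b - a + s - card J * s" using J(3) by (simp add: algebra_simps)
  finally show ?case unfolding Suc.hyps(2)[symmetric] .
qed

section \<open>Separated configurations on the circle\<close>

definition circ_sep :: "real \<Rightarrow> nat set \<Rightarrow> (nat \<Rightarrow> real) \<Rightarrow> bool" where
  "circ_sep s J x \<longleftrightarrow> (\<forall>i\<in>J. \<forall>j\<in>J. i \<noteq> j \<longrightarrow> s \<le> \<bar>x i - x j\<bar> \<and> \<bar>x i - x j\<bar> \<le> 1 - s)"

lemma circ_sepD:
  assumes "circ_sep s J x" "i \<in> J" "j \<in> J" "i \<noteq> j"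
  shows "s \<le> \<bar>x i - x j\<bar>" "\<bar>x i - x j\<bar> \<le> 1 - s"
  using assms unfolding circ_sep_def by blast+

text \<open>Again split by the smallest coordinate. The other points must also keep distance
  \<open>s\<close> from it across 0, which bounds them by \<open>x i + 1 - s\<close>; the minimum
  with 1 keeps them in the unit interval.\<close>

lemma circ_sep_split:
  fixes s :: real
  assumes J: "finite J" "J \<noteq> {}" and s: "0 < s" and x: "\<And>j. j \<in> J \<Longrightarrow> x j \<in> circle"
  shows "indicator {x. circ_sep s J x} x
    = (\<Sum>i\<in>J. indicator {x. line_sep s (J - {i}) (x i + s) (min 1 (x i + 1 - s)) x} x :: ennreal)"
proof (cases "circ_sep s J x")
  case True
  note D = circ_sepD[OF True]
  obtain i where i: "i \<in> J" "\<And>j. j \<in> J \<Longrightarrow> x i \<le> x j"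
    using arg_min_if_finite(1)[OF J, of x] arg_min_least[OF J, of _ x] by blast
  have ge: "x i + s \<le> x j" "x j \<le> min 1 (x i + 1 - s)" if "j \<in> J" "j \<noteq> i" for j
    using D[OF that(1) i(1) that(2)] i(2)[OF that(1)] x[OF that(1)] by (auto simp: circle_def)
  have "line_sep s (J - {i}) (x i + s) (min 1 (x i + 1 - s)) x"
    unfolding line_sep_def using ge D(1) by blast
  then have one: "indicator {x. line_sep s (J - {i}) (x i + s) (min 1 (x i + 1 - s)) x} x = (1 :: ennreal)" by simp
  have zero: "indicator {x. line_sep s (J - {j}) (x j + s) (min 1 (x j + 1 - s)) x} x = (0 :: ennreal)"
    if j: "j \<in> J - {i}" for j
  proof -
    have "\<not> line_sep s (J - {j}) (x j + s) (min 1 (x j + 1 - s)) x"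
    proof
      assume "line_sep s (J - {j}) (x j + s) (min 1 (x j + 1 - s)) x"
      from line_sepD(1)[OF this, of i] i(1) j have "x j + s \<le> x i" by auto
      then show False using i(2)[of j] j s by auto
    qed
    then show ?thesis by simp
  qed
  have "(\<Sum>j\<in>J. indicator {x. line_sep s (J - {j}) (x j + s) (min 1 (x j + 1 - s)) x} x :: ennreal)
    = 1 + (\<Sum>j\<in>J-{i}. 0)"
    unfolding sum.remove[OF J(1) i(1)] one using zero by (intro arg_cong2[where f = "(+)"] sum.cong) auto
  then show ?thesis using True by simp
next
  case False
  have "indicator {x. line_sep s (J - {i}) (x i + s) (min 1 (x i + 1 - s)) x} x = (0 :: ennreal)"
    if i: "i \<in> J" for i
  proof (rule ccontr)
    assume "\<not> ?thesis"
    then have *: "line_sep s (J - {i}) (x i + s) (min 1 (x i + 1 - s)) x"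
      by (auto simp: indicator_def split: if_splits)
    note D = line_sepD[OF *]
    have ge: "x i + s \<le> x j" "x j \<le> x i + 1 - s" if "j \<in> J" "j \<noteq> i" for j
      using D(1,2)[of j] that by auto
    have "circ_sep s J x"
      unfolding circ_sep_def
    proof (intro ballI impI)
      fix j k assume jk: "j \<in> J" "k \<in> J" "j \<noteq> k"
      show "s \<le> \<bar>x j - x k\<bar> \<and> \<bar>x j - x k\<bar> \<le> 1 - s"
      proof (cases "j = i \<or> k = i")
        case True
        then show ?thesis using ge[OF jk(1)] ge[OF jk(2)] jk(3) by auto
      next
        case False
        then show ?thesis using D(3)[of j k] jk ge[OF jk(1)] ge[OF jk(2)] s by auto
      qed
    qed
    then show False using False by blast
  qed
  then have "(\<Sum>i\<in>J. indicator {x. line_sep s (J - {i}) (x i + s) (min 1 (x i + 1 - s)) x} x) = (0 :: ennreal)"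
    by (intro sum.neutral ballI)
  then show ?thesis using False by (simp only: indicator_simps mem_Collect_eq) simp
qed

lemma AE_components_circle:
  assumes "finite J"
  shows "AE x in Pi\<^sub>M J (\<lambda>_. unif). \<forall>j\<in>J. x j \<in> circle"
  using assms AE_unif_circle
  by (intro eventually_ball_finite ballI AE_PiM_component prob_space_unif) auto

text \<open>With \<open>L = max 0 (1 - (k + 1) * s)\<close>, the integrand is constantly
  \<open>L ^ k\<close> up to y = s, where the bound across 0 is active, and a decreasing power
  afterwards. The two pieces combine because \<open>(k + 1) * s + L = 1\<close> whenever L is
  positive.\<close>

lemma nn_integral_circ_sep_slice:
  fixes s :: real and k :: nat
  assumes s: "0 < s" "s \<le> 1"
  shows "(\<integral>\<^sup>+y. ennreal (max 0 (min 1 (y + 1 - s) - y - k * s) ^ k) * indicator {0..1} y \<partial>lborel)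
    = ennreal (max 0 (1 - Suc k * s) ^ k / Suc k)"
proof -
  define L where "L = max 0 (1 - Suc k * s)"
  let ?h = "\<lambda>y. ennreal (max 0 (min 1 (y + 1 - s) - y - k * s) ^ k)"
  have L0: "0 \<le> L" by (simp add: L_def)
  have "(\<integral>\<^sup>+y. ?h y * indicator {0..1} y \<partial>lborel)
    = (\<integral>\<^sup>+y. ennreal (L ^ k) * indicator {0..s} y + ennreal (max 0 (1 - k * s - y) ^ k) * indicator {s..1 - k * s} y \<partial>lborel)"
  proof (rule nn_integral_cong_AE)
    have "AE y in lborel. y \<noteq> s" by (rule AE_lborel_singleton)
    then show "AE y in lborel. ?h y * indicator {0..1} y
      = ennreal (L ^ k) * indicator {0..s} y + ennreal (max 0 (1 - k * s - y) ^ k) * indicator {s..1 - k * s} y"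
    proof eventually_elim
      fix y assume ys: "y \<noteq> s"
      have k0: "0 \<le> k * s" using s by simp
      consider "y < 0" | "0 \<le> y" "y < s" | "s < y" "y \<le> 1 - k * s" | "s < y" "1 - k * s < y" "y \<le> 1" | "1 < y"
        using ys by linarith
      then show "?h y * indicator {0..1} y
        = ennreal (L ^ k) * indicator {0..s} y + ennreal (max 0 (1 - k * s - y) ^ k) * indicator {s..1 - k * s} y"
      proof cases
        case 1
        then show ?thesis using s by simp
      next
        case 2
        then have eq: "min 1 (y + 1 - s) - y - k * s = 1 - Suc k * s" by (simp add: algebra_simps)
        have "?h y = ennreal (L ^ k)" by (simp only: eq L_def)
        then show ?thesis using 2 s by simp
      next
        case 3
        then have eq: "min 1 (y + 1 - s) - y - k * s = 1 - k * s - y" by (simp add: algebra_simps)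
        have "?h y = ennreal (max 0 (1 - k * s - y) ^ k)" by (simp only: eq)
        moreover have "0 \<le> y" "y \<le> 1" using 3 s k0 by linarith+
        ultimately show ?thesis using 3 s by simp
      next
        case 4
        then have eq: "min 1 (y + 1 - s) - y - k * s = 1 - k * s - y" by (simp add: algebra_simps)
        have "?h y = ennreal (max 0 (1 - k * s - y) ^ k)" by (simp only: eq)
        moreover have "k \<noteq> 0" using 4 by (cases "k = 0") simp_all
        moreover have "max 0 (1 - k * s - y) = 0" using 4 by simp
        ultimately show ?thesis using 4 s by simp
      next
        case 5
        then have "1 - k * s < y" using k0 by linarith
        then show ?thesis using 5 s by simp
      qed
    qed
  qed
  also have "\<dots> = ennreal (L ^ k) * ennreal s + ennreal (max 0 (1 - k * s - s) ^ Suc k / Suc k)"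
    using s by (subst nn_integral_add) (simp_all add: nn_integral_cmult nn_integral_power)
  also have "1 - k * s - s = 1 - Suc k * s" by (simp add: algebra_simps)
  also have "ennreal (L ^ k) * ennreal s + ennreal (max 0 (1 - Suc k * s) ^ Suc k / Suc k)
    = ennreal (L ^ k * s + L ^ Suc k / Suc k)"
    using s L0 unfolding L_def[symmetric] by (simp add: ennreal_mult' ennreal_plus)
  also have "L ^ k * s + L ^ Suc k / Suc k = L ^ k / Suc k"
  proof (cases "L = 0")
    case False
    then have "L = 1 - Suc k * s" by (simp add: L_def max_def split: if_splits)
    then have "Suc k * s + L = 1" by simp
    moreover have "L ^ k * s + L ^ Suc k / Suc k = L ^ k * (Suc k * s + L) / Suc k" by (simp add: field_simps)
    ultimately show ?thesis by (simp only: mult_1_right)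
  next
    case L: True
    show ?thesis
    proof (cases k)
      case 0
      \<comment> \<open>Here 0^0 = 1 enters, and s = 1 makes both sides equal to 1.\<close>
      then have "s = 1" using L s by (simp add: L_def max_def split: if_splits)
      then show ?thesis using 0 L by simp
    next
      case (Suc q)
      then show ?thesis using L by simp
    qed
  qed
  finally show ?thesis by (simp add: L_def)
qed

text \<open>The exponent is one less than the number of points, as expected from the freedom of a
  common rotation: relative to one point, the others are separated points on a line.\<close>

lemma volume_circ_sep:
  fixes s :: real
  assumes J: "finite J" "card J = Suc k" and s: "0 < s" "s \<le> 1"
  shows "(\<integral>\<^sup>+x. indicator {x. circ_sep s J x} x \<partial>Pi\<^sub>M J (\<lambda>_. unif)) = ennreal (max 0 (1 - Suc k * s) ^ k)"
proof -
  let ?g = "\<lambda>i (x :: nat \<Rightarrow> real). indicator {x. line_sep s (J - {i}) (x i + s) (min 1 (x i + 1 - s)) x} x :: ennreal"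
  have Jne: "J \<noteq> {}" using J by auto
  have meas: "?g i \<in> borel_measurable (Pi\<^sub>M J (\<lambda>_. unif))" if i: "i \<in> J" for i
  proof -
    note [measurable] = component_measurable[OF i]
    have "Measurable.pred (Pi\<^sub>M J (\<lambda>_. unif)) (\<lambda>x. line_sep s (J - {i}) (x i + s) (min 1 (x i + 1 - s)) x)"
      using J by (intro measurable_line_sep) (auto intro: component_measurable)
    then show ?thesis unfolding indicator_def by measurable
  qed
  have trm: "integral\<^sup>N (Pi\<^sub>M J (\<lambda>_. unif)) (?g i) = ennreal (max 0 (1 - Suc k * s) ^ k / Suc k)" if i: "i \<in> J" for i
  proof -
    have Ji: "insert i (J - {i}) = J" "card (J - {i}) = k" using i J by auto
    have "integral\<^sup>N (Pi\<^sub>M J (\<lambda>_. unif)) (?g i)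
      = (\<integral>\<^sup>+y. (\<integral>\<^sup>+x. ?g i (x(i := y)) \<partial>Pi\<^sub>M (J - {i}) (\<lambda>_. unif)) \<partial>unif)"
      using unif.product_nn_integral_insert_rev[of "J - {i}" i "?g i"] J meas[OF i] unfolding Ji by simp
    also have "\<dots> = (\<integral>\<^sup>+y. ennreal (max 0 (min 1 (y + 1 - s) - y - k * s) ^ k) \<partial>unif)"
    proof (rule nn_integral_cong_AE)
      show "AE y in unif. (\<integral>\<^sup>+x. ?g i (x(i := y)) \<partial>Pi\<^sub>M (J - {i}) (\<lambda>_. unif))
        = ennreal (max 0 (min 1 (y + 1 - s) - y - k * s) ^ k)"
        using AE_unif_circle
      proof eventually_elim
        fix y assume "y \<in> circle"
        then have y: "0 \<le> y + s" "min 1 (y + 1 - s) \<le> 1" using s by (auto simp: circle_def)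
        have "(\<integral>\<^sup>+x. ?g i (x(i := y)) \<partial>Pi\<^sub>M (J - {i}) (\<lambda>_. unif))
          = (\<integral>\<^sup>+x. indicator {x. line_sep s (J - {i}) (y + s) (min 1 (y + 1 - s)) x} x \<partial>Pi\<^sub>M (J - {i}) (\<lambda>_. unif))"
          by (intro nn_integral_cong) (simp add: indicator_def line_sep_update)
        also have "\<dots> = ennreal (max 0 (min 1 (y + 1 - s) - (y + s) + s - card (J - {i}) * s) ^ card (J - {i}))"
          using J s y by (intro volume_line_sep) auto
        finally show "(\<integral>\<^sup>+x. ?g i (x(i := y)) \<partial>Pi\<^sub>M (J - {i}) (\<lambda>_. unif))
          = ennreal (max 0 (min 1 (y + 1 - s) - y - k * s) ^ k)"
          unfolding Ji by (simp add: algebra_simps)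
      qed
    qed
    also have "\<dots> = ennreal (max 0 (1 - Suc k * s) ^ k / Suc k)"
      by (subst nn_integral_unif) (simp, rule nn_integral_circ_sep_slice[OF s])
    finally show ?thesis .
  qed
  have "(\<integral>\<^sup>+x. indicator {x. circ_sep s J x} x \<partial>Pi\<^sub>M J (\<lambda>_. unif)) = (\<integral>\<^sup>+x. (\<Sum>i\<in>J. ?g i x) \<partial>Pi\<^sub>M J (\<lambda>_. unif))"
  proof (rule nn_integral_cong_AE)
    show "AE x in Pi\<^sub>M J (\<lambda>_. unif). indicator {x. circ_sep s J x} x = (\<Sum>i\<in>J. ?g i x)"
      using AE_components_circle[OF J(1)] by eventually_elim (rule circ_sep_split[OF J(1) Jne s(1)], blast)
  qed
  also have "\<dots> = (\<Sum>i\<in>J. ennreal (max 0 (1 - Suc k * s) ^ k / Suc k))"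
    using meas trm by (subst nn_integral_sum) auto
  also have "\<dots> = ennreal (max 0 (1 - Suc k * s) ^ k)" by (rule sum_ennreal_average[OF J(2)]) simp
  finally show ?thesis .
qed

lemma emeasure_arc:
  fixes s :: real
  assumes a: "a \<in> circle" and s: "0 < s" "s \<le> 1"
  shows "emeasure lborel {y\<in>circle. cw a y < s} = ennreal s"
proof -
  have *: "{y\<in>circle. cw a y < s} = {a<..<min 1 (a + s)} \<union> {0..<a + s - 1}"
    using a s by (auto simp: circle_def cw_def split: if_splits)
  show ?thesis
  proof (cases "a + s \<le> 1")
    case True
    then have "{y\<in>circle. cw a y < s} = {a<..<a + s}" unfolding * by auto
    then show ?thesis using s by simp
  next
    case False
    have "emeasure lborel ({a<..<1} \<union> {0..<a + s - 1}) = emeasure lborel {a<..<1} + emeasure lborel {0..<a + s - 1}"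
      using s by (intro plus_emeasure[symmetric]) auto
    also have "\<dots> = ennreal (1 - a) + ennreal (a + s - 1)" using a False by (simp add: circle_def)
    also have "\<dots> = ennreal s" using a False by (subst ennreal_plus[symmetric]) (auto simp: circle_def)
    finally show ?thesis unfolding * using False by (simp add: min_def)
  qed
qed

text \<open>Arcs of length \<open>s\<close> following points at mutual distance at least
  \<open>s\<close> are disjoint, so their lengths add up.\<close>

lemma emeasure_cover:
  fixes s :: real
  assumes J: "finite J" and s: "0 < s" "s \<le> 1" and x: "\<And>j. j \<in> J \<Longrightarrow> x j \<in> circle" and sep: "circ_sep s J x"
  shows "emeasure unif {y. \<exists>a\<in>J. cw (x a) y < s} = ennreal (card J * s)"
proof -
  have m: "{y. \<exists>a\<in>J. cw (x a) y < s} \<in> sets borel"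
  proof -
    have "Measurable.pred borel (\<lambda>y. \<exists>a\<in>J. cw (x a) y < s)"
      unfolding cw_def using J by measurable
    then show ?thesis by (simp add: pred_def)
  qed
  have "emeasure unif {y. \<exists>a\<in>J. cw (x a) y < s} = emeasure lborel (circle \<inter> {y. \<exists>a\<in>J. cw (x a) y < s})"
    using m by (subst emeasure_uniform_measure) (simp_all add: emeasure_circle divide_ennreal_def)
  also have "circle \<inter> {y. \<exists>a\<in>J. cw (x a) y < s} = (\<Union>a\<in>J. {y\<in>circle. cw (x a) y < s})" by blast
  also have "emeasure lborel \<dots> = (\<Sum>a\<in>J. emeasure lborel {y\<in>circle. cw (x a) y < s})"
  proof (rule sum_emeasure[symmetric])
    show "(\<lambda>a. {y\<in>circle. cw (x a) y < s}) ` J \<subseteq> sets lborel"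
    proof (rule image_subsetI)
      fix a
      have "Measurable.pred borel (\<lambda>y. y \<in> circle \<and> cw (x a) y < s)"
        unfolding cw_def by measurable
      then show "{y\<in>circle. cw (x a) y < s} \<in> sets lborel" by (simp add: pred_def)
    qed
    show "disjoint_family_on (\<lambda>a. {y\<in>circle. cw (x a) y < s}) J"
      unfolding disjoint_family_on_def
    proof (intro ballI impI)
      fix a b assume ab: "a \<in> J" "b \<in> J" "a \<noteq> b"
      have False if "y \<in> circle" "cw (x a) y < s" "cw (x b) y < s" for y
        using that circ_sepD[OF sep ab] x[OF ab(1)] x[OF ab(2)]
        by (auto simp: cw_def circle_def split: if_splits)
      then show "{y\<in>circle. cw (x a) y < s} \<inter> {y\<in>circle. cw (x b) y < s} = {}" by blast
    qed
  qed (rule J)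
  also have "\<dots> = (\<Sum>a\<in>J. ennreal s)" using emeasure_arc[OF _ s] x by (intro sum.cong) auto
  also have "\<dots> = ennreal (card J * s)" using s by (simp add: ennreal_of_nat_eq_real_of_nat ennreal_mult')
  finally show ?thesis .
qed

text \<open>\<open>spread\<close> in terms of indices, so that the points of \<open>J\<close> and
  the remaining ones are independent coordinates. \<open>spread_image_iff\<close> returns to sets of
  points for samples without repetitions.\<close>

definition spread_event :: "real \<Rightarrow> nat \<Rightarrow> nat set \<Rightarrow> (nat \<Rightarrow> real) \<Rightarrow> bool" where
  "spread_event s n J x \<longleftrightarrow> circ_sep s J x \<and> (\<forall>i\<in>{..<n} - J. \<exists>a\<in>J. cw (x a) (x i) < s)"

lemma measurable_circ_sep:
  assumes J: "finite J" and x: "\<And>j. j \<in> J \<Longrightarrow> (\<lambda>z. x z j) \<in> borel_measurable M"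
  shows "Measurable.pred M (\<lambda>z. circ_sep s J (x z))"
proof -
  have "Measurable.pred M (\<lambda>z. i \<noteq> j \<longrightarrow> s \<le> \<bar>x z i - x z j\<bar> \<and> \<bar>x z i - x z j\<bar> \<le> 1 - s)" if "i \<in> J" "j \<in> J" for i j
    using x[OF that(1)] x[OF that(2)] by measurable
  then show ?thesis unfolding circ_sep_def by - (intro pred_finite_ball J; blast)
qed

lemma measurable_spread_event:
  assumes J: "J \<subseteq> {..<n}"
  shows "Measurable.pred (Pi\<^sub>M {..<n} (\<lambda>_. unif)) (spread_event s n J)"
proof -
  have finJ: "finite J" and fin: "finite ({..<n} - J)" using J finite_subset by blast+
  have p1: "Measurable.pred (Pi\<^sub>M {..<n} (\<lambda>_. unif)) (\<lambda>x. cw (x a) (x i) < s)" if "i \<in> {..<n} - J" "a \<in> J" for a i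
  proof -
    have "a \<in> {..<n}" "i \<in> {..<n}" using that J by auto
    note [measurable] = this[THEN component_measurable]
    show ?thesis unfolding cw_def by measurable
  qed
  have p2: "Measurable.pred (Pi\<^sub>M {..<n} (\<lambda>_. unif)) (\<lambda>x. circ_sep s J x)"
    by (rule measurable_circ_sep[OF finJ component_measurable]) (use J in blast)
  have "Measurable.pred (Pi\<^sub>M {..<n} (\<lambda>_. unif)) (\<lambda>x. spread_event s n J x)"
    unfolding spread_event_def
    by (rule pred_intros_logic(3)[OF p2 pred_finite_ball[OF fin pred_finite_bex[OF finJ p1]]])
  then show ?thesis .
qed

lemma volume_spread_event:
  fixes s :: real
  assumes J: "J \<subseteq> {..<n}" "card J = Suc k" and s: "0 < s" "s \<le> 1"
  shows "(\<integral>\<^sup>+x. indicator {x. spread_event s n J x} x \<partial>circle_sample n)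
    = ennreal (max 0 (1 - Suc k * s) ^ k * (Suc k * s) ^ (n - Suc k))"
proof -
  define R where "R = {..<n} - J"
  have fin: "finite J" "finite R" and disj: "J \<inter> R = {}" and un: "J \<union> R = {..<n}"
    using J finite_subset by (auto simp: R_def)
  have cR: "card R = n - Suc k" using J by (simp add: R_def card_Diff_subset fin(1))
  let ?f = "indicator {x. spread_event s n J x} :: _ \<Rightarrow> ennreal"
  let ?U = "\<lambda>x. {y. \<exists>a\<in>J. cw (x a) y < s}"
  have mf: "?f \<in> borel_measurable (Pi\<^sub>M (J \<union> R) (\<lambda>_. unif))"
    using measurable_spread_event[OF J(1)] unfolding un indicator_def by measurable
  have "(\<integral>\<^sup>+x. ?f x \<partial>circle_sample n) = (\<integral>\<^sup>+x. (\<integral>\<^sup>+y. ?f (merge J R (x, y)) \<partial>Pi\<^sub>M R (\<lambda>_. unif)) \<partial>Pi\<^sub>M J (\<lambda>_. unif))"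
    unfolding circle_sample_def un[symmetric] by (rule unif.product_nn_integral_fold[OF disj fin mf])
  also have "\<dots> = (\<integral>\<^sup>+x. indicator {x. circ_sep s J x} x * ennreal ((Suc k * s) ^ (n - Suc k)) \<partial>Pi\<^sub>M J (\<lambda>_. unif))"
  proof (rule nn_integral_cong_AE)
    show "AE x in Pi\<^sub>M J (\<lambda>_. unif). (\<integral>\<^sup>+y. ?f (merge J R (x, y)) \<partial>Pi\<^sub>M R (\<lambda>_. unif))
      = indicator {x. circ_sep s J x} x * ennreal ((Suc k * s) ^ (n - Suc k))"
      using AE_components_circle[OF fin(1)]
    proof eventually_elim
      fix x assume x: "\<forall>j\<in>J. x j \<in> circle"
      have mJ: "merge J R (x, y) a = x a" if "a \<in> J" for a and y :: "nat \<Rightarrow> real" using that by (simp add: merge_def)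
      have mR: "merge J R (x, y) i = y i" if "i \<in> R" for i and y :: "nat \<Rightarrow> real"
        using that disj by (auto simp: merge_def)
      have ev: "spread_event s n J (merge J R (x, y)) \<longleftrightarrow> circ_sep s J x \<and> (\<forall>i\<in>R. y i \<in> ?U x)" for y
        unfolding spread_event_def circ_sep_def R_def[symmetric] using mJ mR by simp
      show "(\<integral>\<^sup>+y. ?f (merge J R (x, y)) \<partial>Pi\<^sub>M R (\<lambda>_. unif))
        = indicator {x. circ_sep s J x} x * ennreal ((Suc k * s) ^ (n - Suc k))"
      proof (cases "circ_sep s J x")
        case False
        then show ?thesis by (simp add: ev indicator_def)
      next
        case True
        have mU: "?U x \<in> sets unif"
        proof -
          have "Measurable.pred borel (\<lambda>y. \<exists>a\<in>J. cw (x a) y < s)" unfolding cw_def using fin by measurable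
          then show ?thesis by (simp add: pred_def)
        qed
        have ind: "?f (merge J R (x, y)) = (\<Prod>i\<in>R. indicator (?U x) (y i))" for y
        proof (cases "\<forall>i\<in>R. y i \<in> ?U x")
          case all: True
          then have "(\<Prod>i\<in>R. indicator (?U x) (y i)) = (1 :: ennreal)" by (intro prod.neutral) simp
          then show ?thesis using True all ev[of y] by simp
        next
          case no: False
          then obtain i where "i \<in> R" "y i \<notin> ?U x" by blast
          then have "(\<Prod>i\<in>R. indicator (?U x) (y i)) = (0 :: ennreal)" using fin(2) by (intro prod_zero bexI[of _ i]) simp_all
          then show ?thesis using no ev[of y] by simp
        qed
        have "(\<integral>\<^sup>+y. ?f (merge J R (x, y)) \<partial>Pi\<^sub>M R (\<lambda>_. unif)) = (\<Prod>i\<in>R. \<integral>\<^sup>+y. indicator (?U x) y \<partial>unif)"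
          unfolding ind by (rule unif.product_nn_integral_prod[OF fin(2) borel_measurable_indicator[OF mU]])
        also have "\<dots> = ennreal (card J * s) ^ (n - Suc k)"
          using emeasure_cover[OF fin(1) s _ True] x mU cR by simp
        finally show ?thesis using True J(2) s by (simp add: ennreal_power)
      qed
    qed
  qed
  also have "\<dots> = (\<integral>\<^sup>+x. indicator {x. circ_sep s J x} x \<partial>Pi\<^sub>M J (\<lambda>_. unif)) * ennreal ((Suc k * s) ^ (n - Suc k))"
  proof (rule nn_integral_multc)
    have "Measurable.pred (Pi\<^sub>M J (\<lambda>_. unif)) (\<lambda>x. circ_sep s J x)"
      by (rule measurable_circ_sep[OF fin(1) component_measurable])
    then show "(\<lambda>x. indicator {x. circ_sep s J x} x :: ennreal) \<in> borel_measurable (Pi\<^sub>M J (\<lambda>_. unif))"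
      unfolding indicator_def by measurable
  qed
  also have "\<dots> = ennreal (max 0 (1 - Suc k * s) ^ k) * ennreal ((Suc k * s) ^ (n - Suc k))"
    by (simp only: volume_circ_sep[OF fin(1) J(2) s])
  also have "\<dots> = ennreal (max 0 (1 - Suc k * s) ^ k * (Suc k * s) ^ (n - Suc k))"
    using s by (intro ennreal_mult[symmetric]) auto
  finally show ?thesis .
qed

lemma AE_sample_inj: "AE \<omega> in circle_sample n. inj_on \<omega> {..<n}"
proof -
  have ne: "AE \<omega> in circle_sample n. \<omega> i \<noteq> \<omega> j" if ij: "i < n" "j < n" "i \<noteq> j" for i j
  proof -
    let ?I = "{..<n} - {j}"
    have I: "insert j ?I = {..<n}" "finite ?I" "j \<notin> ?I" using ij by auto
    have mp: "Measurable.pred (Pi\<^sub>M {..<n} (\<lambda>_. unif)) (\<lambda>\<omega>. \<omega> i = \<omega> j)"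
      using borel_measurable_eq[OF component_measurable[of i "{..<n}"] component_measurable[of j "{..<n}"]] ij
      by (simp add: pred_def)
    have mf: "(indicator {\<omega>. \<omega> i = \<omega> j} :: _ \<Rightarrow> ennreal) \<in> borel_measurable (Pi\<^sub>M {..<n} (\<lambda>_. unif))"
      using mp unfolding indicator_def by measurable
    have "(\<integral>\<^sup>+\<omega>. indicator {\<omega>. \<omega> i = \<omega> j} \<omega> \<partial>circle_sample n)
      = (\<integral>\<^sup>+x. (\<integral>\<^sup>+y. indicator {\<omega>. \<omega> i = \<omega> j} (x(j := y)) \<partial>unif) \<partial>Pi\<^sub>M ?I (\<lambda>_. unif))"
      unfolding circle_sample_def
      using unif.product_nn_integral_insert[OF I(2,3), of "indicator {\<omega>. \<omega> i = \<omega> j}"] mf unfolding I(1) by simp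
    also have "\<dots> = (\<integral>\<^sup>+x. 0 \<partial>Pi\<^sub>M ?I (\<lambda>_. unif))"
    proof (rule nn_integral_cong)
      fix x :: "nat \<Rightarrow> real"
      have "(\<integral>\<^sup>+y. indicator {\<omega>. \<omega> i = \<omega> j} (x(j := y)) \<partial>unif) = (\<integral>\<^sup>+y. indicator {x i} y \<partial>unif)"
        using ij(3) by (intro nn_integral_cong) (auto simp: indicator_def)
      also have "\<dots> = emeasure unif {x i}" by (rule nn_integral_indicator) simp
      also have "\<dots> = emeasure lborel (circle \<inter> {x i})"
        by (subst emeasure_uniform_measure) (simp_all add: emeasure_circle divide_ennreal_def)
      also have "\<dots> = 0"
      proof -
        have "emeasure lborel (circle \<inter> {x i}) \<le> emeasure lborel {x i}" by (rule emeasure_mono) auto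
        then show ?thesis by simp
      qed
      finally show "(\<integral>\<^sup>+y. indicator {\<omega>. \<omega> i = \<omega> j} (x(j := y)) \<partial>unif) = 0" .
    qed
    finally have "(\<integral>\<^sup>+\<omega>. indicator {\<omega>. \<omega> i = \<omega> j} \<omega> \<partial>circle_sample n) = 0" by simp
    then have "AE \<omega> in circle_sample n. indicator {\<omega>. \<omega> i = \<omega> j} \<omega> = (0 :: ennreal)"
      using mf by (subst (asm) nn_integral_0_iff_AE) (simp_all add: circle_sample_def)
    then show ?thesis by eventually_elim (auto simp: indicator_def split: if_splits)
  qed
  have "AE \<omega> in circle_sample n. \<forall>i\<in>{..<n}. \<forall>j\<in>{..<n}. i \<noteq> j \<longrightarrow> \<omega> i \<noteq> \<omega> j"
  proof (intro eventually_ball_finite ballI finite_lessThan)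
    fix i j assume "i \<in> {..<n}" "j \<in> {..<n}"
    then show "AE \<omega> in circle_sample n. i \<noteq> j \<longrightarrow> \<omega> i \<noteq> \<omega> j" using ne[of i j] by (cases "i = j") simp_all
  qed
  then show ?thesis by eventually_elim (auto simp: inj_on_def)
qed

lemma AE_sample_circle: "AE \<omega> in circle_sample n. \<forall>i<n. \<omega> i \<in> circle"
  using AE_components_circle[OF finite_lessThan] unfolding circle_sample_def by eventually_elim simp

section \<open>Expectations\<close>

text \<open>The mean number of spread sets with \<open>m + 1\<close> points. The shift makes
  \<open>2 * m\<close> the homological degree that such sets contribute to.\<close>

definition mean_spreads :: "nat \<Rightarrow> nat \<Rightarrow> real \<Rightarrow> real" where
  "mean_spreads n m s = real (n choose Suc m) * (max 0 (1 - real (Suc m) * s) ^ m * (real (Suc m) * s) ^ (n - Suc m))"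

definition spread_count :: "real \<Rightarrow> nat \<Rightarrow> nat \<Rightarrow> (nat \<Rightarrow> real) \<Rightarrow> nat" where
  "spread_count s n m \<omega> = card {J. J \<subseteq> {..<n} \<and> card J = Suc m \<and> spread_event s n J \<omega>}"

lemma spread_count_sum:
  "real (spread_count s n m \<omega>) = (\<Sum>J | J \<subseteq> {..<n} \<and> card J = Suc m. indicator {\<omega>. spread_event s n J \<omega>} \<omega>)"
proof -
  have "finite {J. J \<subseteq> {..<n} \<and> card J = Suc m}" by (rule finite_subset[of _ "Pow {..<n}"]) auto
  then have "(\<Sum>J | J \<subseteq> {..<n} \<and> card J = Suc m. indicator {\<omega>. spread_event s n J \<omega>} \<omega> :: real)
    = (\<Sum>J\<in>{J. J \<subseteq> {..<n} \<and> card J = Suc m} \<inter> {J. spread_event s n J \<omega>}. 1)"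
    by (simp add: indicator_def sum.If_cases)
  also have "{J. J \<subseteq> {..<n} \<and> card J = Suc m} \<inter> {J. spread_event s n J \<omega>}
    = {J. J \<subseteq> {..<n} \<and> card J = Suc m \<and> spread_event s n J \<omega>}" by blast
  finally show ?thesis by (simp add: spread_count_def)
qed

lemma has_integral_spread_event:
  assumes J: "J \<subseteq> {..<n}" "card J = Suc k" and s: "0 < s" "s \<le> 1"
  shows "has_bochner_integral (circle_sample n) (\<lambda>\<omega>. indicator {\<omega>. spread_event s n J \<omega>} \<omega> :: real)
    (max 0 (1 - real (Suc k) * s) ^ k * (real (Suc k) * s) ^ (n - Suc k))"
proof (rule has_bochner_integral_nn_integral)
  have "Measurable.pred (circle_sample n) (spread_event s n J)"
    unfolding circle_sample_def by (rule measurable_spread_event[OF J(1)])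
  then show "(\<lambda>\<omega>. indicator {\<omega>. spread_event s n J \<omega>} \<omega> :: real) \<in> borel_measurable (circle_sample n)"
    unfolding indicator_def by measurable
  show "(\<integral>\<^sup>+\<omega>. ennreal (indicator {\<omega>. spread_event s n J \<omega>} \<omega>) \<partial>circle_sample n)
    = ennreal (max 0 (1 - real (Suc k) * s) ^ k * (real (Suc k) * s) ^ (n - Suc k))"
    using volume_spread_event[OF J s] by (simp add: ennreal_indicator)
qed (use s in auto)

lemma has_integral_spread_count:
  assumes s: "0 < s" "s \<le> 1"
  shows "has_bochner_integral (circle_sample n) (\<lambda>\<omega>. real (spread_count s n m \<omega>)) (mean_spreads n m s)"
proof -
  let ?F = "{J. J \<subseteq> {..<n} \<and> card J = Suc m}"
  let ?p = "max 0 (1 - real (Suc m) * s) ^ m * (real (Suc m) * s) ^ (n - Suc m)"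
  have "has_bochner_integral (circle_sample n) (\<lambda>\<omega>. \<Sum>J\<in>?F. indicator {\<omega>. spread_event s n J \<omega>} \<omega> :: real) (\<Sum>J\<in>?F. ?p)"
    by (rule has_bochner_integral_sum) (use has_integral_spread_event[OF _ _ s] in blast)
  moreover have "(\<Sum>J\<in>?F. ?p) = mean_spreads n m s"
    using n_subsets[of "{..<n}" "Suc m"] by (simp add: mean_spreads_def)
  ultimately show ?thesis by (simp only: spread_count_sum)
qed

text \<open>For distinct points of the fundamental domain the two clockwise distances are the
  absolute difference and its complement to 1, which explains the two inequalities in
  \<open>circ_sep\<close>.\<close>

lemma spread_image_iff:
  assumes \<omega>: "inj_on \<omega> {..<n}" "\<And>i. i < n \<Longrightarrow> \<omega> i \<in> circle" and J: "J \<subseteq> {..<n}" "J \<noteq> {}" and s: "s \<le> 1"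
  shows "spread s (\<omega> ` {..<n}) (\<omega> ` J) \<longleftrightarrow> spread_event s n J \<omega>"
proof -
  have pair: "s \<le> cw (\<omega> i) (\<omega> j) \<and> s \<le> cw (\<omega> j) (\<omega> i) \<longleftrightarrow> s \<le> \<bar>\<omega> i - \<omega> j\<bar> \<and> \<bar>\<omega> i - \<omega> j\<bar> \<le> 1 - s"
    if ij: "i \<in> J" "j \<in> J" "i \<noteq> j" for i j
  proof -
    have "\<omega> i \<noteq> \<omega> j" using inj_onD[OF \<omega>(1), of i j] ij J(1) by blast
    then show ?thesis by (auto simp: cw_def)
  qed
  have sep: "(\<forall>a\<in>\<omega> ` J. \<forall>b\<in>\<omega> ` J. s \<le> cw a b) \<longleftrightarrow> circ_sep s J \<omega>"
  proof
    assume L: "\<forall>a\<in>\<omega> ` J. \<forall>b\<in>\<omega> ` J. s \<le> cw a b"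
    show "circ_sep s J \<omega>"
      unfolding circ_sep_def
    proof (intro ballI impI)
      fix i j assume ij: "i \<in> J" "j \<in> J" "i \<noteq> j"
      then have "s \<le> cw (\<omega> i) (\<omega> j) \<and> s \<le> cw (\<omega> j) (\<omega> i)" using L by blast
      then show "s \<le> \<bar>\<omega> i - \<omega> j\<bar> \<and> \<bar>\<omega> i - \<omega> j\<bar> \<le> 1 - s" using pair[OF ij] by blast
    qed
  next
    assume R: "circ_sep s J \<omega>"
    have "s \<le> cw (\<omega> i) (\<omega> j)" if ij: "i \<in> J" "j \<in> J" for i j
    proof (cases "i = j")
      case True then show ?thesis using s by (simp add: cw_self)
    next
      case False then show ?thesis using pair[OF ij False] circ_sepD[OF R ij False] by blast
    qed
    then show "\<forall>a\<in>\<omega> ` J. \<forall>b\<in>\<omega> ` J. s \<le> cw a b" by blast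
  qed
  have "\<omega> ` {..<n} - \<omega> ` J = \<omega> ` ({..<n} - J)" using inj_on_image_set_diff[OF \<omega>(1), of "{..<n}" J] J(1) by blast
  then have "(\<forall>x\<in>\<omega> ` {..<n} - \<omega> ` J. \<exists>a\<in>\<omega> ` J. cw a x < s) \<longleftrightarrow> (\<forall>i\<in>{..<n} - J. \<exists>a\<in>J. cw (\<omega> a) (\<omega> i) < s)"
    by simp
  moreover have "\<omega> ` J \<noteq> {}" "\<omega> ` J \<subseteq> \<omega> ` {..<n}" using J by auto
  ultimately show ?thesis unfolding spread_def spread_event_def sep by blast
qed

lemma card_spreads_sample:
  assumes \<omega>: "inj_on \<omega> {..<n}" "\<And>i. i < n \<Longrightarrow> \<omega> i \<in> circle" and s: "s \<le> 1"
  shows "card (spreads s (\<omega> ` {..<n}) (Suc m)) = spread_count s n m \<omega>"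
proof -
  let ?F = "{J. J \<subseteq> {..<n} \<and> card J = Suc m \<and> spread_event s n J \<omega>}"
  have cJ: "card (\<omega> ` J) = card J" if "J \<subseteq> {..<n}" for J by (rule card_image[OF inj_on_subset[OF \<omega>(1) that]])
  have "spreads s (\<omega> ` {..<n}) (Suc m) = (`) \<omega> ` ?F"
  proof (intro equalityI subsetI)
    fix I assume "I \<in> spreads s (\<omega> ` {..<n}) (Suc m)"
    then have I: "spread s (\<omega> ` {..<n}) I" "card I = Suc m" by (simp_all add: spreads_def)
    from spreadD(2)[OF I(1)] obtain J where J: "J \<subseteq> {..<n}" "I = \<omega> ` J" by (rule subset_imageE)
    have "J \<noteq> {}" using spreadD(1)[OF I(1)] J(2) by blast
    then have "J \<in> ?F" using spread_image_iff[OF \<omega> J(1) _ s] I cJ[OF J(1)] J by auto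
    with J(2) show "I \<in> (`) \<omega> ` ?F" by (rule image_eqI)
  next
    fix I assume "I \<in> (`) \<omega> ` ?F"
    then obtain J where J: "J \<subseteq> {..<n}" "card J = Suc m" "spread_event s n J \<omega>" "I = \<omega> ` J" by blast
    then have "J \<noteq> {}" by auto
    then show "I \<in> spreads s (\<omega> ` {..<n}) (Suc m)"
      using spread_image_iff[OF \<omega> J(1) _ s] J cJ[OF J(1)] by (simp add: spreads_def)
  qed
  moreover have "inj_on ((`) \<omega>) ?F"
  proof (rule inj_onI)
    fix J J' assume "J \<in> ?F" "J' \<in> ?F" "\<omega> ` J = \<omega> ` J'"
    then show "J = J'" using inj_on_image_eq_iff[OF \<omega>(1), of J J'] by blast
  qed
  ultimately show ?thesis by (simp add: card_image spread_count_def)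
qed

lemma sample_homology:
  assumes \<omega>: "inj_on \<omega> {..<n}" "\<And>i. i < n \<Longrightarrow> \<omega> i \<in> circle" and r: "0 < r" "r < 1/2"
  shows "euler_char (cech (\<omega> ` {..<n}) r) = (\<Sum>m<n. int (spread_count (1 - 2 * r) n m \<omega>))"
    and "k \<ge> 1 \<Longrightarrow> betti TYPE('f :: field) (cech (\<omega> ` {..<n}) r) (2 * k) = spread_count (1 - 2 * r) n k \<omega> - 1"
proof -
  have X: "\<omega> ` {..<n} \<subseteq> circle" using \<omega>(2) by auto
  interpret circle_points "1 - 2 * r" "\<omega> ` {..<n}"
    using X r by unfold_locales auto
  have cX: "card (\<omega> ` {..<n}) = n" using card_image[OF \<omega>(1)] by simp
  have spr: "card (spreads (1 - 2 * r) (\<omega> ` {..<n}) (Suc m)) = spread_count (1 - 2 * r) n m \<omega>" for m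
    by (rule card_spreads_sample) (use \<omega> r in auto)
  have "(\<Sum>m<n. int (card (spreads (1 - 2 * r) (\<omega> ` {..<n}) (Suc m)))) = (\<Sum>m<n. int (spread_count (1 - 2 * r) n m \<omega>))"
    by (simp only: spr)
  then show "euler_char (cech (\<omega> ` {..<n}) r) = (\<Sum>m<n. int (spread_count (1 - 2 * r) n m \<omega>))"
    using euler_char_arc_cx unfolding cech_eq_arc_cx[OF X r] card_all_spreads cX by simp
  show "betti TYPE('f) (cech (\<omega> ` {..<n}) r) (2 * k) = spread_count (1 - 2 * r) n k \<omega> - 1" if "k \<ge> 1"
    using betti_arc_cx[OF that, where 'f='f] unfolding cech_eq_arc_cx[OF X r] spr .
qed

lemma AE_sample_homology:
  assumes r: "0 < r" "r < 1/2"
  shows "AE \<omega> in circle_sample n. real_of_int (euler_char (cech (\<omega> ` {..<n}) r)) = (\<Sum>m<n. real (spread_count (1 - 2 * r) n m \<omega>))"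
    and "k \<ge> 1 \<Longrightarrow> AE \<omega> in circle_sample n.
      real (betti TYPE('f :: field) (cech (\<omega> ` {..<n}) r) (2 * k)) = real (spread_count (1 - 2 * r) n k \<omega> - 1)"
proof -
  show "AE \<omega> in circle_sample n. real_of_int (euler_char (cech (\<omega> ` {..<n}) r)) = (\<Sum>m<n. real (spread_count (1 - 2 * r) n m \<omega>))"
    using AE_sample_inj AE_sample_circle
  proof eventually_elim
    fix \<omega> assume "inj_on \<omega> {..<n}" "\<forall>i<n. \<omega> i \<in> circle"
    then show "real_of_int (euler_char (cech (\<omega> ` {..<n}) r)) = (\<Sum>m<n. real (spread_count (1 - 2 * r) n m \<omega>))"
      using sample_homology(1)[of \<omega> n r] r by simp
  qed
  show "AE \<omega> in circle_sample n.
      real (betti TYPE('f :: field) (cech (\<omega> ` {..<n}) r) (2 * k)) = real (spread_count (1 - 2 * r) n k \<omega> - 1)" if "k \<ge> 1"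
    using AE_sample_inj AE_sample_circle
  proof eventually_elim
    fix \<omega> assume "inj_on \<omega> {..<n}" "\<forall>i<n. \<omega> i \<in> circle"
    then show "real (betti TYPE('f :: field) (cech (\<omega> ` {..<n}) r) (2 * k)) = real (spread_count (1 - 2 * r) n k \<omega> - 1)"
      using sample_homology(2)[of \<omega> n r k, where 'f='f] r that by simp
  qed
qed

lemma has_integral_spread_counts:
  assumes r: "0 < r" "r < 1/2"
  shows "has_bochner_integral (circle_sample n) (\<lambda>\<omega>. \<Sum>m\<in>S. real (spread_count (1 - 2 * r) n m \<omega>))
    (\<Sum>m\<in>S. mean_spreads n m (1 - 2 * r))"
  by (rule has_bochner_integral_sum, rule has_integral_spread_count) (use r in auto)

lemma has_integral_euler_char:
  assumes r: "0 < r" "r < 1/2"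
  shows "has_bochner_integral (circle_sample n) (\<lambda>\<omega>. real_of_int (euler_char (cech (\<omega> ` {..<n}) r)))
    (\<Sum>m<n. mean_spreads n m (1 - 2 * r))"
proof -
  note H = has_integral_spread_counts[OF r, of n "{..<n}"]
  have m: "(\<lambda>\<omega>. \<Sum>m<n. real (spread_count (1 - 2 * r) n m \<omega>)) \<in> borel_measurable (circle_sample n)"
    using H by (rule borel_measurable_has_bochner_integral)
  show ?thesis
    using H has_bochner_integral_cong_AE[OF measurable_euler_cech m AE_sample_homology(1)[OF r]] by simp
qed

lemma mean_euler_char_eq:
  assumes "0 < r" "r < 1/2"
  shows "mean_euler_char n r = (\<Sum>m<n. mean_spreads n m (1 - 2 * r))"
  unfolding mean_euler_char_def by (rule has_bochner_integral_integral_eq[OF has_integral_euler_char[OF assms]])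

text \<open>Almost surely the Betti number is the truncated difference of a spread count and 1. The
  lower bound loses at most 1 in the mean, which disappears after division by
  \<open>n\<close>.\<close>

lemma mean_betti_bounds:
  assumes r: "0 < r" "r < 1/2" and k: "k \<ge> 1" "k < n"
  shows "mean_spreads n k (1 - 2 * r) - 1 \<le> mean_betti TYPE('f :: field) (2 * k) n r"
    and "mean_betti TYPE('f) (2 * k) n r \<le> mean_euler_char n r"
proof -
  let ?b = "\<lambda>\<omega>. real (betti TYPE('f) (cech (\<omega> ` {..<n}) r) (2 * k))"
  let ?c = "\<lambda>\<omega>. real (spread_count (1 - 2 * r) n k \<omega>)"
  interpret M: prob_space "circle_sample n" unfolding circle_sample_def by (intro prob_space_PiM prob_space_unif)
  have s: "0 < 1 - 2 * r" "1 - 2 * r \<le> 1" using r by auto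
  note C = has_integral_spread_count[OF s, of n k]
  have ae: "AE \<omega> in circle_sample n. ?b \<omega> = real (spread_count (1 - 2 * r) n k \<omega> - 1)"
    by (rule AE_sample_homology(2)[OF r k(1)])
  have mb: "?b \<in> borel_measurable (circle_sample n)" by (rule measurable_betti_cech) (use k in simp)
  have intc: "integrable (circle_sample n) ?c" using C by (rule integrable.intros)
  have intb: "integrable (circle_sample n) ?b"
  proof (rule Bochner_Integration.integrable_bound[OF intc mb])
    show "AE \<omega> in circle_sample n. norm (?b \<omega>) \<le> norm (?c \<omega>)" using ae by eventually_elim simp
  qed
  have "integral\<^sup>L (circle_sample n) (\<lambda>\<omega>. ?c \<omega> - 1) \<le> integral\<^sup>L (circle_sample n) ?b"
  proof (rule integral_mono_AE)
    show "integrable (circle_sample n) (\<lambda>\<omega>. ?c \<omega> - 1)" using intc by simp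
    show "AE \<omega> in circle_sample n. ?c \<omega> - 1 \<le> ?b \<omega>" using ae by eventually_elim linarith
  qed (rule intb)
  moreover have "integral\<^sup>L (circle_sample n) (\<lambda>\<omega>. ?c \<omega> - 1) = mean_spreads n k (1 - 2 * r) - 1"
    using intc has_bochner_integral_integral_eq[OF C] by (simp add: M.prob_space)
  ultimately show "mean_spreads n k (1 - 2 * r) - 1 \<le> mean_betti TYPE('f) (2 * k) n r"
    by (simp add: mean_betti_def)
  note H = has_integral_euler_char[OF r, of n]
  show "mean_betti TYPE('f) (2 * k) n r \<le> mean_euler_char n r"
    unfolding mean_betti_def mean_euler_char_def
  proof (rule integral_mono_AE[OF intb])
    show "integrable (circle_sample n) (\<lambda>\<omega>. real_of_int (euler_char (cech (\<omega> ` {..<n}) r)))"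
      using H by (rule integrable.intros)
    show "AE \<omega> in circle_sample n. ?b \<omega> \<le> real_of_int (euler_char (cech (\<omega> ` {..<n}) r))"
      using ae AE_sample_homology(1)[OF r]
    proof eventually_elim
      fix \<omega> :: "nat \<Rightarrow> real"
      assume b: "?b \<omega> = real (spread_count (1 - 2 * r) n k \<omega> - 1)"
        and e: "real_of_int (euler_char (cech (\<omega> ` {..<n}) r)) = (\<Sum>m<n. real (spread_count (1 - 2 * r) n m \<omega>))"
      have "?c \<omega> \<le> (\<Sum>m<n. real (spread_count (1 - 2 * r) n m \<omega>))"
        by (rule member_le_sum) (use k in auto)
      then show "?b \<omega> \<le> real_of_int (euler_char (cech (\<omega> ` {..<n}) r))" using b e by linarith
    qed
  qed
qed

section \<open>Closed formula, continuity and polynomial pieces\<close>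

lemma mean_spreads_nonneg: "0 \<le> s \<Longrightarrow> 0 \<le> mean_spreads n m s"
  unfolding mean_spreads_def by simp

lemma mean_euler_char_formula:
  assumes n: "n > 0" and r: "0 < r" "r < 1"
  shows "mean_euler_char n ((1 - r) / 2) =
    (\<Sum>k = 1..nat \<lfloor>1 / r\<rfloor>. real (n choose k) * (1 - real k * r) ^ (k - 1) * (real k * r) ^ (n - k))"
proof -
  let ?N = "nat \<lfloor>1 / r\<rfloor>"
  let ?f = "\<lambda>k. real (n choose k) * (max 0 (1 - real k * r) ^ (k - 1) * (real k * r) ^ (n - k))"
  have le: "k \<le> ?N \<longleftrightarrow> real k * r \<le> 1" for k :: nat
  proof -
    have "k \<le> ?N \<longleftrightarrow> real k \<le> 1 / r" using r le_nat_iff[of "\<lfloor>1 / r\<rfloor>" k] le_floor_iff[of "int k" "1 / r"] by simp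
    then show ?thesis using r by (simp add: field_simps)
  qed
  have "mean_euler_char n ((1 - r) / 2) = (\<Sum>m<n. mean_spreads n m (1 - 2 * ((1 - r) / 2)))"
    by (rule mean_euler_char_eq) (use r in auto)
  also have "1 - 2 * ((1 - r) / 2) = r" by (simp add: field_simps)
  also have "(\<Sum>m<n. mean_spreads n m r) = (\<Sum>k=1..n. ?f k)"
    by (rule sum.reindex_bij_witness[of _ "\<lambda>k. k - 1" Suc]) (auto simp: mean_spreads_def)
  \<comment> \<open>Passes through a common range: terms beyond \<open>n\<close> vanish by the
    binomial coefficient, terms beyond \<open>?N\<close> by the truncation.\<close>
  also have "\<dots> = (\<Sum>k=1..max n ?N. ?f k)"
    by (rule sum.mono_neutral_left) auto
  also have "\<dots> = (\<Sum>k=1..?N. ?f k)"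
  proof (rule sum.mono_neutral_right)
    show "\<forall>k\<in>{1..max n ?N} - {1..?N}. ?f k = 0"
    proof
      fix k assume "k \<in> {1..max n ?N} - {1..?N}"
      then have k: "1 < real k * r" "1 \<le> k" using le[of k] by auto
      \<comment> \<open>The exponent \<open>k - 1\<close> is thus positive, and the truncated base 0
        gives 0.\<close>
      then have "k \<noteq> 1" using r by auto
      then show "?f k = 0" using k by (simp add: max_def)
    qed
  qed auto
  also have "\<dots> = (\<Sum>k=1..?N. real (n choose k) * (1 - real k * r) ^ (k - 1) * (real k * r) ^ (n - k))"
    by (rule sum.cong) (use le in \<open>auto simp: max_def\<close>)
  finally show ?thesis .
qed

lemma continuous_on_mean_euler_char: "continuous_on {0<..<1/2} (mean_euler_char n)"
proof -
  have "continuous_on {0<..<1/2} (\<lambda>r. \<Sum>m<n. mean_spreads n m (1 - 2 * r))"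
    unfolding mean_spreads_def by (intro continuous_intros)
  then show ?thesis by (rule continuous_on_eq) (simp add: mean_euler_char_eq)
qed

lemma piecewise_polynomial_mean_euler_char:
  assumes n: "n > 0"
  shows "piecewise_polynomial_on 0 (1/2) (mean_euler_char n)"
proof -
  \<comment> \<open>The radii at which \<open>s = 1 - 2 * r\<close> equals
    \<open>1 / (i + 1)\<close>. There the term with index \<open>i\<close> in
    \<open>mean_spreads\<close> is truncated or released; after the first \<open>n\<close> of them
    the last piece extends to 1/2.\<close>
  define t :: "nat \<Rightarrow> real" where "t i = (if i < n then (1 - 1 / (real i + 1)) / 2 else 1/2)" for i
  \<comment> \<open>\<open>1 - (m + 1) * s\<close> and \<open>(m + 1) * s\<close> as linear
    polynomials in the radius.\<close>
  define P :: "nat \<Rightarrow> real poly" where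
    "P i = (\<Sum>m\<le>i. smult (real (n choose Suc m)) ([:1 - real (Suc m), 2 * real (Suc m):] ^ m * [:real (Suc m), - 2 * real (Suc m):] ^ (n - Suc m)))" for i
  have "mean_euler_char n x = poly (P i) x" if i: "i < n" and x: "x \<in> {t i..t (Suc i)} \<inter> {0<..<1/2}" for i x
  proof -
    let ?s = "1 - 2 * x"
    have s1: "real (Suc i) * ?s \<le> 1"
    proof -
      have "?s \<le> 1 / (real i + 1)" using x i by (simp add: t_def)
      then show ?thesis by (simp add: field_simps)
    qed
    have s2: "1 \<le> (real i + 2) * ?s" if "Suc i < n"
    proof -
      have "1 / (real i + 2) \<le> ?s" using x that by (simp add: t_def add.commute)
      then show ?thesis by (simp add: field_simps)
    qed
    have s0: "0 \<le> ?s" using x by simp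
    have low: "mean_spreads n m ?s = poly (smult (real (n choose Suc m)) ([:1 - real (Suc m), 2 * real (Suc m):] ^ m * [:real (Suc m), - 2 * real (Suc m):] ^ (n - Suc m))) x"
      if "m \<le> i" for m
    proof -
      have "real (Suc m) * ?s \<le> real (Suc i) * ?s" using that s0 by (intro mult_right_mono) auto
      then have "max 0 (1 - real (Suc m) * ?s) = 1 - real (Suc m) * ?s" using s1 by linarith
      also have "\<dots> = poly [:1 - real (Suc m), 2 * real (Suc m):] x" by (simp add: algebra_simps)
      finally have 1: "max 0 (1 - real (Suc m) * ?s) = poly [:1 - real (Suc m), 2 * real (Suc m):] x" .
      have 2: "real (Suc m) * ?s = poly [:real (Suc m), - 2 * real (Suc m):] x" by (simp add: algebra_simps)
      show ?thesis unfolding mean_spreads_def 1 by (simp only: 2 poly_smult poly_mult poly_power)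
    qed
    have high: "mean_spreads n m ?s = 0" if m: "m \<in> {..<n} - {..i}" for m
    proof -
      have "Suc i < n" "i + 2 \<le> Suc m" using m by auto
      then have "(real i + 2) * ?s \<le> real (Suc m) * ?s" using s0 by (intro mult_right_mono) auto
      then have "max 0 (1 - real (Suc m) * ?s) = 0" using s2[OF \<open>Suc i < n\<close>] by linarith
      moreover have "m \<noteq> 0" using m by auto
      ultimately show ?thesis unfolding mean_spreads_def by (simp del: of_nat_Suc)
    qed
    have "mean_euler_char n x = (\<Sum>m<n. mean_spreads n m ?s)" by (rule mean_euler_char_eq) (use x in auto)
    also have "\<dots> = (\<Sum>m\<le>i. mean_spreads n m ?s)"
      using i high by (intro sum.mono_neutral_right) auto
    also have "\<dots> = poly (P i) x" unfolding P_def poly_sum using low by (intro sum.cong) auto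
    finally show ?thesis .
  qed
  moreover have "t i < t (Suc i)" if "i < n" for i
  proof -
    have "1 / (real i + 2) < 1 / (real i + 1)" by (intro divide_strict_left_mono) auto
    then show ?thesis using that by (auto simp: t_def add.commute)
  qed
  moreover have "t 0 = 0" "t n = 1/2" using n by (simp_all add: t_def)
  ultimately show ?thesis unfolding piecewise_polynomial_on_def by (intro exI[of _ n] exI[of _ t]) blast
qed

section \<open>Asymptotics\<close>

lemma binomial_power_limit: "(\<lambda>n. real (n choose k) / real n ^ k) \<longlonglongrightarrow> 1 / fact k"
proof (induction k)
  case (Suc k)
  have "(\<lambda>n. (real n - real k) / real n) \<longlonglongrightarrow> 1" by real_asymp
  then have "(\<lambda>n. real (n choose k) / real n ^ k * ((real n - real k) / real n / real (Suc k))) \<longlonglongrightarrow> 1 / fact k * (1 / real (Suc k))"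
    by (intro tendsto_mult Suc.IH tendsto_divide tendsto_const) simp_all
  moreover have "\<forall>\<^sub>F n in sequentially. real (n choose k) / real n ^ k * ((real n - real k) / real n / real (Suc k))
    = real (n choose Suc k) / real n ^ Suc k"
    using eventually_gt_at_top[of k]
  proof eventually_elim
    fix n :: nat assume n: "k < n"
    have "Suc k * (n choose Suc k) = (n - k) * (n choose k)"
      using binomial_absorption[of k n] binomial_absorb_comp[of n k] by simp
    then have "real (Suc k) * real (n choose Suc k) = (real n - real k) * real (n choose k)"
      using n by (metis of_nat_mult of_nat_diff less_imp_le)
    then have "real (n choose Suc k) = (real n - real k) * real (n choose k) / real (Suc k)"
      by (simp add: field_simps del: of_nat_Suc)
    then show "real (n choose k) / real n ^ k * ((real n - real k) / real n / real (Suc k)) = real (n choose Suc k) / real n ^ Suc k"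
      by (simp add: ac_simps)
  qed
  ultimately have "(\<lambda>n. real (n choose Suc k) / real n ^ Suc k) \<longlonglongrightarrow> 1 / fact k * (1 / real (Suc k))"
    by (rule Lim_transform_eventually)
  then show ?case by (simp add: mult.commute)
qed simp

lemma power_times_geometric_limit:
  fixes q :: real
  assumes "0 < q" "q < 1"
  shows "(\<lambda>n. real n ^ j * q ^ n) \<longlonglongrightarrow> 0"
  using assms by real_asymp

text \<open>Bounds the share of spread sets with at most \<open>k\<close> points for s <= 1 / (k +
  1): their arcs cover at most \<open>k / (k + 1)\<close> of the circle, and the probability of
  containing all other points decays geometrically.\<close>

definition lower_error :: "nat \<Rightarrow> nat \<Rightarrow> real" where
  "lower_error k n = (\<Sum>m<k. real (n choose Suc m) * (real k / (real k + 1)) ^ (n - Suc m) / real n)"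

lemma lower_error_limit: "lower_error k \<longlonglongrightarrow> 0"
  unfolding lower_error_def
proof (rule tendsto_null_sum)
  fix m assume m: "m \<in> {..<k}"
  let ?q = "real k / (real k + 1)"
  have q: "0 < ?q" "?q < 1" using m by auto
  have "(\<lambda>n. real n ^ Suc m * ?q ^ n * (1 / ?q ^ Suc m)) \<longlonglongrightarrow> 0 * (1 / ?q ^ Suc m)"
    by (intro tendsto_mult power_times_geometric_limit q tendsto_const)
  then have lim: "(\<lambda>n. real n ^ Suc m * ?q ^ n * (1 / ?q ^ Suc m)) \<longlonglongrightarrow> 0" by (simp only: mult_zero_left)
  show "(\<lambda>n. real (n choose Suc m) * ?q ^ (n - Suc m) / real n) \<longlonglongrightarrow> 0"
  proof (rule tendsto_sandwich[OF _ _ tendsto_const lim])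
    show "\<forall>\<^sub>F n in sequentially. 0 \<le> real (n choose Suc m) * ?q ^ (n - Suc m) / real n" using q by simp
    show "\<forall>\<^sub>F n in sequentially. real (n choose Suc m) * ?q ^ (n - Suc m) / real n \<le> real n ^ Suc m * ?q ^ n * (1 / ?q ^ Suc m)"
      using eventually_gt_at_top[of m]
    proof eventually_elim
      fix n :: nat assume n: "m < n"
      have qne: "?q \<noteq> 0" using q by linarith
      have c: "real (n choose Suc m) \<le> real n ^ Suc m"
        using n binomial_le_pow[of "Suc m" n] by (metis Suc_leI of_nat_le_iff of_nat_power)
      have p: "?q ^ (n - Suc m) = ?q ^ n * (1 / ?q ^ Suc m)"
        by (simp only: power_diff[OF qne Suc_leI[OF n]] times_divide_eq_right mult_1_right)
      have "real (n choose Suc m) * ?q ^ (n - Suc m) / real n \<le> real (n choose Suc m) * ?q ^ (n - Suc m) / 1"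
        using n q by (intro divide_left_mono) auto
      also have "\<dots> \<le> real n ^ Suc m * ?q ^ (n - Suc m)" 
        using c q by (simp only: div_by_1) (intro mult_right_mono, auto)
      finally show "real (n choose Suc m) * ?q ^ (n - Suc m) / real n \<le> real n ^ Suc m * ?q ^ n * (1 / ?q ^ Suc m)"
        by (simp only: p mult.assoc)
    qed
  qed
qed

text \<open>Replace \<open>1 - y\<close> by \<open>exp (- y)\<close> and maximise:
  \<open>y ^ k * exp (- y * N)\<close> is largest at y = k / N. This is where \<open>e\<close>
  enters the limit.\<close>

lemma power_mult_power_le:
  fixes y :: real
  assumes y: "0 \<le> y" "y \<le> 1" and N: "N > 0"
  shows "y ^ k * (1 - y) ^ N \<le> (real k / (exp 1 * real N)) ^ k"
proof (cases "k = 0")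
  case True
  then show ?thesis using y by (simp add: power_le_one)
next
  case False
  \<comment> \<open>Rescaled so that the maximiser is t = 1 and the claim becomes
    \<open>t * exp (- t) \<le> 1 / exp 1\<close>.\<close>
  define t where "t = y * real N / real k"
  have "t \<le> exp (t - 1)" using exp_ge_add_one_self[of "t - 1"] by simp
  then have "t * exp (- t) \<le> exp (t - 1) * exp (- t)" by (intro mult_right_mono) auto
  also have "\<dots> = 1 / exp 1" by (simp add: exp_diff exp_minus)
  finally have "t * exp (- t) * (real k / real N) \<le> 1 / exp 1 * (real k / real N)" by (intro mult_right_mono) auto
  then have 1: "y * exp (- t) \<le> real k / (exp 1 * real N)" using False N by (simp add: t_def)
  have "(1 - y) ^ N \<le> exp (- y) ^ N" using y exp_ge_add_one_self[of "- y"] by (intro power_mono) auto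
  also have "\<dots> = exp (- t) ^ k" using False by (simp add: t_def flip: exp_of_nat_mult)
  finally have "y ^ k * (1 - y) ^ N \<le> y ^ k * exp (- t) ^ k" using y by (intro mult_left_mono) auto
  also have "\<dots> = (y * exp (- t)) ^ k" by (simp add: power_mult_distrib)
  also have "\<dots> \<le> (real k / (exp 1 * real N)) ^ k" using 1 y by (intro power_mono) auto
  finally show ?thesis .
qed

lemma upper_bound_limit:
  "(\<lambda>n. real (n choose Suc k) / real n ^ Suc k * (real n / real (n - Suc k) * (real k / exp 1)) ^ k)
    \<longlonglongrightarrow> (real k / exp 1) ^ k / fact (k + 1)"
proof -
  have "(\<lambda>n. real n / (real n - real (Suc k))) \<longlonglongrightarrow> 1" by real_asymp
  moreover have "\<forall>\<^sub>F n in sequentially. real n / (real n - real (Suc k)) = real n / real (n - Suc k)"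
    using eventually_gt_at_top[of "Suc k"] by eventually_elim (simp add: of_nat_diff)
  ultimately have "(\<lambda>n. real n / real (n - Suc k)) \<longlonglongrightarrow> 1" by (rule Lim_transform_eventually)
  then have "(\<lambda>n. real (n choose Suc k) / real n ^ Suc k * (real n / real (n - Suc k) * (real k / exp 1)) ^ k)
    \<longlonglongrightarrow> 1 / fact (Suc k) * (1 * (real k / exp 1)) ^ k"
    by (intro tendsto_mult binomial_power_limit tendsto_power tendsto_const)
  then show ?thesis by simp
qed

text \<open>Evaluation at \<open>y = (k + 1 / n) / n\<close>, close to the maximiser k / n. The
  extra \<open>1 / n\<close> keeps \<open>y\<close> positive also for k = 0, where the maximiser
  corresponds to the excluded left end point of the interval of radii.\<close>

lemma lower_bound_limit:
  "(\<lambda>n. real (n choose Suc k) / real n ^ Suc k * ((real k + 1 / real n) ^ k * (1 - (real k + 1 / real n) / real n) ^ n))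
    \<longlonglongrightarrow> (real k / exp 1) ^ k / fact (k + 1)"
proof -
  have "(\<lambda>n. real k + 1 / real n) \<longlonglongrightarrow> real k" by real_asymp
  moreover have "(\<lambda>n. (1 - (real k + 1 / real n) / real n) ^ n) \<longlonglongrightarrow> exp (- real k)"
  proof (cases "k = 0")
    case True
    then show ?thesis by simp real_asymp
  next
    case False
    then have "real k > 0" by simp
    then show ?thesis by real_asymp
  qed
  ultimately have "(\<lambda>n. real (n choose Suc k) / real n ^ Suc k * ((real k + 1 / real n) ^ k * (1 - (real k + 1 / real n) / real n) ^ n))
    \<longlonglongrightarrow> 1 / fact (Suc k) * (real k ^ k * exp (- real k))"
    by (intro tendsto_mult binomial_power_limit tendsto_power)
  moreover have "exp (- real k) = 1 / exp 1 ^ k" by (simp add: exp_minus field_simps flip: exp_of_nat_mult)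
  ultimately show ?thesis by (simp add: power_divide ac_simps)
qed

lemma mean_spreads_eq_0:
  assumes "1 / (real k + 2) < s" "k < m"
  shows "mean_spreads n m s = 0"
proof -
  have "1 < (real k + 2) * s" using assms(1) by (simp add: field_simps)
  also have "\<dots> \<le> real (Suc m) * s" using assms less_trans[of 0 "1 / (real k + 2)" s] by (intro mult_right_mono) auto
  finally have "max 0 (1 - real (Suc m) * s) = 0" by linarith
  then show ?thesis using assms(2) by (simp add: mean_spreads_def del: of_nat_Suc)
qed

lemma mean_spreads_le:
  assumes "0 \<le> s" "s \<le> 1 / (real k + 1)" "m < k"
  shows "mean_spreads n m s \<le> real (n choose Suc m) * (real k / (real k + 1)) ^ (n - Suc m)"
proof -
  have "real (Suc m) * s \<le> real k * (1 / (real k + 1))" using assms by (intro mult_mono) auto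
  then have "(real (Suc m) * s) ^ (n - Suc m) \<le> (real k / (real k + 1)) ^ (n - Suc m)"
    using assms by (intro power_mono) auto
  moreover have "max 0 (1 - real (Suc m) * s) ^ m \<le> 1"
    using mult_nonneg_nonneg[of "real (Suc m)" s] assms by (intro power_le_one) (auto simp del: of_nat_Suc)
  ultimately have "max 0 (1 - real (Suc m) * s) ^ m * (real (Suc m) * s) ^ (n - Suc m) \<le> 1 * (real k / (real k + 1)) ^ (n - Suc m)"
    using assms by (intro mult_mono) auto
  then show ?thesis unfolding mean_spreads_def by (intro mult_left_mono) auto
qed

text \<open>Only the spread sets with \<open>k + 1\<close> points contribute at linear order in \<open>n\<close>.\<close>

lemma mean_euler_char_main_term:
  assumes r: "0 < r" "real k / (2 * real k + 2) \<le> r" "r < (real k + 1) / (2 * real k + 4)" and n: "k < n"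
  shows "mean_spreads n k (1 - 2 * r) \<le> mean_euler_char n r"
    and "mean_euler_char n r / real n \<le> mean_spreads n k (1 - 2 * r) / real n + lower_error k n"
    and "r < 1/2"
proof -
  let ?E = "\<lambda>m. mean_spreads n m (1 - 2 * r)"
  have s1: "1 / (real k + 2) < 1 - 2 * r"
  proof -
    have "2 * r < 2 * ((real k + 1) / (2 * real k + 4))" by (rule mult_strict_left_mono[OF r(3)]) simp
    also have "\<dots> = 1 - 1 / (real k + 2)" by (simp add: field_simps)
    finally show ?thesis by simp
  qed
  have s2: "1 - 2 * r \<le> 1 / (real k + 1)"
  proof -
    have "1 - 1 / (real k + 1) = 2 * (real k / (2 * real k + 2))" by (simp add: field_simps)
    also have "\<dots> \<le> 2 * r" by (rule mult_left_mono[OF r(2)]) simp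
    finally show ?thesis by simp
  qed
  have s0: "0 < 1 - 2 * r" by (rule less_trans[OF _ s1]) simp
  then show r2: "r < 1/2" by simp
  have "mean_euler_char n r = (\<Sum>m<n. ?E m)" by (rule mean_euler_char_eq[OF r(1) r2])
  also have "\<dots> = (\<Sum>m<Suc k. ?E m)"
    by (rule sum.mono_neutral_right) (use n mean_spreads_eq_0[OF s1] in auto)
  finally have eq: "mean_euler_char n r = ?E k + (\<Sum>m<k. ?E m)" by simp
  have "0 \<le> (\<Sum>m<k. ?E m)" by (intro sum_nonneg mean_spreads_nonneg) (use s0 in simp)
  then show "?E k \<le> mean_euler_char n r" using eq by simp
  have "(\<Sum>m<k. ?E m) \<le> (\<Sum>m<k. real (n choose Suc m) * (real k / (real k + 1)) ^ (n - Suc m))"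
    using s0 s2 by (intro sum_mono mean_spreads_le) auto
  then have "(\<Sum>m<k. ?E m) / real n \<le> lower_error k n"
    unfolding lower_error_def sum_divide_distrib[symmetric] by (rule divide_right_mono) simp
  then show "mean_euler_char n r / real n \<le> ?E k / real n + lower_error k n"
    unfolding eq by (simp add: add_divide_distrib)
qed

lemma mean_spreads_upper:
  assumes s: "0 \<le> s" "real (Suc k) * s \<le> 1" and n: "Suc k < n"
  shows "mean_spreads n k s / real n
    \<le> real (n choose Suc k) / real n ^ Suc k * (real n / real (n - Suc k) * (real k / exp 1)) ^ k"
proof -
  define y where "y = 1 - real (Suc k) * s"
  have y: "0 \<le> y" "y \<le> 1" using s mult_nonneg_nonneg[of "real (Suc k)" s] by (auto simp: y_def simp del: of_nat_Suc)
  have e: "real (Suc k) * s = 1 - y" by (simp add: y_def)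
  have "mean_spreads n k s = real (n choose Suc k) * (y ^ k * (1 - y) ^ (n - Suc k))"
    unfolding mean_spreads_def e using y by simp
  also have "\<dots> \<le> real (n choose Suc k) * (real k / (exp 1 * real (n - Suc k))) ^ k"
    using n by (intro mult_left_mono power_mult_power_le[OF y]) auto
  finally have "mean_spreads n k s / real n \<le> real (n choose Suc k) * (real k / (exp 1 * real (n - Suc k))) ^ k / real n"
    by (rule divide_right_mono) simp
  also have "\<dots> = real (n choose Suc k) / real n ^ Suc k * (real n ^ k * (real k / (exp 1 * real (n - Suc k))) ^ k)"
    using n by simp
  also have "real n ^ k * (real k / (exp 1 * real (n - Suc k))) ^ k = (real n / real (n - Suc k) * (real k / exp 1)) ^ k"
    unfolding power_mult_distrib[symmetric] by (simp add: mult.commute)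
  finally show ?thesis .
qed

lemma mean_spreads_lower:
  assumes n: "0 < n" and y: "y = (real k + 1 / real n) / real n" "y < 1"
  shows "real (n choose Suc k) / real n ^ Suc k * ((real k + 1 / real n) ^ k * (1 - (real k + 1 / real n) / real n) ^ n)
    \<le> mean_spreads n k ((1 - y) / (real k + 1)) / real n"
proof -
  have y0: "0 < y" using n by (auto simp: y intro!: divide_pos_pos add_nonneg_pos)
  have e: "real (Suc k) * ((1 - y) / (real k + 1)) = 1 - y" by (simp add: add.commute)
  have p: "(real k + 1 / real n) ^ k = real n ^ k * y ^ k"
    unfolding power_mult_distrib[symmetric] y(1) using n by simp
  have "real (n choose Suc k) / real n ^ Suc k * ((real k + 1 / real n) ^ k * (1 - (real k + 1 / real n) / real n) ^ n)
    = real (n choose Suc k) / real n * (y ^ k * (1 - y) ^ n)"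
    unfolding p y(1)[symmetric] using n by simp
  also have "\<dots> \<le> real (n choose Suc k) / real n * (y ^ k * (1 - y) ^ (n - Suc k))"
    using y0 y(2) by (intro mult_left_mono power_decreasing) auto
  also have "\<dots> = mean_spreads n k ((1 - y) / (real k + 1)) / real n"
    unfolding mean_spreads_def e using y0 by simp
  finally show ?thesis .
qed

text \<open>The upper bound is uniform over the interval; the lower one is the value at a single
  radius that depends on \<open>n\<close> and tends to the left end point.\<close>

lemma mean_euler_char_sup_limit:
  "(\<lambda>n. SUP r\<in>{real k / (2 * real k + 2)<..<(real k + 1) / (2 * real k + 4)}. mean_euler_char n r / real n)
    \<longlonglongrightarrow> (real k / exp 1) ^ k / fact (k + 1)"
proof -
  let ?I = "{real k / (2 * real k + 2)<..<(real k + 1) / (2 * real k + 4)}"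
  let ?U = "\<lambda>n. real (n choose Suc k) / real n ^ Suc k * (real n / real (n - Suc k) * (real k / exp 1)) ^ k + lower_error k n"
  let ?L = "\<lambda>n. real (n choose Suc k) / real n ^ Suc k * ((real k + 1 / real n) ^ k * (1 - (real k + 1 / real n) / real n) ^ n)"
  have upper: "mean_euler_char n r / real n \<le> ?U n" if n: "Suc k < n" and r: "r \<in> ?I" for n r
  proof -
    have r1: "real k / (2 * real k + 2) < r" using r by (simp only: greaterThanLessThan_iff)
    have "0 \<le> real k / (2 * real k + 2)" by simp
    from this r1 have r0: "0 < r" by (rule le_less_trans)
    have "1 - 2 * r \<le> 1 - 2 * (real k / (2 * real k + 2))" using r1 by linarith
    also have "\<dots> = 1 / (real k + 1)" by (simp add: field_simps)
    finally have "real (Suc k) * (1 - 2 * r) \<le> real (Suc k) * (1 / (real k + 1))" by (intro mult_left_mono) auto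
    then have s: "real (Suc k) * (1 - 2 * r) \<le> 1" by (simp add: add.commute)
    have "mean_euler_char n r / real n \<le> mean_spreads n k (1 - 2 * r) / real n + lower_error k n" and "r < 1/2"
      using mean_euler_char_main_term[OF r0, of k n] r n by auto
    then show ?thesis using mean_spreads_upper[OF _ s n] by auto
  qed
  have ne: "?I \<noteq> {}" by (simp add: field_simps)
  show ?thesis
  proof (rule tendsto_sandwich)
    show "?L \<longlonglongrightarrow> (real k / exp 1) ^ k / fact (k + 1)" by (rule lower_bound_limit)
    show "?U \<longlonglongrightarrow> (real k / exp 1) ^ k / fact (k + 1)"
      using tendsto_add[OF upper_bound_limit lower_error_limit] by simp
    show "\<forall>\<^sub>F n in sequentially. (SUP r\<in>?I. mean_euler_char n r / real n) \<le> ?U n"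
      using eventually_gt_at_top[of "Suc k"]
    proof eventually_elim
      fix n assume "Suc k < n"
      from upper[OF this] show "(SUP r\<in>?I. mean_euler_char n r / real n) \<le> ?U n" by (rule cSUP_least[OF ne])
    qed
    \<comment> \<open>Once \<open>(k + 2) * y < 1\<close>, the value
      \<open>s = (1 - y) / (k + 1)\<close> exceeds \<open>1 / (k + 2)\<close>, which puts the test
      radius inside the interval.\<close>
    have "(\<lambda>n. (real k + 1 / real n) / real n) \<longlonglongrightarrow> 0" by real_asymp
    then have "\<forall>\<^sub>F n in sequentially. (real k + 1 / real n) / real n < 1 / (real k + 2)"
      by (rule order_tendstoD) simp
    then show "\<forall>\<^sub>F n in sequentially. ?L n \<le> (SUP r\<in>?I. mean_euler_char n r / real n)"
      using eventually_gt_at_top[of "Suc k"]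
    proof eventually_elim
      fix n assume a: "(real k + 1 / real n) / real n < 1 / (real k + 2)" and n: "Suc k < n"
      define y where "y = (real k + 1 / real n) / real n"
      define r where "r = (1 - (1 - y) / (real k + 1)) / 2"
      have y0: "0 < y" using n by (auto simp: y_def intro!: divide_pos_pos add_nonneg_pos)
      have "1 / (real k + 2) < 1" by simp
      then have y1: "y < 1" "(real k + 2) * y < 1" using a unfolding y_def[symmetric] by (linarith, simp add: field_simps)
      have r1: "real k / (2 * real k + 2) < r"
      proof -
        have "real k / (2 * real k + 2) = (1 - 1 / (real k + 1)) / 2" by (simp add: field_simps)
        moreover have "(1 - y) / (real k + 1) < 1 / (real k + 1)" using y0 by (intro divide_strict_right_mono) auto
        ultimately show ?thesis unfolding r_def by simp
      qed
      have r2: "r < (real k + 1) / (2 * real k + 4)"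
      proof -
        have "(real k + 1) / (2 * real k + 4) = (1 - 1 / (real k + 2)) / 2" by (simp add: field_simps)
        moreover have "1 / (real k + 2) < (1 - y) / (real k + 1)" using y1(2) by (simp add: field_simps)
        ultimately show ?thesis unfolding r_def by simp
      qed
      have rI: "r \<in> ?I" using r1 r2 by simp
      have "0 \<le> real k / (2 * real k + 2)" by simp
      from this r1 have r0: "0 < r" by (rule le_less_trans)
      have "1 - 2 * ((1 - q) / 2) = q" for q :: real by (simp add: field_simps)
      then have "1 - 2 * r = (1 - y) / (real k + 1)" unfolding r_def .
      then have "?L n \<le> mean_spreads n k (1 - 2 * r) / real n"
        using mean_spreads_lower[OF _ y_def y1(1)] n by simp
      also have "\<dots> \<le> mean_euler_char n r / real n"
        using mean_euler_char_main_term(1)[OF r0, of k n] r1 r2 n by (intro divide_right_mono) auto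
      \<comment> \<open>The uniform upper bound also supplies the boundedness without which a real
        supremum is not an upper bound.\<close>
      also have "\<dots> \<le> (SUP r\<in>?I. mean_euler_char n r / real n)"
        using upper[OF n] by (intro cSUP_upper[OF rI] bdd_aboveI2)
      finally show "?L n \<le> (SUP r\<in>?I. mean_euler_char n r / real n)" .
    qed
  qed
qed

text \<open>The total error \<open>lower_error k n + 1 / n\<close> does not involve the radius, so
  the bounds hold simultaneously.\<close>

lemma mean_betti_asymptotics:
  assumes k: "k \<ge> 1" and \<epsilon>: "\<epsilon> > 0"
  shows "\<forall>\<^sub>F n in sequentially. \<forall>r\<in>{real k / (2 * real k + 2)..<(real k + 1) / (2 * real k + 4)}.
    mean_euler_char n r / real n - \<epsilon> \<le> mean_betti TYPE('f::field) (2 * k) n r / real n \<and>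
    mean_betti TYPE('f) (2 * k) n r / real n \<le> mean_euler_char n r / real n"
proof -
  have "(\<lambda>n. 1 / real n) \<longlonglongrightarrow> 0" by real_asymp
  from tendsto_add[OF lower_error_limit[of k] this] have "(\<lambda>n. lower_error k n + 1 / real n) \<longlonglongrightarrow> 0" by simp
  then have "\<forall>\<^sub>F n in sequentially. lower_error k n + 1 / real n < \<epsilon>" using \<epsilon> by (rule order_tendstoD)
  then show ?thesis using eventually_gt_at_top[of k]
  proof eventually_elim
    fix n assume e: "lower_error k n + 1 / real n < \<epsilon>" and n: "k < n"
    show "\<forall>r\<in>{real k / (2 * real k + 2)..<(real k + 1) / (2 * real k + 4)}.
      mean_euler_char n r / real n - \<epsilon> \<le> mean_betti TYPE('f) (2 * k) n r / real n \<and>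
      mean_betti TYPE('f) (2 * k) n r / real n \<le> mean_euler_char n r / real n"
    proof
      fix r assume "r \<in> {real k / (2 * real k + 2)..<(real k + 1) / (2 * real k + 4)}"
      then have r: "real k / (2 * real k + 2) \<le> r" "r < (real k + 1) / (2 * real k + 4)" by auto
      \<comment> \<open>For k >= 1 the closed left end point is still a positive radius.\<close>
      have "0 < real k / (2 * real k + 2)" using k by simp
      from this r(1) have r0: "0 < r" by (rule less_le_trans)
      note M = mean_euler_char_main_term[OF r0 r n]
      note B = mean_betti_bounds[OF r0 M(3) k n, where 'f='f]
      have "mean_spreads n k (1 - 2 * r) / real n - 1 / real n \<le> mean_betti TYPE('f) (2 * k) n r / real n"
        using divide_right_mono[OF B(1), of "real n"] by (simp add: diff_divide_distrib)
      then show "mean_euler_char n r / real n - \<epsilon> \<le> mean_betti TYPE('f) (2 * k) n r / real n \<and>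
        mean_betti TYPE('f) (2 * k) n r / real n \<le> mean_euler_char n r / real n"
        using M(2) e divide_right_mono[OF B(2), of "real n"] by simp
    qed
  qed
qed

theorem theoremA:
  shows
    "(\<forall>n::nat. n > 0 \<longrightarrow>
        (\<forall>r::real. 0 < r \<and> r < 1 \<longrightarrow>
           mean_euler_char n ((1 - r) / 2) =
             (\<Sum>k = 1..nat \<lfloor>1 / r\<rfloor>.
                real (n choose k) * (1 - real k * r) ^ (k - 1) * (real k * r) ^ (n - k))) \<and>
        continuous_on {0<..<1/2} (mean_euler_char n) \<and>
        piecewise_polynomial_on 0 (1/2) (mean_euler_char n)) \<and>
     (\<forall>k::nat.
        (\<lambda>n. SUP r\<in>{real k / (2 * real k + 2)<..<(real k + 1) / (2 * real k + 4)}.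
               mean_euler_char n r / real n)
          \<longlonglongrightarrow> (real k / exp 1) ^ k / fact (k + 1)) \<and>
     (\<forall>k::nat. \<forall>\<epsilon>::real. k \<ge> 1 \<and> \<epsilon> > 0 \<longrightarrow>
        (\<forall>\<^sub>F n in sequentially.
           \<forall>r\<in>{real k / (2 * real k + 2)..<(real k + 1) / (2 * real k + 4)}.
             mean_euler_char n r / real n - \<epsilon> \<le> mean_betti TYPE('f::field) (2 * k) n r / real n \<and>
             mean_betti TYPE('f) (2 * k) n r / real n \<le> mean_euler_char n r / real n))"
proof (intro conjI allI impI)
  fix n :: nat and r :: real
  assume "n > 0" "0 < r \<and> r < 1"
  then show "mean_euler_char n ((1 - r) / 2) =
      (\<Sum>k = 1..nat \<lfloor>1 / r\<rfloor>. real (n choose k) * (1 - real k * r) ^ (k - 1) * (real k * r) ^ (n - k))"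
    by (intro mean_euler_char_formula) auto
qed (use mean_betti_asymptotics mean_euler_char_sup_limit continuous_on_mean_euler_char
    piecewise_polynomial_mean_euler_char in blast)+

end
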